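(* Let $X=(X_t)_{t\ge0}$ be an additive process on $\mathbb{R}^d$ with symbols $p_s(\xi)$ and characteristic triplets $(b_s,0,\nu_s)$. Then $X$ is spatially associated if and only if $$\nu_s\big((\mathbb{R}_+^d\cup\mathbb{R}_-^d)^c\big)=0,\qquad\forall s\in\mathbb{Q}_+.$$
   Context: Notation: $\mathbb{R}_+^d=[0,\infty)^d$, $\mathbb{R}_-^d=(-\infty,0]^d$, $\mathbb{Q}_+$ the nonnegative rationals. An additive process on $\mathbb{R}^d$ is a càdlàg adapted process $X=(X_t)_{t\ge0}$ on a filtered probability space $(\Omega,\mathcal{G},(\mathcal{G}_t)_{t\ge0},\mathbb{P})$ with $X_0=0$ a.s., with $X_t-X_s$ independent of $\mathcal{G}_s$ for all $s\le t$, and stochastically continuous: $\lim_{h\searrow0}\mathbb{P}(|X_{t+h}-X_t|\ge a)=0$ for all $a>0$, $t\ge0$. For an additive process each $X_t$ is infinitely divisible, with characteristic function $\mathbb{E}e^{iu\cdot X_t}=\exp(p_t(u))$, where $$p_t(u)=iu\cdot b_t-\tfrac12u\cdot\Sigma_tu+\int_{\mathbb{R}^d\setminus\{0\}}\big(e^{iu\cdot y}-1-iu\cdot y\,\chi(y)\big)\nu_t(dy),\qquad\chi(y)=\mathbf{1}_{(0,1)}(|y|),$$ with $b_t\in\mathbb{R}^d$, $\Sigma_t$ symmetric nonnegative definite, and $\nu_t$ a Lévy measure on $\mathbb{R}^d$. The function $p_t$ is called the symbol and $(b_t,\Sigma_t,\nu_t)$ the characteristic triplet; $(b_s,0,\nu_s)$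 means $\Sigma_s=0$ for all $s$. $X$ is a time-inhomogeneous Markov process with Markov evolution $T_{s,t}f(x)=\mathbb{E}[f(X_t)\mid X_s=x]=\mathbb{E}f(X_t-X_s+x)$, $0\le s\le t$. $X$ is spatially associated if $T_{s,t}(fg)\ge T_{s,t}f\cdot T_{s,t}g$ pointwise for all $s\le t$ and all bounded continuous $f,g:\mathbb{R}^d\to\mathbb{R}$ that are non-decreasing in each component.
   Formalization: Stochastic continuity is taken two-sided (h→0 with t+h≥0) instead of only h↘0; the one-sided condition is automatic for càdlàg paths, admits fixed jump times, and makes the stated equivalence false. *)

theory Defs
  imports "HOL-Probability.Probability"
begin

text \<open>Only the restriction of the filtration and of the processes below to times \<open>t \<ge> 0\<close>
  is meaningful; their values at negative times are junk and are never constrained.\<close>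

locale filtered_prob_space = prob_space M for M :: "'w measure" +
  fixes G :: "real \<Rightarrow> 'w measure"
  assumes subalgebra_filtration: "0 \<le> t \<Longrightarrow> subalgebra M (G t)"
    and filtration_mono: "0 \<le> s \<Longrightarrow> s \<le> t \<Longrightarrow> sets (G s) \<subseteq> sets (G t)"

definition cadlag :: "(real \<Rightarrow> 'b::topological_space) \<Rightarrow> bool" where
  "cadlag f \<longleftrightarrow> (\<forall>t\<ge>0. (f \<longlongrightarrow> f t) (at_right t)) \<and> (\<forall>t>0. \<exists>l. (f \<longlongrightarrow> l) (at_left t))"

text \<open>Stochastic continuity is two-sided, as usual for additive processes: \<open>h\<close> tends to \<open>0\<close>
  through all values with \<open>t + h \<ge> 0\<close>.  For right-continuous paths the limit over \<open>h > 0\<close> alone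
  would be automatic, so that fixed times of discontinuity would be admitted and \<open>X t\<close> need not
  be infinitely divisible.\<close>

locale additive_process = filtered_prob_space M G
  for M :: "'w measure" and G :: "real \<Rightarrow> 'w measure" +
  fixes X :: "real \<Rightarrow> 'w \<Rightarrow> real ^ 'n"
  assumes adapted: "0 \<le> t \<Longrightarrow> X t \<in> borel_measurable (G t)"
    and cadlag_paths: "\<omega> \<in> space M \<Longrightarrow> cadlag (\<lambda>t. X t \<omega>)"
    and start_zero: "AE \<omega> in M. X 0 \<omega> = 0"
    and indep_increments: "0 \<le> s \<Longrightarrow> s \<le> t \<Longrightarrow>
      indep_set {(\<lambda>\<omega>. X t \<omega> - X s \<omega>) -` A \<inter> space M |A. A \<in> sets borel} (sets (G s))"
    and stoch_continuous: "0 \<le> t \<Longrightarrow> 0 < a \<Longrightarrow>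
      ((\<lambda>h. prob {\<omega> \<in> space M. a \<le> norm (X (t + h) \<omega> - X t \<omega>)}) \<longlongrightarrow> 0)
        (at 0 within {h. 0 \<le> t + h})"

definition levy_measure :: "(real ^ 'n) measure \<Rightarrow> bool" where
  "levy_measure \<nu> \<longleftrightarrow> sets \<nu> = sets borel \<and> emeasure \<nu> {0} = 0 \<and>
     (\<integral>\<^sup>+ y. ennreal (min 1 ((norm y)\<^sup>2)) \<partial>\<nu>) < \<infinity>"

definition levy_symbol ::
  "real ^ 'n \<Rightarrow> real ^ 'n ^ 'n \<Rightarrow> (real ^ 'n) measure \<Rightarrow> real ^ 'n \<Rightarrow> complex" where
  "levy_symbol b \<Sigma> \<nu> u =
     \<i> * of_real (u \<bullet> b) - of_real (u \<bullet> (\<Sigma> *v u)) / 2 +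
     (LINT y : - {0} | \<nu>. exp (\<i> * of_real (u \<bullet> y)) - 1
        - \<i> * of_real (u \<bullet> y) * of_real (indicator {0<..<1} (norm y)))"

definition characteristic_triplet ::
  "'w measure \<Rightarrow> ('w \<Rightarrow> real ^ 'n) \<Rightarrow> real ^ 'n \<Rightarrow> real ^ 'n ^ 'n \<Rightarrow> (real ^ 'n) measure \<Rightarrow> bool"
where
  "characteristic_triplet M Y b \<Sigma> \<nu> \<longleftrightarrow>
     transpose \<Sigma> = \<Sigma> \<and> (\<forall>u. 0 \<le> u \<bullet> (\<Sigma> *v u)) \<and> levy_measure \<nu> \<and>
     (\<forall>u. (LINT \<omega>|M. exp (\<i> * of_real (u \<bullet> Y \<omega>))) = exp (levy_symbol b \<Sigma> \<nu> u))"

definition markov_evolution ::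
  "'w measure \<Rightarrow> (real \<Rightarrow> 'w \<Rightarrow> real ^ 'n) \<Rightarrow> real \<Rightarrow> real \<Rightarrow> (real ^ 'n \<Rightarrow> real) \<Rightarrow> real ^ 'n \<Rightarrow> real"
where
  "markov_evolution M X s t f x = (LINT \<omega>|M. f (X t \<omega> - X s \<omega> + x))"

definition nondecreasing_each :: "(real ^ 'n \<Rightarrow> real) \<Rightarrow> bool" where
  "nondecreasing_each f \<longleftrightarrow> (\<forall>x i. mono (\<lambda>r. f (\<chi> j. if j = i then r else x $ j)))"

definition spatially_associated :: "'w measure \<Rightarrow> (real \<Rightarrow> 'w \<Rightarrow> real ^ 'n) \<Rightarrow> bool" where
  "spatially_associated M X \<longleftrightarrow>
     (\<forall>s t f g. 0 \<le> s \<and> s \<le> t \<and>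
        continuous_on UNIV f \<and> bounded (range f) \<and> nondecreasing_each f \<and>
        continuous_on UNIV g \<and> bounded (range g) \<and> nondecreasing_each g \<longrightarrow>
        (\<forall>x. markov_evolution M X s t (\<lambda>y. f y * g y) x
              \<ge> markov_evolution M X s t f x * markov_evolution M X s t g x))"

definition nonneg_orthant :: "(real ^ 'n) set" where
  "nonneg_orthant = {y. \<forall>i. 0 \<le> y $ i}"

definition nonpos_orthant :: "(real ^ 'n) set" where
  "nonpos_orthant = {y. \<forall>i. y $ i \<le> 0}"

end

theory Submission
  imports Defs
begin

text \<open>Both implications rest on one description of the jumps. Cut \<open>[0, t]\<close> into small steps and
  symmetrise every increment by subtracting an independent copy. The squared modulus of the
  characteristic function of \<open>X t\<close> is the product of those of the steps, and all factors are close to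
  \<open>1\<close> by stochastic continuity. Hence the sum \<open>\<mu>\<close> of the symmetrised increment laws satisfies
  \<open>\<integral>(1 - cos (u \<bullet> y)) d\<mu> \<le> 2 \<integral>(1 - cos (u \<bullet> y)) d\<nu>\<close> for every partition, with convergence as the
  mesh tends to zero. It follows that \<open>\<integral>H d\<mu>\<close> converges to \<open>2 \<integral>H d\<nu>\<close> for every even bounded continuous
  function \<open>H\<close> that vanishes near the origin (\<open>tendsto_integral_even\<close>). As there is no Gaussian part,
  the same holds in the form needed below for functions of order \<open>|y|^2\<close> at the origin that vanish
  almost everywhere for \<open>\<nu>\<close> (\<open>integral_mu_vanishes\<close>). Symmetrisation makes the drift disappear.

  Suppose first that \<open>\<nu>\<close> lives on the two orthants. The covariance of two monotone Lipschitz functions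
  under a law is half the mean of \<open>(f x - f y) (g x - g y)\<close>, and this product is negative only if
  \<open>x - y\<close> has coordinates of both signs; it is bounded below by a multiple of the function \<open>clash\<close> of
  \<open>x - y\<close>, which is zero on the orthants. The Markov property adds these lower bounds up over the
  steps of a partition (\<open>covariance_defect_chain\<close>), and their sum tends to zero. Approximation extends
  this from Lipschitz to continuous functions, and right-continuity of the paths from rational to
  arbitrary times.

  Conversely, suppose association. Each symmetrised increment is then associated too. For the
  non-decreasing functions \<open>ramp i \<epsilon> y\<close> and \<open>- ramp j \<epsilon> (- y)\<close>, whose product is non-positive, this
  means that the mean of \<open>ramp i \<epsilon> y * ramp j \<epsilon> (- y)\<close> is at most the product of the means of the
  factors. These are uniformly small with bounded sum, so the sum over a partition tends to zero,
  and \<open>\<nu>\<close> has no mass where \<open>y $ i > \<epsilon>\<close> and \<open>y $ j < - \<epsilon>\<close> (\<open>opposite_signs_null\<close>).\<close>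

section \<open>Functions integrable against a Levy measure\<close>

lemma levy_integrable:
  fixes f :: "real ^ 'n \<Rightarrow> 'b::{banach, second_countable_topology}"
  assumes lam: "levy_measure \<nu>" and f: "f \<in> borel_measurable borel"
    and le: "\<And>y. norm (f y) \<le> C * min 1 ((norm y)\<^sup>2)"
  shows "integrable \<nu> f"
proof -
  have sets: "sets \<nu> = sets borel" and fin: "(\<integral>\<^sup>+ y. ennreal (min 1 ((norm y)\<^sup>2)) \<partial>\<nu>) < \<infinity>"
    using lam by (auto simp: levy_measure_def)
  note [measurable_cong] = sets
  have "integrable \<nu> (\<lambda>y. C * min 1 ((norm y)\<^sup>2))"
    by (intro integrable_mult_right integrableI_nonneg) (use fin in auto)
  moreover have "f \<in> borel_measurable \<nu>" using f by measurable
  moreover have "norm (f y) \<le> norm (C * min 1 ((norm y)\<^sup>2))" for y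
    using le[of y] unfolding real_norm_def by linarith
  ultimately show ?thesis
    by (rule Bochner_Integration.integrable_bound[OF _ _ AE_I2])
qed

text \<open>A function vanishing near the origin is dominated by a multiple of \<open>min 1 |y|^2\<close>,
  because \<open>|y|^2\<close> is at least \<open>\<epsilon>^2\<close> where the function is non-zero.\<close>

lemma levy_integrable_off_zero:
  fixes f :: "real ^ 'n \<Rightarrow> real"
  assumes lam: "levy_measure \<nu>" and f: "f \<in> borel_measurable borel" and bdd: "\<And>y. \<bar>f y\<bar> \<le> B"
    and eps: "0 < \<epsilon>" and zero: "\<And>y. norm y < \<epsilon> \<Longrightarrow> f y = 0"
  shows "integrable \<nu> f"
proof (rule levy_integrable[OF lam f, where C = "B * max 1 (1 / \<epsilon>\<^sup>2)"])
  have B: "0 \<le> B" using bdd[of 0] by simp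
  fix y :: "real ^ 'n"
  show "norm (f y) \<le> B * max 1 (1 / \<epsilon>\<^sup>2) * min 1 ((norm y)\<^sup>2)"
  proof (cases "norm y < \<epsilon>")
    case True
    then show ?thesis using zero B by (simp add: max_def)
  next
    case False
    have aux: "1 \<le> c * x \<Longrightarrow> 1 \<le> c \<Longrightarrow> 1 \<le> c * min 1 x" for c x :: real by (simp add: min_def)
    have "\<epsilon>\<^sup>2 \<le> (norm y)\<^sup>2" using False eps by (intro power_mono) auto
    then have "1 \<le> 1 / \<epsilon>\<^sup>2 * (norm y)\<^sup>2" using eps by (simp add: field_simps)
    also have "\<dots> \<le> max 1 (1 / \<epsilon>\<^sup>2) * (norm y)\<^sup>2" by (intro mult_right_mono) auto
    finally have "1 \<le> max 1 (1 / \<epsilon>\<^sup>2) * min 1 ((norm y)\<^sup>2)" by (rule aux) simp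
    from mult_left_mono[OF this B] show ?thesis using bdd[of y] by (simp add: mult.assoc)
  qed
qed

text \<open>Needed for Tonelli's theorem. The sets \<open>|y| > 1/(m+1)\<close> have finite mass, and the
  remaining point \<open>0\<close> is null.\<close>

lemma levy_sigma_finite:
  assumes lam: "levy_measure (\<nu> :: (real ^ 'n) measure)"
  shows "sigma_finite_measure \<nu>"
proof -
  have sets: "sets \<nu> = sets borel" and null: "emeasure \<nu> {0} = 0"
    using lam by (auto simp: levy_measure_def)
  note [measurable_cong] = sets
  let ?A = "\<lambda>m::nat. {y :: real ^ 'n. inverse (Suc m) < norm y}"
  have m: "?A m \<in> sets \<nu>" for m unfolding sets by measurable
  have fin: "emeasure \<nu> (?A m) \<noteq> \<infinity>" for m
  proof -
    let ?r = "(inverse (real (Suc m)))\<^sup>2"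
    have r: "0 < ?r" "?r \<le> 1" by (auto simp: field_simps power_le_one)
    have "integrable \<nu> (indicator (?A m) :: _ \<Rightarrow> real)"
    proof (rule levy_integrable[OF lam, where C = "1 / ?r"])
      fix y :: "real ^ 'n"
      have "?r \<le> min 1 ((norm y)\<^sup>2)" if "y \<in> ?A m"
        using that r(2) by (auto intro!: power_mono simp del: of_nat_Suc)
      then show "norm (indicator (?A m) y :: real) \<le> 1 / ?r * min 1 ((norm y)\<^sup>2)"
        using r by (cases "y \<in> ?A m") (simp_all add: pos_le_divide_eq del: of_nat_Suc)
    qed measurable
    then show ?thesis
      using m[of m] by (simp add: integrable_indicator_iff less_top[symmetric])
  qed
  have "y \<in> insert {0} (range ?A) \<Longrightarrow> emeasure \<nu> y \<noteq> \<infinity>" for y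
    using fin null by auto
  moreover have "\<Union> (insert {0} (range ?A)) = space \<nu>"
  proof -
    have "\<exists>m. inverse (real (Suc m)) < norm y" if "y \<noteq> 0" for y :: "real ^ 'n"
      using reals_Archimedean[of "norm y"] that by auto
    moreover have "space \<nu> = UNIV" using sets_eq_imp_space_eq[OF sets] by simp
    ultimately show ?thesis by auto
  qed
  ultimately show ?thesis
    by (intro sigma_finite_measure.intro exI[of _ "insert {0} (range ?A)"]) (use m sets in auto)
qed

lemma measurable_vec_nth[measurable (raw)]:
  fixes f :: "'a \<Rightarrow> real ^ 'n"
  shows "f \<in> borel_measurable M \<Longrightarrow> (\<lambda>x. f x $ i) \<in> borel_measurable M"
  by (rule measurable_compose[where g = "\<lambda>y. y $ i"])
    (auto intro!: borel_measurable_continuous_onI continuous_intros)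

lemma one_minus_cos_le: "1 - cos (x::real) \<le> x\<^sup>2 / 2"
proof -
  have "cos (2 * (x/2)) = 1 - 2 * (sin (x/2))\<^sup>2" by (rule cos_double_sin)
  moreover have "\<bar>sin (x/2)\<bar>\<^sup>2 \<le> \<bar>x/2\<bar>\<^sup>2" by (intro power_mono abs_sin_x_le_abs_x) auto
  ultimately show ?thesis by (simp add: power_divide)
qed

lemma one_minus_cos_inner_le:
  fixes u y :: "real ^ 'n"
  shows "\<bar>1 - cos (u \<bullet> y)\<bar> \<le> max 2 ((norm u)\<^sup>2) * min 1 ((norm y)\<^sup>2)"
proof -
  have "(u \<bullet> y)\<^sup>2 \<le> (norm u * norm y)\<^sup>2"
    using Cauchy_Schwarz_ineq2[of u y] by (metis abs_ge_zero power2_abs power_mono)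
  then have "1 - cos (u \<bullet> y) \<le> (norm u)\<^sup>2 * (norm y)\<^sup>2"
    using one_minus_cos_le[of "u \<bullet> y"] by (simp add: power_mult_distrib) (smt (verit) zero_le_power2 zero_le_mult_iff)
  also have "\<dots> \<le> max 2 ((norm u)\<^sup>2) * (norm y)\<^sup>2" by (intro mult_right_mono) auto
  finally have 1: "1 - cos (u \<bullet> y) \<le> max 2 ((norm u)\<^sup>2) * (norm y)\<^sup>2" .
  have 2: "1 - cos (u \<bullet> y) \<le> max 2 ((norm u)\<^sup>2) * 1"
    using cos_ge_minus_one[of "u \<bullet> y"] by linarith
  show ?thesis using 1 2 cos_le_one[of "u \<bullet> y"] by (auto simp: min_def)
qed

text \<open>Averaging the exponent \<open>1 - cos\<close> over Gaussian frequencies gives a function that is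
  comparable to \<open>min 1 c^2\<close>. In this way bounds on characteristic exponents turn into bounds on
  masses, both far away from the origin and close to it.\<close>

lemma gaussian_average_one_minus_cos:
  "(\<integral>s. 1 - cos (s * c) \<partial>std_normal_distribution) = 1 - exp (- (c\<^sup>2) / 2)"
proof -
  interpret real_distribution std_normal_distribution by (rule real_dist_normal_dist)
  have i: "integrable std_normal_distribution (\<lambda>s. iexp (c * s))"
    by (rule integrable_const_bound[where B = 1]) auto
  have "(\<integral>s. Re (iexp (c * s)) \<partial>std_normal_distribution) = exp (- (c\<^sup>2) / 2)"
    using fun_cong[OF char_std_normal_distribution, of c] integral_Re[OF i]
    by (simp add: char_def)
  moreover have "Re (iexp (c * s)) = cos (s * c)" for s
    by (simp add: Re_exp mult.commute)
  moreover have "integrable std_normal_distribution (\<lambda>s. cos (s * c))"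
    by (rule integrable_const_bound[where B = 1]) auto
  ultimately show ?thesis
    using prob_space by (simp add: Bochner_Integration.integral_diff)
qed

definition gauss_weight :: "real \<Rightarrow> real ^ 'n \<Rightarrow> real" where
  "gauss_weight \<sigma> y = (\<Sum>i\<in>UNIV. 1 - exp (- ((\<sigma> * y $ i)\<^sup>2) / 2))"

lemma gauss_weight_measurable[measurable]: "gauss_weight \<sigma> \<in> borel_measurable borel"
  unfolding gauss_weight_def by measurable

lemma gauss_weight_nonneg: "0 \<le> gauss_weight \<sigma> y"
  unfolding gauss_weight_def by (intro sum_nonneg) simp

text \<open>Tonelli: integrating the weight amounts to averaging characteristic exponents, so that an
  inequality between exponents passes to the weights.\<close>

lemma nn_integral_gauss_weight_term:
  fixes N :: "(real ^ 'n) measure"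
  assumes sf: "sigma_finite_measure N" and sets: "sets N = sets borel"
  shows "(\<integral>\<^sup>+ y. ennreal (1 - exp (- ((\<sigma> * y $ i)\<^sup>2) / 2)) \<partial>N) =
    (\<integral>\<^sup>+ s. (\<integral>\<^sup>+ y. ennreal (1 - cos (axis i (\<sigma> * s) \<bullet> y)) \<partial>N) \<partial>std_normal_distribution)"
proof -
  note [measurable_cong] = sets
  interpret S: real_distribution std_normal_distribution by (rule real_dist_normal_dist)
  interpret N: sigma_finite_measure N by fact
  interpret P: pair_sigma_finite N std_normal_distribution ..
  have "ennreal (1 - exp (- ((\<sigma> * y $ i)\<^sup>2) / 2)) =
      (\<integral>\<^sup>+ s. ennreal (1 - cos (s * (\<sigma> * y $ i))) \<partial>std_normal_distribution)" for y
    unfolding gaussian_average_one_minus_cos[symmetric]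
    by (rule nn_integral_eq_integral[symmetric])
      (auto intro!: S.integrable_const_bound[where B = 2] simp: abs_le_iff cos_ge_minus_one intro: add_increasing)
  then have "(\<integral>\<^sup>+ y. ennreal (1 - exp (- ((\<sigma> * y $ i)\<^sup>2) / 2)) \<partial>N) =
     (\<integral>\<^sup>+ y. (\<integral>\<^sup>+ s. ennreal (1 - cos (s * (\<sigma> * y $ i))) \<partial>std_normal_distribution) \<partial>N)"
    by simp
  also have "\<dots> = (\<integral>\<^sup>+ s. (\<integral>\<^sup>+ y. ennreal (1 - cos (s * (\<sigma> * y $ i))) \<partial>N) \<partial>std_normal_distribution)"
    by (rule P.Fubini'[symmetric]) measurable
  finally show ?thesis by (simp add: inner_axis' mult_ac)
qed

lemma gauss_weight_le_small:
  fixes y :: "real ^ 'n"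
  assumes "0 \<le> \<sigma>"
  shows "gauss_weight \<sigma> y \<le> real CARD('n) * min 1 (\<sigma>\<^sup>2 * (norm y)\<^sup>2)"
proof -
  have "1 - exp (- ((\<sigma> * y $ i)\<^sup>2) / 2) \<le> min 1 (\<sigma>\<^sup>2 * (norm y)\<^sup>2)" for i
  proof -
    have "\<bar>y $ i\<bar>\<^sup>2 \<le> (norm y)\<^sup>2" by (intro power_mono component_le_norm_cart) auto
    then have "(\<sigma> * y $ i)\<^sup>2 \<le> \<sigma>\<^sup>2 * (norm y)\<^sup>2"
      by (auto simp: power_mult_distrib intro: mult_left_mono)
    moreover have "1 + (- ((\<sigma> * y $ i)\<^sup>2) / 2) \<le> exp (- ((\<sigma> * y $ i)\<^sup>2) / 2)"
      by (rule exp_ge_add_one_self)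
    moreover have "0 \<le> (\<sigma> * y $ i)\<^sup>2" by simp
    ultimately have "1 - exp (- ((\<sigma> * y $ i)\<^sup>2) / 2) \<le> \<sigma>\<^sup>2 * (norm y)\<^sup>2" by linarith
    then show ?thesis by simp
  qed
  then have "gauss_weight \<sigma> y \<le> (\<Sum>i\<in>(UNIV::'n set). min 1 (\<sigma>\<^sup>2 * (norm y)\<^sup>2))"
    unfolding gauss_weight_def by (intro sum_mono)
  then show ?thesis by simp
qed

text \<open>With small \<open>\<sigma>\<close> the weight controls the tails.\<close>

lemma gauss_weight_ge_half:
  fixes y :: "real ^ 'n"
  assumes "pi / 2 \<le> \<bar>\<sigma> * y $ i\<bar>"
  shows "1 / 2 \<le> gauss_weight \<sigma> y"
proof -
  have "(3/2)\<^sup>2 \<le> \<bar>\<sigma> * y $ i\<bar>\<^sup>2" using assms pi_gt3 by (intro power_mono) auto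
  then have "1 \<le> (\<sigma> * y $ i)\<^sup>2 / 2" by (simp add: power2_eq_square)
  then have "exp (- ((\<sigma> * y $ i)\<^sup>2) / 2) \<le> exp (-1)" by simp
  also have "\<dots> \<le> 1 / 2" 
    using exp_ge_add_one_self[of 1] by (simp add: exp_minus field_simps)
  finally have "1 / 2 \<le> 1 - exp (- ((\<sigma> * y $ i)\<^sup>2) / 2)" by simp
  also have "\<dots> \<le> gauss_weight \<sigma> y" unfolding gauss_weight_def
    by (intro member_le_sum) auto
  finally show ?thesis .
qed

text \<open>With large \<open>\<sigma>\<close> the weight controls second moments near the origin.\<close>

lemma gauss_weight_ge_square:
  fixes y :: "real ^ 'n"
  assumes "0 \<le> \<sigma>" "\<sigma> * norm y \<le> 1"
  shows "\<sigma>\<^sup>2 * (norm y)\<^sup>2 / 4 \<le> gauss_weight \<sigma> y"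
proof -
  have "(\<sigma> * y $ i)\<^sup>2 / 4 \<le> 1 - exp (- ((\<sigma> * y $ i)\<^sup>2) / 2)" for i
  proof -
    let ?t = "(\<sigma> * y $ i)\<^sup>2 / 2"
    have "\<bar>\<sigma> * y $ i\<bar> \<le> \<sigma> * norm y"
      using assms component_le_norm_cart[of y i] by (simp add: abs_mult mult_left_mono)
    then have "\<bar>\<sigma> * y $ i\<bar>\<^sup>2 \<le> 1\<^sup>2" using assms by (intro power_mono) auto
    then have t: "0 \<le> ?t" "?t \<le> 1" by auto
    have "1 + ?t \<le> exp ?t" by (rule exp_ge_add_one_self)
    then have "exp (- ?t) \<le> 1 / (1 + ?t)"
      unfolding exp_minus inverse_eq_divide using t by (intro divide_left_mono mult_pos_pos add_pos_nonneg) auto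
    also have "\<dots> \<le> 1 - ?t / 2"
    proof -
      have "?t * ?t \<le> ?t * 1" using t by (intro mult_left_mono) auto
      then have "1 \<le> (1 - ?t / 2) * (1 + ?t)" by (simp add: algebra_simps)
      then show ?thesis using t(1) by (subst pos_divide_le_eq) (auto intro: add_pos_nonneg)
    qed
    finally show ?thesis by simp
  qed
  then have "(\<Sum>i\<in>UNIV. (\<sigma> * y $ i)\<^sup>2 / 4) \<le> gauss_weight \<sigma> y"
    unfolding gauss_weight_def by (intro sum_mono)
  moreover have "(\<Sum>i\<in>UNIV. (\<sigma> * y $ i)\<^sup>2 / 4) = \<sigma>\<^sup>2 * (norm y)\<^sup>2 / 4"
    by (simp add: power_mult_distrib sum_distrib_left[symmetric] sum_divide_distrib[symmetric]
       norm_vec_def L2_set_def sum_nonneg)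
  ultimately show ?thesis by simp
qed

lemma gauss_weight_integrable:
  fixes \<nu> :: "(real ^ 'n) measure"
  assumes "levy_measure \<nu>" "0 \<le> \<sigma>"
  shows "integrable \<nu> (gauss_weight \<sigma>)"
proof (rule levy_integrable[OF assms(1), where C = "real CARD('n) * max 1 (\<sigma>\<^sup>2)"])
  fix y :: "real ^ 'n"
  have "min 1 (\<sigma>\<^sup>2 * (norm y)\<^sup>2) \<le> max 1 (\<sigma>\<^sup>2) * min 1 ((norm y)\<^sup>2)"
  proof (cases "(norm y)\<^sup>2 \<le> 1")
    case True
    have "\<sigma>\<^sup>2 * (norm y)\<^sup>2 \<le> max 1 (\<sigma>\<^sup>2) * (norm y)\<^sup>2" by (intro mult_right_mono) auto
    then show ?thesis using True by simp
  qed simp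
  then have "real CARD('n) * min 1 (\<sigma>\<^sup>2 * (norm y)\<^sup>2) \<le> real CARD('n) * (max 1 (\<sigma>\<^sup>2) * min 1 ((norm y)\<^sup>2))"
    by (intro mult_left_mono) auto
  then show "norm (gauss_weight \<sigma> y) \<le> real CARD('n) * max 1 (\<sigma>\<^sup>2) * min 1 ((norm y)\<^sup>2)"
    using gauss_weight_le_small[OF assms(2), of y] gauss_weight_nonneg[of \<sigma> y] unfolding mult.assoc real_norm_def by linarith
qed simp

lemma gauss_weight_tail_vanishes:
  fixes \<nu> :: "(real ^ 'n) measure"
  assumes lam: "levy_measure \<nu>"
  shows "(\<lambda>m. \<integral>y. gauss_weight (1 / Suc m) y \<partial>\<nu>) \<longlonglongrightarrow> 0"
proof -
  have sets: "sets \<nu> = sets borel" using lam by (auto simp: levy_measure_def)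
  note [measurable_cong] = sets
  have "(\<lambda>m. \<integral>y. gauss_weight (1 / Suc m) y \<partial>\<nu>) \<longlonglongrightarrow> (\<integral>y. 0 \<partial>\<nu>)"
  proof (rule integral_dominated_convergence[where w = "\<lambda>y. real CARD('n) * min 1 ((norm y)\<^sup>2)"])
    show "integrable \<nu> (\<lambda>y. real CARD('n) * min 1 ((norm y)\<^sup>2))"
      by (rule levy_integrable[OF lam, where C = "real CARD('n)"]) auto
    show "AE y in \<nu>. (\<lambda>m. gauss_weight (1 / Suc m) y) \<longlonglongrightarrow> 0"
    proof (rule AE_I2)
      fix y :: "real ^ 'n"
      have "(\<lambda>m. 1 - exp (- (((1 / Suc m) * y $ i)\<^sup>2) / 2)) \<longlonglongrightarrow> 1 - exp (- ((0 * y $ i)\<^sup>2) / 2)" for i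
        by (intro tendsto_intros LIMSEQ_Suc[OF lim_1_over_n]) simp
      then show "(\<lambda>m. gauss_weight (1 / Suc m) y) \<longlonglongrightarrow> 0"
        unfolding gauss_weight_def by (auto intro!: tendsto_null_sum)
    qed
    fix m :: nat
    show "AE y in \<nu>. norm (gauss_weight (1 / Suc m) y) \<le> real CARD('n) * min 1 ((norm y)\<^sup>2)"
    proof (rule AE_I2)
      fix y :: "real ^ 'n"
      have "(1 / Suc m)\<^sup>2 * (norm y)\<^sup>2 \<le> 1 * (norm y)\<^sup>2" 
        by (intro mult_right_mono) (auto simp: power_le_one)
      then have "min 1 ((1 / Suc m)\<^sup>2 * (norm y)\<^sup>2) \<le> min 1 ((norm y)\<^sup>2)" by simp
      then have "real CARD('n) * min 1 ((1 / Suc m)\<^sup>2 * (norm y)\<^sup>2) \<le> real CARD('n) * min 1 ((norm y)\<^sup>2)"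
        by (rule mult_left_mono) auto
      then show "norm (gauss_weight (1 / Suc m) y) \<le> real CARD('n) * min 1 ((norm y)\<^sup>2)"
        using gauss_weight_le_small[of "1 / Suc m" y] gauss_weight_nonneg[of "1 / Suc m" y]
        unfolding real_norm_def by (smt (verit) of_nat_0_le_iff zero_le_divide_1_iff)
    qed
  qed measurable
  then show ?thesis by simp
qed

text \<open>This is where the absence of a Gaussian part enters: a Levy measure has no infinitesimal
  second moment at the origin, so its weight grows more slowly than \<open>\<sigma>^2\<close>. A Gaussian component
  would contribute a term of exact order \<open>\<sigma>^2\<close>.\<close>

lemma gauss_weight_core_vanishes:
  fixes \<nu> :: "(real ^ 'n) measure"
  assumes lam: "levy_measure \<nu>"
  shows "(\<lambda>m. (\<integral>y. gauss_weight (real (Suc m)) y \<partial>\<nu>) / (real (Suc m))\<^sup>2) \<longlonglongrightarrow> 0"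
proof -
  have sets: "sets \<nu> = sets borel" using lam by (auto simp: levy_measure_def)
  note [measurable_cong] = sets
  have "(\<lambda>m. \<integral>y. gauss_weight (real (Suc m)) y / (real (Suc m))\<^sup>2 \<partial>\<nu>) \<longlonglongrightarrow> (\<integral>y. 0 \<partial>\<nu>)"
  proof (rule integral_dominated_convergence[where w = "\<lambda>y. real CARD('n) * min 1 ((norm y)\<^sup>2)"])
    show "integrable \<nu> (\<lambda>y. real CARD('n) * min 1 ((norm y)\<^sup>2))"
      by (rule levy_integrable[OF lam, where C = "real CARD('n)"]) auto
    have le: "gauss_weight (real (Suc m)) y / (real (Suc m))\<^sup>2 \<le> real CARD('n) * min ((1 / Suc m)\<^sup>2) ((norm y)\<^sup>2)"
      for m and y :: "real ^ 'n"
    proof -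
      have "real CARD('n) * min 1 ((real (Suc m))\<^sup>2 * (norm y)\<^sup>2) / (real (Suc m))\<^sup>2
         = real CARD('n) * min ((1 / Suc m)\<^sup>2) ((norm y)\<^sup>2)"
        by (auto simp: min_def field_simps power_divide simp del: of_nat_Suc)
      then show ?thesis using gauss_weight_le_small[of "Suc m" y] 
        by (metis divide_right_mono of_nat_0_le_iff zero_le_power2 of_nat_power)
    qed
    show "AE y in \<nu>. (\<lambda>m. gauss_weight (real (Suc m)) y / (real (Suc m))\<^sup>2) \<longlonglongrightarrow> 0"
    proof (rule AE_I2)
      fix y :: "real ^ 'n"
      show "(\<lambda>m. gauss_weight (real (Suc m)) y / (real (Suc m))\<^sup>2) \<longlonglongrightarrow> 0"
      proof (rule tendsto_sandwich[where f = "\<lambda>m. 0" and h = "\<lambda>m. real CARD('n) * (1 / Suc m)\<^sup>2"])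
        show "\<forall>\<^sub>F m in sequentially. gauss_weight (real (Suc m)) y / (real (Suc m))\<^sup>2 \<le> real CARD('n) * (1 / Suc m)\<^sup>2"
        proof (intro always_eventually allI)
          fix m
          have "real CARD('n) * min ((1 / Suc m)\<^sup>2) ((norm y)\<^sup>2) \<le> real CARD('n) * (1 / Suc m)\<^sup>2"
            by (intro mult_left_mono) auto
          with le[of m y] show "gauss_weight (real (Suc m)) y / (real (Suc m))\<^sup>2 \<le> real CARD('n) * (1 / Suc m)\<^sup>2" by linarith
        qed
        have "(\<lambda>m. real CARD('n) * (1 / Suc m)\<^sup>2) \<longlonglongrightarrow> real CARD('n) * 0\<^sup>2"
          by (intro tendsto_intros LIMSEQ_Suc[OF lim_1_over_n])
        then show "(\<lambda>m. real CARD('n) * (1 / Suc m)\<^sup>2) \<longlonglongrightarrow> 0" by simp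
        show "(\<lambda>m::nat. 0 :: real) \<longlonglongrightarrow> 0" by simp
        show "\<forall>\<^sub>F m in sequentially. 0 \<le> gauss_weight (real (Suc m)) y / (real (Suc m))\<^sup>2"
          by (intro always_eventually allI divide_nonneg_nonneg gauss_weight_nonneg) simp
      qed
    qed
    fix m :: nat
    show "AE y in \<nu>. norm (gauss_weight (real (Suc m)) y / (real (Suc m))\<^sup>2) \<le> real CARD('n) * min 1 ((norm y)\<^sup>2)"
    proof (rule AE_I2)
      fix y :: "real ^ 'n"
      have "(1 / Suc m)\<^sup>2 \<le> 1" by (auto simp: power_le_one)
      then have "real CARD('n) * min ((1 / Suc m)\<^sup>2) ((norm y)\<^sup>2) \<le> real CARD('n) * min 1 ((norm y)\<^sup>2)"
        by (intro mult_left_mono min.mono) auto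
      then show "norm (gauss_weight (real (Suc m)) y / (real (Suc m))\<^sup>2) \<le> real CARD('n) * min 1 ((norm y)\<^sup>2)"
        using le[of m y] divide_nonneg_nonneg[OF gauss_weight_nonneg[of "real (Suc m)" y], of "(real (Suc m))\<^sup>2"]
        by (subst real_norm_def, subst abs_of_nonneg) (simp, rule order_trans)
    qed
  qed measurable
  then show ?thesis by simp
qed

section \<open>Trigonometric polynomials\<close>

inductive trig_poly :: "(real ^ 'n \<Rightarrow> real) \<Rightarrow> bool" where
  cos: "trig_poly (\<lambda>y. c * cos (u \<bullet> y))"
| sin: "trig_poly (\<lambda>y. c * sin (u \<bullet> y))"
| add: "trig_poly p \<Longrightarrow> trig_poly q \<Longrightarrow> trig_poly (\<lambda>y. p y + q y)"

lemma trig_poly_const: "trig_poly (\<lambda>y. c)"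
  using trig_poly.cos[of c 0] by simp

text \<open>The product-to-sum formulas.\<close>

lemma trig_poly_mult:
  assumes "trig_poly p" "trig_poly q"
  shows "trig_poly (\<lambda>y. p y * q y)"
  using assms
proof (induction p rule: trig_poly.induct)
  case (cos c u)
  from cos show ?case
  proof (induction q rule: trig_poly.induct)
    case (cos d v)
    have "trig_poly (\<lambda>y. c * d / 2 * cos ((u - v) \<bullet> y) + c * d / 2 * cos ((u + v) \<bullet> y))"
      by (intro trig_poly.intros)
    moreover have "c * d / 2 * cos ((u - v) \<bullet> y) + c * d / 2 * cos ((u + v) \<bullet> y) = c * cos (u \<bullet> y) * (d * cos (v \<bullet> y))" for y
      by (simp add: inner_diff_left inner_add_left cos_add cos_diff algebra_simps)
    ultimately show ?case by simp
  next
    case (sin d v)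
    have "trig_poly (\<lambda>y. c * d / 2 * sin ((u + v) \<bullet> y) + - c * d / 2 * sin ((u - v) \<bullet> y))"
      by (intro trig_poly.intros)
    moreover have "c * d / 2 * sin ((u + v) \<bullet> y) + - c * d / 2 * sin ((u - v) \<bullet> y) = c * cos (u \<bullet> y) * (d * sin (v \<bullet> y))" for y
      by (simp add: inner_diff_left inner_add_left sin_add sin_diff algebra_simps)
    ultimately show ?case by simp
  next
    case (add p q)
    then show ?case by (auto simp: distrib_left intro: trig_poly.add)
  qed
next
  case (sin c u)
  from sin show ?case
  proof (induction q rule: trig_poly.induct)
    case (sin d v)
    have "trig_poly (\<lambda>y. c * d / 2 * cos ((u - v) \<bullet> y) + - c * d / 2 * cos ((u + v) \<bullet> y))"
      by (intro trig_poly.intros)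
    moreover have "c * d / 2 * cos ((u - v) \<bullet> y) + - c * d / 2 * cos ((u + v) \<bullet> y) = c * sin (u \<bullet> y) * (d * sin (v \<bullet> y))" for y
      by (simp add: inner_diff_left inner_add_left cos_add cos_diff algebra_simps)
    ultimately show ?case by simp
  next
    case (cos d v)
    have "trig_poly (\<lambda>y. c * d / 2 * sin ((u + v) \<bullet> y) + c * d / 2 * sin ((u - v) \<bullet> y))"
      by (intro trig_poly.intros)
    moreover have "c * d / 2 * sin ((u + v) \<bullet> y) + c * d / 2 * sin ((u - v) \<bullet> y) = c * sin (u \<bullet> y) * (d * cos (v \<bullet> y))" for y
      by (simp add: inner_diff_left inner_add_left sin_add sin_diff algebra_simps)
    ultimately show ?case by simp
  next
    case (add p q)
    then show ?case by (auto simp: distrib_left intro: trig_poly.add)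
  qed
next
  case (add p p')
  then show ?case by (auto simp: distrib_right intro: trig_poly.add)
qed

lemma trig_poly_sum:
  "finite I \<Longrightarrow> (\<And>i. i \<in> I \<Longrightarrow> trig_poly (p i)) \<Longrightarrow> trig_poly (\<lambda>y. \<Sum>i\<in>I. p i y)"
  by (induction I rule: finite_induct) (auto intro: trig_poly.add trig_poly_const)

text \<open>The substitution \<open>s = sin (a y)\<close> wraps the space onto the compact cube \<open>[-1,1]^n\<close>.
  Polynomial approximation on the cube thus becomes approximation by trigonometric polynomials that
  is uniform on the whole space.\<close>

lemma trig_poly_polynomial_sin:
  assumes "real_polynomial_function P"
  shows "trig_poly (\<lambda>y :: real ^ 'n. P (\<chi> i. sin (a * y $ i)))"
  using assms
proof (induction P rule: real_polynomial_function.induct)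
  case (linear f)
  interpret bounded_linear f by fact
  have "f (\<chi> i. sin (a * y $ i)) = (\<Sum>i\<in>UNIV. f (axis i 1) * sin (axis i a \<bullet> y))" for y
  proof -
    have "(\<chi> i. sin (a * y $ i)) = (\<Sum>i\<in>UNIV. sin (a * y $ i) *\<^sub>R axis i 1)"
      by (simp add: vec_eq_iff axis_def if_distrib cong: if_cong)
    then show ?thesis by (simp only: sum scaleR) (simp add: inner_axis' mult.commute)
  qed
  then show ?case by (auto intro!: trig_poly_sum trig_poly.sin)
qed (auto intro: trig_poly_const trig_poly.add trig_poly_mult)

lemma trig_poly_continuous: "trig_poly p \<Longrightarrow> continuous_on UNIV p"
  by (induction rule: trig_poly.induct) (auto intro!: continuous_intros)

section \<open>Convergence of measures from their characteristic exponents\<close>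

text \<open>A continuity theorem for Levy measures. The finite measures \<open>\<mu> m\<close> stand for sums of laws
  of small symmetric increments. Their exponents \<open>\<integral>(1 - cos (u \<bullet> y))\<close> stay below that of \<open>\<nu>\<close> and
  converge to it. Domination makes every estimate uniform in \<open>m\<close>: a bound on tails or on the mass
  near the origin has to be proved for \<open>\<nu>\<close> only.\<close>

locale levy_dominated =
  fixes \<mu> :: "nat \<Rightarrow> (real ^ 'n) measure" and \<nu> :: "(real ^ 'n) measure"
  assumes fin: "finite_measure (\<mu> m)" and sets_mu: "sets (\<mu> m) = sets borel"
    and levy: "levy_measure \<nu>"
    and dom: "(\<integral>y. 1 - cos (u \<bullet> y) \<partial>\<mu> m) \<le> (\<integral>y. 1 - cos (u \<bullet> y) \<partial>\<nu>)"
    and conv: "(\<lambda>m. \<integral>y. 1 - cos (u \<bullet> y) \<partial>\<mu> m) \<longlonglongrightarrow> (\<integral>y. 1 - cos (u \<bullet> y) \<partial>\<nu>)"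
begin

lemma sets_lam: "sets \<nu> = sets borel" using levy by (auto simp: levy_measure_def)

lemmas [measurable_cong] = sets_mu sets_lam

lemma integrable_mu:
  fixes f :: "real ^ 'n \<Rightarrow> real"
  assumes "f \<in> borel_measurable borel" "\<And>y. \<bar>f y\<bar> \<le> B"
  shows "integrable (\<mu> m) f"
  using finite_measure.integrable_const_bound[OF fin, of f B m] assms by simp

lemma integrable_one_minus_cos: "integrable \<nu> (\<lambda>y. 1 - cos (u \<bullet> y))"
  by (rule levy_integrable[OF levy, where C = "max 2 ((norm u)\<^sup>2)"])
    (use one_minus_cos_inner_le[of u] in auto)

lemma integrable_mu_one_minus_cos: "integrable (\<mu> m) (\<lambda>y. 1 - cos (u \<bullet> y))"
  by (rule integrable_mu[where B = 2]) (auto simp: abs_le_iff cos_ge_minus_one intro: add_increasing)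

lemma integrable_gauss_weight_mu: "integrable (\<mu> m) (gauss_weight \<sigma>)"
proof (rule integrable_mu[where B = "real CARD('n)"])
  fix y :: "real ^ 'n"
  have "gauss_weight \<sigma> y \<le> (\<Sum>i\<in>(UNIV::'n set). 1)" unfolding gauss_weight_def by (intro sum_mono) simp
  then show "\<bar>gauss_weight \<sigma> y\<bar> \<le> real CARD('n)" using gauss_weight_nonneg[of \<sigma> y] by simp
qed simp

lemma gauss_weight_mu_le:
  assumes "0 \<le> \<sigma>"
  shows "(\<integral>y. gauss_weight \<sigma> y \<partial>\<mu> m) \<le> (\<integral>y. gauss_weight \<sigma> y \<partial>\<nu>)"
proof -
  interpret mu: finite_measure "\<mu> m" by (rule fin)
  have sf: "sigma_finite_measure (\<mu> m)" ..
  have nn: "(\<integral>\<^sup>+ y. ennreal (gauss_weight \<sigma> y) \<partial>N) =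
      (\<Sum>i\<in>UNIV. \<integral>\<^sup>+ y. ennreal (1 - exp (- ((\<sigma> * y $ i)\<^sup>2) / 2)) \<partial>N)"
    if "sets N = sets borel" for N :: "(real ^ 'n) measure"
    unfolding gauss_weight_def 
    by (subst nn_integral_sum[symmetric])
      (use that in \<open>auto simp: sum_ennreal intro!: measurable_compose[OF _ measurable_ennreal] borel_measurable_diff borel_measurable_const\<close>)
  have "(\<integral>\<^sup>+ y. ennreal (gauss_weight \<sigma> y) \<partial>\<mu> m) \<le> (\<integral>\<^sup>+ y. ennreal (gauss_weight \<sigma> y) \<partial>\<nu>)"
    unfolding nn[OF sets_mu] nn[OF sets_lam]
  proof (intro sum_mono)
    fix i
    show "(\<integral>\<^sup>+ y. ennreal (1 - exp (- ((\<sigma> * y $ i)\<^sup>2) / 2)) \<partial>\<mu> m) \<le>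
      (\<integral>\<^sup>+ y. ennreal (1 - exp (- ((\<sigma> * y $ i)\<^sup>2) / 2)) \<partial>\<nu>)"
      unfolding nn_integral_gauss_weight_term[OF sf sets_mu]
        nn_integral_gauss_weight_term[OF levy_sigma_finite[OF levy] sets_lam]
    proof (intro nn_integral_mono)
      fix s
      show "(\<integral>\<^sup>+ y. ennreal (1 - cos (axis i (\<sigma> * s) \<bullet> y)) \<partial>\<mu> m) \<le>
        (\<integral>\<^sup>+ y. ennreal (1 - cos (axis i (\<sigma> * s) \<bullet> y)) \<partial>\<nu>)"
        using dom[where u = "axis i (\<sigma> * s)" and m = m]
        by (subst (1 2) nn_integral_eq_integral[OF _ AE_I2])
           (auto intro: integrable_mu_one_minus_cos integrable_one_minus_cos ennreal_leI)
    qed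
  qed
  then show ?thesis
    by (subst (asm) (1 2) nn_integral_eq_integral[OF _ AE_I2])
      (auto simp: gauss_weight_nonneg integral_nonneg_AE integrable_gauss_weight_mu gauss_weight_integrable[OF levy assms])
qed

text \<open>The even part of a trigonometric polynomial, with its value at the origin subtracted, is a
  linear combination of functions \<open>1 - cos (u \<bullet> y)\<close>, for which convergence is assumed.\<close>

lemma trig_poly_even_defect:
  assumes "trig_poly q"
  shows "\<exists>C\<ge>0. \<forall>y. \<bar>q 0 - (q y + q (- y)) / 2\<bar> \<le> C * min 1 ((norm y)\<^sup>2)"
    and "(\<lambda>m. \<integral>y. q 0 - (q y + q (- y)) / 2 \<partial>\<mu> m) \<longlonglongrightarrow> (\<integral>y. q 0 - (q y + q (- y)) / 2 \<partial>\<nu>)"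
proof -
  have "(\<exists>C\<ge>0. \<forall>y. \<bar>q 0 - (q y + q (- y)) / 2\<bar> \<le> C * min 1 ((norm y)\<^sup>2)) \<and>
     (\<lambda>m. \<integral>y. q 0 - (q y + q (- y)) / 2 \<partial>\<mu> m) \<longlonglongrightarrow> (\<integral>y. q 0 - (q y + q (- y)) / 2 \<partial>\<nu>)"
    using assms
  proof (induction q rule: trig_poly.induct)
    case (cos c u)
    have eq: "c * cos (u \<bullet> 0) - (c * cos (u \<bullet> y) + c * cos (u \<bullet> - y)) / 2 = c * (1 - cos (u \<bullet> y))" for y
      by (simp add: algebra_simps)
    show ?case unfolding eq
    proof
      have "\<bar>c * (1 - cos (u \<bullet> y))\<bar> \<le> (\<bar>c\<bar> * max 2 ((norm u)\<^sup>2)) * min 1 ((norm y)\<^sup>2)" for y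
        using mult_left_mono[OF one_minus_cos_inner_le[of u y], of "\<bar>c\<bar>"] by (simp add: abs_mult mult.assoc)
      then show "\<exists>C\<ge>0. \<forall>y. \<bar>c * (1 - cos (u \<bullet> y))\<bar> \<le> C * min 1 ((norm y)\<^sup>2)"
        by (intro exI[of _ "\<bar>c\<bar> * max 2 ((norm u)\<^sup>2)"]) auto
    qed (auto intro!: tendsto_mult conv)
  next
    case (sin c u)
    then show ?case by auto
  next
    case (add p q)
    from add.IH obtain C D where C: "0 \<le> C" "\<And>y. \<bar>p 0 - (p y + p (- y)) / 2\<bar> \<le> C * min 1 ((norm y)\<^sup>2)"
      and D: "0 \<le> D" "\<And>y. \<bar>q 0 - (q y + q (- y)) / 2\<bar> \<le> D * min 1 ((norm y)\<^sup>2)" by auto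
    have [measurable]: "p \<in> borel_measurable borel" "q \<in> borel_measurable borel"
      using add.hyps trig_poly_continuous by (auto intro: borel_measurable_continuous_onI)
    have le: "C * min 1 ((norm y)\<^sup>2) \<le> C" "D * min 1 ((norm y)\<^sup>2) \<le> D" for y :: "real ^ 'n"
      using C(1) D(1) by (auto intro: mult_left_le)
    have i: "integrable \<nu> (\<lambda>y. p 0 - (p y + p (- y)) / 2)" "integrable \<nu> (\<lambda>y. q 0 - (q y + q (- y)) / 2)"
      "integrable (\<mu> m) (\<lambda>y. p 0 - (p y + p (- y)) / 2)" "integrable (\<mu> m) (\<lambda>y. q 0 - (q y + q (- y)) / 2)" for m
    proof -
      show "integrable \<nu> (\<lambda>y. p 0 - (p y + p (- y)) / 2)"
        by (rule levy_integrable[OF levy, where C = C]) (use C in auto)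
      show "integrable \<nu> (\<lambda>y. q 0 - (q y + q (- y)) / 2)"
        by (rule levy_integrable[OF levy, where C = D]) (use D in auto)
      show "integrable (\<mu> m) (\<lambda>y. p 0 - (p y + p (- y)) / 2)"
        by (rule integrable_mu[where B = C]) (auto intro: order_trans[OF C(2) le(1)])
      show "integrable (\<mu> m) (\<lambda>y. q 0 - (q y + q (- y)) / 2)"
        by (rule integrable_mu[where B = D]) (auto intro: order_trans[OF D(2) le(2)])
    qed
    have eq: "p 0 + q 0 - (p y + q y + (p (- y) + q (- y))) / 2 =
      (p 0 - (p y + p (- y)) / 2) + (q 0 - (q y + q (- y)) / 2)" for y by (simp add: field_simps)
    show ?case unfolding eq
    proof
      have "\<bar>(p 0 - (p y + p (- y)) / 2) + (q 0 - (q y + q (- y)) / 2)\<bar> \<le> (C + D) * min 1 ((norm y)\<^sup>2)" for y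
        using C(2)[of y] D(2)[of y] by (simp add: distrib_right)
      then show "\<exists>C\<ge>0. \<forall>y. \<bar>(p 0 - (p y + p (- y)) / 2) + (q 0 - (q y + q (- y)) / 2)\<bar> \<le> C * min 1 ((norm y)\<^sup>2)"
        using C(1) D(1) by (intro exI[of _ "C + D"]) auto
      show "(\<lambda>m. \<integral>y. (p 0 - (p y + p (- y)) / 2) + (q 0 - (q y + q (- y)) / 2) \<partial>\<mu> m)
        \<longlonglongrightarrow> (\<integral>y. (p 0 - (p y + p (- y)) / 2) + (q 0 - (q y + q (- y)) / 2) \<partial>\<nu>)"
        by (subst (1 2) Bochner_Integration.integral_add) (use i add.IH in \<open>auto intro!: tendsto_add\<close>)
    qed
  qed
  then show "\<exists>C\<ge>0. \<forall>y. \<bar>q 0 - (q y + q (- y)) / 2\<bar> \<le> C * min 1 ((norm y)\<^sup>2)"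
    and "(\<lambda>m. \<integral>y. q 0 - (q y + q (- y)) / 2 \<partial>\<mu> m) \<longlonglongrightarrow> (\<integral>y. q 0 - (q y + q (- y)) / 2 \<partial>\<nu>)" by auto
qed

text \<open>For small \<open>a\<close> the function \<open>H\<close> agrees with \<open>H (arcsin (sin (a y)) / a)\<close> on a large box.
  The latter is a function \<open>H (A s)\<close> of \<open>s = sin (a y)\<close> on the cube; it vanishes near \<open>s = 0\<close>, so
  it equals \<open>|s|^2\<close> times a continuous function, to which Stone and Weierstrass apply. The factor
  \<open>|s|^2\<close> keeps the error integrable although the total masses of the measures are unbounded:
  \<open>|sin (a y)|^2\<close> is a sum of functions \<open>(1 - cos) / 2\<close>. Outside the box the error is
  controlled by the Gaussian weight.\<close>

lemma tendsto_integral_even: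
  fixes H :: "real ^ 'n \<Rightarrow> real"
  assumes cont: "continuous_on UNIV H" and bdd: "\<And>y. \<bar>H y\<bar> \<le> B" and even: "\<And>y. H (- y) = H y"
    and eps: "0 < \<epsilon>" and zero: "\<And>y. norm y < \<epsilon> \<Longrightarrow> H y = 0"
  shows "(\<lambda>m. \<integral>y. H y \<partial>\<mu> m) \<longlonglongrightarrow> (\<integral>y. H y \<partial>\<nu>)"
proof -
  have B: "0 \<le> B" using bdd[of 0] by simp
  have approx: "\<exists>q. trig_poly q \<and> q 0 = 0 \<and>
      (\<forall>m. \<bar>(\<integral>y. H y \<partial>\<mu> m) - (\<integral>y. (q y + q (- y)) / 2 \<partial>\<mu> m)\<bar> \<le> e) \<and>
      \<bar>(\<integral>y. H y \<partial>\<nu>) - (\<integral>y. (q y + q (- y)) / 2 \<partial>\<nu>)\<bar> \<le> e" if e: "0 < e" for e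
  proof -
    have "eventually (\<lambda>m. (\<integral>y. gauss_weight (1 / Suc m) y \<partial>\<nu>) < e / (8 * B + 8)) sequentially"
      using e B by (intro order_tendstoD[OF gauss_weight_tail_vanishes[OF levy]]) auto
    then obtain m where m: "(\<integral>y. gauss_weight (1 / Suc m) y \<partial>\<nu>) < e / (8 * B + 8)"
      by (auto simp: eventually_sequentially)
    define a :: real where "a = 1 / Suc m"
    have a: "0 < a" by (simp add: a_def)
    define W where "W = (\<integral>y. gauss_weight a y \<partial>\<nu>)"
    have W: "4 * B * W \<le> e / 2"
    proof -
      have "W \<le> e / (8 * B + 8)" using m by (simp add: W_def a_def)
      then have "4 * B * W \<le> 4 * B * (e / (8 * B + 8))" using B by (intro mult_left_mono) auto
      also have "\<dots> \<le> e / 2" using B e by (simp add: field_simps)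
      finally show ?thesis .
    qed
    define S :: "(real ^ 'n) set" where "S = {s. \<forall>i. -1 \<le> s $ i \<and> s $ i \<le> 1}"
    have "S = cbox (- 1) 1" by (auto simp: S_def mem_box_cart)
    then have S: "compact S" by simp
    define A :: "real ^ 'n \<Rightarrow> real ^ 'n" where "A s = (\<chi> i. arcsin (s $ i) / a)" for s
    have contA: "continuous_on S A" unfolding A_def
      by (intro continuous_intros) (use a in \<open>auto simp: S_def\<close>)
    have "0 \<in> S" by (simp add: S_def)
    have A0: "A 0 = 0" by (simp add: A_def vec_eq_iff)
    obtain r where r: "0 < r" and rA: "\<And>s. s \<in> S \<Longrightarrow> norm s < r \<Longrightarrow> norm (A s) < \<epsilon>"
      using contA[unfolded continuous_on_iff, rule_format, OF \<open>0 \<in> S\<close> eps] by (auto simp: A0)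
    \<comment> \<open>Replacing \<open>|s|^2\<close> by \<open>max (|s|^2) (r^2)\<close> changes nothing where \<open>H (A s) \<noteq> 0\<close>, but makes the
      quotient continuous at the origin.\<close>
    define k where "k s = H (A s) / max ((norm s)\<^sup>2) (r\<^sup>2)" for s
    have "continuous_on S k" unfolding k_def
      by (intro continuous_intros continuous_on_compose2[OF cont contA]) (use r in \<open>auto simp: max_def\<close>)
    have HA: "H (A s) = (norm s)\<^sup>2 * k s" if "s \<in> S" for s
    proof (cases "norm s < r")
      case True
      then show ?thesis using rA[OF that] zero by (simp add: k_def)
    next
      case False
      then have "r\<^sup>2 \<le> (norm s)\<^sup>2" using r by (intro power_mono) auto
      moreover have "norm s \<noteq> 0" using False r by auto
      ultimately show ?thesis by (simp add: k_def max_absorb1)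
    qed
    define D where "D = (\<Sum>i\<in>UNIV. (\<integral>y. 1 - cos (axis i (2 * a) \<bullet> y) \<partial>\<nu>) / 2)"
    have D: "0 \<le> D" unfolding D_def by (intro sum_nonneg divide_nonneg_nonneg integral_nonneg_AE) auto
    define \<delta> where "\<delta> = e / (2 * D + 2)"
    have \<delta>: "0 < \<delta>" "\<delta> * D \<le> e / 2" using e D by (auto simp: \<delta>_def field_simps)
    obtain P where P: "real_polynomial_function P" "\<And>s. s \<in> S \<Longrightarrow> \<bar>k s - P s\<bar> < \<delta>"
      using Stone_Weierstrass_real_polynomial_function[OF S \<open>continuous_on S k\<close> \<delta>(1)] by auto
    define sn :: "real ^ 'n \<Rightarrow> real ^ 'n" where "sn y = (\<chi> i. sin (a * y $ i))" for y
    have snS: "sn y \<in> S" for y by (simp add: sn_def S_def)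
    have norm_sn: "(norm (sn y))\<^sup>2 = (\<Sum>i\<in>UNIV. (1 - cos (axis i (2 * a) \<bullet> y)) / 2)" for y
    proof -
      have "(sin (a * y $ i))\<^sup>2 = (1 - cos (axis i (2 * a) \<bullet> y)) / 2" for i
        using cos_double_sin[of "a * y $ i"] by (simp add: inner_axis' mult.assoc)
      then have "(\<Sum>i\<in>UNIV. (sin (a * y $ i))\<^sup>2) = (\<Sum>i\<in>UNIV. (1 - cos (axis i (2 * a) \<bullet> y)) / 2)"
        by (intro sum.cong) auto
      then show ?thesis by (simp add: norm_vec_def L2_set_def sum_nonneg sn_def)
    qed
    define q where "q y = (norm (sn y))\<^sup>2 * P (sn y)" for y
    have "real_polynomial_function (\<lambda>s::real ^ 'n. (\<Sum>i\<in>UNIV. s $ i * s $ i) * P s)"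
      by (intro real_polynomial_function.intros(4) real_polynomial_function_sum P(1)
          real_polynomial_function.intros(1) bounded_linear_vec_nth) auto
    moreover have "q = (\<lambda>y. (\<Sum>i\<in>UNIV. sn y $ i * sn y $ i) * P (sn y))"
      by (simp add: q_def norm_vec_def L2_set_def sum_nonneg power2_eq_square fun_eq_iff)
    ultimately have q: "trig_poly q"
      using trig_poly_polynomial_sin[of "\<lambda>s. (\<Sum>i\<in>UNIV. s $ i * s $ i) * P s" a]
      by (simp add: sn_def)
    have q0: "q 0 = 0" by (simp add: q_def sn_def norm_vec_def L2_set_def)
    define E where "E y = 4 * B * gauss_weight a y + \<delta> * (norm (sn y))\<^sup>2" for y
    have Hq: "\<bar>H y - q y\<bar> \<le> E y" for y
    proof -
      have "\<bar>H y - H (A (sn y))\<bar> \<le> 4 * B * gauss_weight a y"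
      proof (cases "\<forall>i. \<bar>a * y $ i\<bar> < pi / 2")
        case True
        have "- (pi / 2) \<le> a * y $ i \<and> a * y $ i \<le> pi / 2" for i
          using True[rule_format, of i] by linarith
        then have "A (sn y) = y" using a by (simp add: A_def sn_def vec_eq_iff arcsin_sin)
        then show ?thesis using B gauss_weight_nonneg[of a y] by simp
      next
        case False
        then obtain i where "pi / 2 \<le> \<bar>a * y $ i\<bar>" by (auto simp: not_less)
        then have "1 / 2 \<le> gauss_weight a y" by (rule gauss_weight_ge_half)
        then have "4 * B * (1 / 2) \<le> 4 * B * gauss_weight a y" using B by (intro mult_left_mono) auto
        then show ?thesis using bdd[of y] bdd[of "A (sn y)"] by linarith
      qed
      moreover have "\<bar>H (A (sn y)) - q y\<bar> \<le> \<delta> * (norm (sn y))\<^sup>2"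
      proof -
        have "H (A (sn y)) - q y = (norm (sn y))\<^sup>2 * (k (sn y) - P (sn y))"
          by (simp add: HA[OF snS] q_def algebra_simps)
        then show ?thesis using mult_left_mono[OF less_imp_le[OF P(2)[OF snS[of y]]], of "(norm (sn y))\<^sup>2"]
          by (simp add: abs_mult mult.commute)
      qed
      ultimately show ?thesis unfolding E_def by linarith
    qed
    have Eeven: "E (- y) = E y" for y
      by (simp add: E_def gauss_weight_def norm_sn)
    have bound: "\<bar>H y - (q y + q (- y)) / 2\<bar> \<le> E y" for y
      using Hq[of y] Hq[of "- y"] unfolding Eeven even by (simp add: abs_le_iff field_simps)
    have [measurable]: "H \<in> borel_measurable borel" "q \<in> borel_measurable borel"
      using cont trig_poly_continuous[OF q] by (auto intro: borel_measurable_continuous_onI)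
    have E_eq: "E = (\<lambda>y. 4 * B * gauss_weight a y + \<delta> * (\<Sum>i\<in>UNIV. (1 - cos (axis i (2 * a) \<bullet> y)) / 2))"
      by (simp add: E_def norm_sn fun_eq_iff)
    have iE: "integrable N E"
      and intE: "(\<integral>y. E y \<partial>N) = 4 * B * (\<integral>y. gauss_weight a y \<partial>N) + \<delta> * (\<Sum>i\<in>UNIV. (\<integral>y. 1 - cos (axis i (2 * a) \<bullet> y) \<partial>N) / 2)"
      if g: "integrable N (gauss_weight a)" and c: "\<And>u. integrable N (\<lambda>y. 1 - cos (u \<bullet> y))" for N
    proof -
      have i1: "integrable N (\<lambda>y. 4 * B * gauss_weight a y)" using g by (rule integrable_mult_right)
      have i2: "integrable N (\<lambda>y. (1 - cos (axis i (2 * a) \<bullet> y)) / 2)" for i using c by (rule integrable_divide)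
      have i3: "integrable N (\<lambda>y. \<delta> * (\<Sum>i\<in>UNIV. (1 - cos (axis i (2 * a) \<bullet> y)) / 2))"
        by (intro integrable_mult_right Bochner_Integration.integrable_sum i2)
      show "integrable N E" unfolding E_eq using i1 i3 by (rule Bochner_Integration.integrable_add)
      show "(\<integral>y. E y \<partial>N) = 4 * B * (\<integral>y. gauss_weight a y \<partial>N) + \<delta> * (\<Sum>i\<in>UNIV. (\<integral>y. 1 - cos (axis i (2 * a) \<bullet> y) \<partial>N) / 2)"
        unfolding E_eq Bochner_Integration.integral_add[OF i1 i3] integral_mult_right_zero
          Bochner_Integration.integral_sum[OF i2] integral_divide_zero ..
    qed
    note \<nu>i = gauss_weight_integrable[OF levy less_imp_le[OF a]] integrable_one_minus_cos
    note \<mu>i = integrable_gauss_weight_mu[of _ a] integrable_mu_one_minus_cos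
    have E\<nu>: "(\<integral>y. E y \<partial>\<nu>) \<le> e"
      using W \<delta>(2) unfolding intE[OF \<nu>i] by (simp add: W_def D_def)
    have E\<mu>: "(\<integral>y. E y \<partial>\<mu> m) \<le> e" for m
    proof -
      have "(\<integral>y. E y \<partial>\<mu> m) \<le> (\<integral>y. E y \<partial>\<nu>)"
        unfolding intE[OF \<nu>i] intE[OF \<mu>i]
        using a B \<delta>(1) by (intro add_mono mult_left_mono sum_mono divide_right_mono gauss_weight_mu_le dom) auto
      with E\<nu> show ?thesis by simp
    qed
    have close: "\<bar>(\<integral>y. H y \<partial>N) - (\<integral>y. (q y + q (- y)) / 2 \<partial>N)\<bar> \<le> (\<integral>y. E y \<partial>N)"
      if E: "integrable N E" and H: "integrable N H" and sN: "sets N = sets borel" for N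
    proof -
      note [measurable_cong] = sN
      have m: "(\<lambda>y. H y - (q y + q (- y)) / 2) \<in> borel_measurable N" by measurable
      have "norm (H y - (q y + q (- y)) / 2) \<le> norm (E y)" for y using bound[of y] by simp
      then have i0: "integrable N (\<lambda>y. H y - (q y + q (- y)) / 2)"
        by (intro Bochner_Integration.integrable_bound[OF E m AE_I2])
      have "integrable N (\<lambda>y. H y - (H y - (q y + q (- y)) / 2))" using H i0 by (rule Bochner_Integration.integrable_diff)
      then have i: "integrable N (\<lambda>y. (q y + q (- y)) / 2)" by simp
      have "\<bar>(\<integral>y. H y \<partial>N) - (\<integral>y. (q y + q (- y)) / 2 \<partial>N)\<bar> = \<bar>\<integral>y. H y - (q y + q (- y)) / 2 \<partial>N\<bar>"
        using Bochner_Integration.integral_diff[OF H i] by simp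
      also have "\<dots> \<le> (\<integral>y. \<bar>H y - (q y + q (- y)) / 2\<bar> \<partial>N)" by (rule integral_abs_bound)
      also have "\<dots> \<le> (\<integral>y. E y \<partial>N)"
        by (intro integral_mono bound E integrable_abs i0)
      finally show ?thesis .
    qed
    have iH\<nu>: "integrable \<nu> H"
      by (rule levy_integrable_off_zero[OF levy _ bdd eps zero]) measurable
    show ?thesis
    proof (intro exI[of _ q] conjI allI)
      show "\<bar>(\<integral>y. H y \<partial>\<mu> m) - (\<integral>y. (q y + q (- y)) / 2 \<partial>\<mu> m)\<bar> \<le> e" for m
        using close[OF iE[OF \<mu>i] integrable_mu[OF _ bdd] sets_mu, of m] E\<mu>[of m] by simp
      show "\<bar>(\<integral>y. H y \<partial>\<nu>) - (\<integral>y. (q y + q (- y)) / 2 \<partial>\<nu>)\<bar> \<le> e"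
        using close[OF iE[OF \<nu>i] iH\<nu> sets_lam] E\<nu> by simp
    qed (use q q0 in auto)
  qed
  show ?thesis
  proof (rule LIMSEQ_I)
    fix e :: real assume "0 < e"
    then obtain q where q: "trig_poly q" "q 0 = 0"
      "\<And>m. \<bar>(\<integral>y. H y \<partial>\<mu> m) - (\<integral>y. (q y + q (- y)) / 2 \<partial>\<mu> m)\<bar> \<le> e / 4"
      "\<bar>(\<integral>y. H y \<partial>\<nu>) - (\<integral>y. (q y + q (- y)) / 2 \<partial>\<nu>)\<bar> \<le> e / 4"
      using approx[of "e / 4"] by auto
    have "(\<lambda>m. - (\<integral>y. q 0 - (q y + q (- y)) / 2 \<partial>\<mu> m)) \<longlonglongrightarrow> - (\<integral>y. q 0 - (q y + q (- y)) / 2 \<partial>\<nu>)"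
      by (intro tendsto_minus trig_poly_even_defect(2) q(1))
    then have "(\<lambda>m. \<integral>y. (q y + q (- y)) / 2 \<partial>\<mu> m) \<longlonglongrightarrow> (\<integral>y. (q y + q (- y)) / 2 \<partial>\<nu>)"
      by (simp add: q(2))
    from LIMSEQ_D[OF this, of "e / 4"] \<open>0 < e\<close> obtain m0 where
      m0: "\<And>m. m \<ge> m0 \<Longrightarrow> \<bar>(\<integral>y. (q y + q (- y)) / 2 \<partial>\<mu> m) - (\<integral>y. (q y + q (- y)) / 2 \<partial>\<nu>)\<bar> < e / 4" by auto
    show "\<exists>m0. \<forall>m\<ge>m0. norm ((\<integral>y. H y \<partial>\<mu> m) - (\<integral>y. H y \<partial>\<nu>)) < e"
    proof (intro exI[of _ m0] allI impI)
      fix m assume "m0 \<le> m"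
      then show "norm ((\<integral>y. H y \<partial>\<mu> m) - (\<integral>y. H y \<partial>\<nu>)) < e"
        using m0[of m] q(3)[of m] q(4) \<open>0 < e\<close> unfolding real_norm_def by linarith
    qed
  qed
qed

end

section \<open>Symmetrised laws and characteristic functions\<close>

text \<open>The law of the difference of two independent variables with law \<open>D\<close>. Symmetrising
  removes the drift, which may have unbounded variation in time, and replaces the characteristic
  function by its squared modulus.\<close>

definition sym_law :: "(real ^ 'n) measure \<Rightarrow> (real ^ 'n) measure" where
  "sym_law D = distr (D \<Otimes>\<^sub>M D) borel (\<lambda>(x, y). x - y)"

lemma sets_sym_law[simp]: "sets (sym_law D) = sets borel"
  by (simp add: sym_law_def)

lemma measurable_diff_pair:
  fixes D :: "(real ^ 'n) measure"
  assumes "sets D = sets borel"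
  shows "(\<lambda>(x, y). x - y) \<in> (D \<Otimes>\<^sub>M D) \<rightarrow>\<^sub>M borel"
proof -
  note [measurable_cong] = assms
  show ?thesis by measurable
qed

lemma prob_space_sym_law:
  assumes "prob_space D" "sets D = sets borel"
  shows "prob_space (sym_law D)"
proof -
  interpret prob_space D by fact
  interpret pair_prob_space D D ..
  show ?thesis unfolding sym_law_def by (intro prob_space_distr measurable_diff_pair assms)
qed

lemma integral_sym_law:
  fixes f :: "real ^ 'n \<Rightarrow> real"
  assumes D: "prob_space D" "sets D = sets borel"
    and f: "f \<in> borel_measurable borel" "\<And>y. \<bar>f y\<bar> \<le> B"
  shows "(\<integral>z. f z \<partial>sym_law D) = (\<integral>x. (\<integral>y. f (x - y) \<partial>D) \<partial>D)"
    and "(\<integral>z. f z \<partial>sym_law D) = (\<integral>y. (\<integral>x. f (x - y) \<partial>D) \<partial>D)"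
proof -
  interpret prob_space D by fact
  interpret P: pair_prob_space D D ..
  note [measurable_cong] = D(2) and [measurable] = f(1)
  have 1: "(\<integral>z. f z \<partial>sym_law D) = (\<integral>(x, y). f (x - y) \<partial>(D \<Otimes>\<^sub>M D))"
    unfolding sym_law_def by (subst integral_distr) (auto simp: case_prod_beta')
  have i: "integrable (D \<Otimes>\<^sub>M D) (\<lambda>(x, y). f (x - y))"
    by (rule P.integrable_const_bound[where B = B]) (use f in auto)
  show "(\<integral>z. f z \<partial>sym_law D) = (\<integral>x. (\<integral>y. f (x - y) \<partial>D) \<partial>D)"
    unfolding 1 using P.integral_fst[OF i] by (simp add: case_prod_beta')
  show "(\<integral>z. f z \<partial>sym_law D) = (\<integral>y. (\<integral>x. f (x - y) \<partial>D) \<partial>D)"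
    unfolding 1 using P.integral_snd[OF i] by (simp add: case_prod_beta')
qed

definition char_fun :: "(real ^ 'n) measure \<Rightarrow> real ^ 'n \<Rightarrow> complex" where
  "char_fun D u = (\<integral>y. exp (\<i> * of_real (u \<bullet> y)) \<partial>D)"

lemma sym_law_one_minus_cos:
  fixes D :: "(real ^ 'n) measure"
  assumes D: "prob_space D" "sets D = sets borel"
  shows "(\<integral>z. 1 - cos (u \<bullet> z) \<partial>sym_law D) = 1 - (cmod (char_fun D u))\<^sup>2"
proof -
  interpret prob_space D by fact
  interpret S: prob_space "sym_law D" using D by (rule prob_space_sym_law)
  note [measurable_cong] = D(2)
  have c: "integrable D (\<lambda>y. cos (u \<bullet> y))" and s: "integrable D (\<lambda>y. sin (u \<bullet> y))"
    by (rule integrable_const_bound[where B = 1]; simp)+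
  have e: "integrable D (\<lambda>y. exp (\<i> * of_real (u \<bullet> y)))"
    by (rule integrable_const_bound[where B = 1]) auto
  have "Re (char_fun D u) = (\<integral>y. cos (u \<bullet> y) \<partial>D)" "Im (char_fun D u) = (\<integral>y. sin (u \<bullet> y) \<partial>D)"
    unfolding char_fun_def integral_Re[OF e, symmetric] integral_Im[OF e, symmetric] by (auto simp: Re_exp Im_exp)
  then have "(cmod (char_fun D u))\<^sup>2 = (\<integral>y. cos (u \<bullet> y) \<partial>D)\<^sup>2 + (\<integral>y. sin (u \<bullet> y) \<partial>D)\<^sup>2"
    by (simp add: cmod_power2)
  also have "\<dots> = (\<integral>x. (\<integral>y. cos (u \<bullet> (x - y)) \<partial>D) \<partial>D)"
  proof -
    have "(\<integral>y. cos (u \<bullet> (x - y)) \<partial>D) = cos (u \<bullet> x) * (\<integral>y. cos (u \<bullet> y) \<partial>D) + sin (u \<bullet> x) * (\<integral>y. sin (u \<bullet> y) \<partial>D)" for x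
      unfolding inner_diff_right cos_diff using c s by simp
    then show ?thesis using c s by (simp add: power2_eq_square)
  qed
  also have "\<dots> = (\<integral>z. cos (u \<bullet> z) \<partial>sym_law D)"
    by (rule integral_sym_law(1)[OF D, symmetric, where B = 1]) auto
  finally have "(cmod (char_fun D u))\<^sup>2 = (\<integral>z. cos (u \<bullet> z) \<partial>sym_law D)" .
  moreover have "integrable (sym_law D) (\<lambda>z. cos (u \<bullet> z))"
    by (rule S.integrable_const_bound[where B = 1]) (auto simp: measurable_cong_sets[OF sets_sym_law refl])
  ultimately show ?thesis by (simp add: S.prob_space)
qed

lemma exp_i_minus_one_bound: "cmod (exp (\<i> * of_real x) - 1) \<le> min 2 \<bar>x\<bar>"
proof -
  have "cmod (exp (\<i> * of_real x) - 1) \<le> \<bar>x\<bar>" using iexp_approx1[of x 0] by simp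
  moreover have "cmod (exp (\<i> * of_real x) - 1) \<le> cmod (exp (\<i> * of_real x)) + cmod 1" by (rule norm_triangle_ineq4)
  ultimately show ?thesis by simp
qed

lemma one_minus_char_fun_square_le:
  fixes D :: "(real ^ 'n) measure"
  assumes D: "prob_space D" "sets D = sets borel"
  shows "1 - (cmod (char_fun D u))\<^sup>2 \<le> 2 * max 2 (norm u) * (\<integral>y. min 1 (norm y) \<partial>D)"
proof -
  interpret prob_space D by fact
  note [measurable_cong] = D(2)
  have e: "integrable D (\<lambda>y. exp (\<i> * of_real (u \<bullet> y)))"
    by (rule integrable_const_bound[where B = 1]) auto
  have "char_fun D u - 1 = (\<integral>y. exp (\<i> * of_real (u \<bullet> y)) - 1 \<partial>D)"
    using e by (simp add: char_fun_def prob_space)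
  then have "cmod (char_fun D u - 1) \<le> (\<integral>y. cmod (exp (\<i> * of_real (u \<bullet> y)) - 1) \<partial>D)"
    by (simp only: integral_norm_bound)
  also have "\<dots> \<le> (\<integral>y. max 2 (norm u) * min 1 (norm y) \<partial>D)"
  proof (rule integral_mono)
    show "integrable D (\<lambda>y. cmod (exp (\<i> * of_real (u \<bullet> y)) - 1))"
      using e by auto
    show "integrable D (\<lambda>y. max 2 (norm u) * min 1 (norm y))"
      by (intro integrable_mult_right integrable_const_bound[where B = 1]) auto
    fix y
    have "\<bar>u \<bullet> y\<bar> \<le> norm u * norm y" by (rule Cauchy_Schwarz_ineq2)
    also have "\<dots> \<le> max 2 (norm u) * norm y" by (intro mult_right_mono) auto
    finally show "cmod (exp (\<i> * of_real (u \<bullet> y)) - 1) \<le> max 2 (norm u) * min 1 (norm y)"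
      using exp_i_minus_one_bound[of "u \<bullet> y"] by (auto simp: min_def split: if_splits)
  qed
  finally have a: "cmod (char_fun D u - 1) \<le> max 2 (norm u) * (\<integral>y. min 1 (norm y) \<partial>D)" by simp
  have "cmod (char_fun D u) \<le> (\<integral>y. cmod (exp (\<i> * of_real (u \<bullet> y))) \<partial>D)"
    unfolding char_fun_def by (rule integral_norm_bound)
  then have le1: "cmod (char_fun D u) \<le> 1" by (simp add: prob_space)
  have "1 - (cmod (char_fun D u))\<^sup>2 = (1 - cmod (char_fun D u)) * (1 + cmod (char_fun D u))"
    by (simp add: algebra_simps power2_eq_square)
  also have "\<dots> \<le> (1 - cmod (char_fun D u)) * 2" using le1 by (intro mult_left_mono) auto
  also have "1 - cmod (char_fun D u) \<le> cmod (char_fun D u - 1)"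
    using norm_triangle_ineq2[of 1 "char_fun D u"] by (simp add: norm_minus_commute)
  finally show ?thesis using a by simp
qed

lemma char_fun_norm_le_1:
  assumes D: "prob_space D"
  shows "cmod (char_fun D u) \<le> 1"
proof -
  interpret prob_space D by fact
  have "cmod (char_fun D u) \<le> (\<integral>y. cmod (exp (\<i> * of_real (u \<bullet> y))) \<partial>D)"
    unfolding char_fun_def by (rule integral_norm_bound)
  then show ?thesis by (simp add: prob_space)
qed

text \<open>The drift contributes only a phase, so the modulus sees the real part of the integrand alone.\<close>

lemma characteristic_triplet_norm:
  fixes Y :: "'w \<Rightarrow> real ^ 'n"
  assumes "characteristic_triplet M Y b 0 \<nu>"
  shows "(cmod (LINT \<omega>|M. exp (\<i> * of_real (u \<bullet> Y \<omega>))))\<^sup>2 = exp (- 2 * (\<integral>y. 1 - cos (u \<bullet> y) \<partial>\<nu>))"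
proof -
  have lev: "levy_measure \<nu>"
    and eq: "(LINT \<omega>|M. exp (\<i> * of_real (u \<bullet> Y \<omega>))) = exp (levy_symbol b 0 \<nu> u)"
    using assms by (auto simp: characteristic_triplet_def)
  have sets: "sets \<nu> = sets borel" and null: "emeasure \<nu> {0} = 0"
    using lev by (auto simp: levy_measure_def)
  note [measurable_cong] = sets
  let ?k = "\<lambda>y. exp (\<i> * of_real (u \<bullet> y)) - 1 - \<i> * of_real (u \<bullet> y) * of_real (indicator {0<..<1} (norm y))"
  have bound: "cmod (?k y) \<le> max 2 ((norm u)\<^sup>2) * min 1 ((norm y)\<^sup>2)" for y
  proof (cases "norm y < 1")
    case True
    have "(u \<bullet> y)\<^sup>2 \<le> (norm u * norm y)\<^sup>2"
      using Cauchy_Schwarz_ineq2[of u y] by (metis abs_ge_zero power2_abs power_mono)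
    then have uy: "(u \<bullet> y)\<^sup>2 / 2 \<le> (norm u)\<^sup>2 * (norm y)\<^sup>2"
      by (simp add: power_mult_distrib) (smt (verit) zero_le_power2 zero_le_mult_iff)
    have "?k y = exp (\<i> * of_real (u \<bullet> y)) - 1 - \<i> * of_real (u \<bullet> y)"
      using True by (cases "y = 0") auto
    moreover have "cmod (exp (\<i> * of_real (u \<bullet> y)) - 1 - \<i> * of_real (u \<bullet> y)) \<le> (u \<bullet> y)\<^sup>2 / 2"
      using iexp_approx1[of "u \<bullet> y" 1] by (simp add: power2_eq_square diff_diff_eq)
    ultimately have "cmod (?k y) \<le> (u \<bullet> y)\<^sup>2 / 2" by (simp only:)
    also have "\<dots> \<le> max 2 ((norm u)\<^sup>2) * (norm y)\<^sup>2"
      using uy by (rule order_trans) (intro mult_right_mono, auto)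
    also have "(norm y)\<^sup>2 = min 1 ((norm y)\<^sup>2)" using True by (intro min_absorb2[symmetric] power_le_one) auto
    finally show ?thesis .
  next
    case False
    then have "?k y = exp (\<i> * of_real (u \<bullet> y)) - 1" by simp
    moreover have "cmod (exp (\<i> * of_real (u \<bullet> y)) - 1) \<le> 2" using exp_i_minus_one_bound[of "u \<bullet> y"] by simp
    ultimately have "cmod (?k y) \<le> 2" by (simp only:)
    also have "2 \<le> max 2 ((norm u)\<^sup>2) * min 1 ((norm y)\<^sup>2)"
    proof -
      have "1 \<le> (norm y)\<^sup>2" using False by simp
      then show ?thesis by (simp add: min_absorb1)
    qed
    finally show ?thesis .
  qed
  have k: "integrable \<nu> ?k"
    by (rule levy_integrable[OF lev _ bound]) measurable
  have "(LINT y : - {0} | \<nu>. ?k y) = (\<integral>y. ?k y \<partial>\<nu>)"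
  proof -
    have "AE y in \<nu>. y \<noteq> 0"
      using null by (subst AE_iff_measurable[where N = "{0}"]) (auto simp: sets sets_eq_imp_space_eq[OF sets])
    then show ?thesis unfolding set_lebesgue_integral_def
      by (intro integral_cong_AE) (auto intro!: borel_measurable_scaleR borel_measurable_indicator simp: sets)
  qed
  then have "Re (levy_symbol b 0 \<nu> u) = Re (\<integral>y. ?k y \<partial>\<nu>)"
    by (simp add: levy_symbol_def matrix_vector_mult_0)
  also have "\<dots> = (\<integral>y. Re (?k y) \<partial>\<nu>)" by (rule integral_Re[OF k, symmetric])
  also have "\<dots> = (\<integral>y. - (1 - cos (u \<bullet> y)) \<partial>\<nu>)"
    by (simp add: Re_exp)
  finally have "Re (levy_symbol b 0 \<nu> u) = - (\<integral>y. 1 - cos (u \<bullet> y) \<partial>\<nu>)" by (simp only: Bochner_Integration.integral_minus)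
  then show ?thesis
    by (simp add: eq exp_double[symmetric])
qed

lemma levy_measure_scale_two:
  "levy_measure \<nu> \<Longrightarrow> levy_measure (scale_measure 2 \<nu>)"
  by (auto simp: levy_measure_def nn_integral_scale_measure ennreal_mult_less_top)

lemma integral_scale_two:
  fixes f :: "'a \<Rightarrow> real"
  assumes [measurable]: "f \<in> borel_measurable M" and nn: "\<And>y. 0 \<le> f y"
  shows "(\<integral>y. f y \<partial>scale_measure 2 M) = 2 * (\<integral>y. f y \<partial>M)"
proof -
  have "(\<integral>y. f y \<partial>scale_measure 2 M) = enn2real (2 * (\<integral>\<^sup>+ y. ennreal (f y) \<partial>M))"
    by (subst integral_eq_nn_integral) (auto simp: nn nn_integral_scale_measure)
  also have "\<dots> = 2 * enn2real (\<integral>\<^sup>+ y. ennreal (f y) \<partial>M)"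
    by (simp add: enn2real_mult)
  finally show ?thesis by (simp add: integral_eq_nn_integral nn)
qed

text \<open>The sum of finitely many measures, written as a mixture over the counting measure.\<close>

definition sum_measure :: "nat \<Rightarrow> (nat \<Rightarrow> (real ^ 'n) measure) \<Rightarrow> (real ^ 'n) measure" where
  "sum_measure N D = count_space {..<N} \<bind> D"

lemma integral_sum_measure:
  fixes D :: "nat \<Rightarrow> (real ^ 'n) measure" and f :: "real ^ 'n \<Rightarrow> real"
  assumes N: "0 < N" and D: "\<And>k. k < N \<Longrightarrow> prob_space (D k)" "\<And>k. k < N \<Longrightarrow> sets (D k) = sets borel"
  shows "sets (sum_measure N D) = sets borel" (is ?s)
    and "finite_measure (sum_measure N D)" (is ?f)
    and "f \<in> borel_measurable borel \<Longrightarrow> (\<And>y. 0 \<le> f y) \<Longrightarrow> (\<And>y. f y \<le> B) \<Longrightarrow>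
      (\<integral>y. f y \<partial>sum_measure N D) = (\<Sum>k<N. \<integral>y. f y \<partial>D k)"
proof -
  have m: "D \<in> measurable (count_space {..<N}) (subprob_algebra borel)"
    using D by (auto simp: space_subprob_algebra prob_space_imp_subprob_space)
  show s: ?s unfolding sum_measure_def by (rule sets_bind[OF D(2)]) (use N in auto)
  have nn: "(\<integral>\<^sup>+ y. g y \<partial>sum_measure N D) = (\<Sum>k<N. \<integral>\<^sup>+ y. g y \<partial>D k)" if "g \<in> borel_measurable borel" for g
    unfolding sum_measure_def using that m by (simp add: nn_integral_bind nn_integral_count_space_finite)
  have "emeasure (sum_measure N D) (space (sum_measure N D)) = (\<Sum>k<N. \<integral>\<^sup>+ y. 1 \<partial>D k)"
    using nn[of "\<lambda>_. 1"] by simp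
  also have "\<dots> = (\<Sum>k<N. 1)" using D(1) by (intro sum.cong) (auto simp: prob_space.emeasure_space_1)
  finally show ?f by (intro finite_measureI) simp
  assume f: "f \<in> borel_measurable borel" "\<And>y. 0 \<le> f y" "\<And>y. f y \<le> B"
  have [measurable_cong]: "sets (sum_measure N D) = sets borel" by (rule s)
  have i: "integrable (D k) f" if "k < N" for k
  proof -
    interpret prob_space "D k" using D(1)[OF that] .
    show ?thesis by (rule integrable_const_bound[where B = B]) (use f D(2)[OF that] in auto)
  qed
  have "(\<integral>y. f y \<partial>sum_measure N D) = enn2real (\<integral>\<^sup>+ y. ennreal (f y) \<partial>sum_measure N D)"
    by (rule integral_eq_nn_integral) (use f s in auto)
  also have "\<dots> = enn2real (\<Sum>k<N. \<integral>\<^sup>+ y. ennreal (f y) \<partial>D k)"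
    using f by (subst nn) auto
  also have "\<dots> = enn2real (\<Sum>k<N. ennreal (\<integral>y. f y \<partial>D k))"
    using i f by (intro arg_cong[where f = enn2real] sum.cong refl nn_integral_eq_integral) auto
  also have "\<dots> = (\<Sum>k<N. \<integral>y. f y \<partial>D k)"
    using f by (simp add: sum_ennreal integral_nonneg_AE sum_nonneg)
  finally show "(\<integral>y. f y \<partial>sum_measure N D) = (\<Sum>k<N. \<integral>y. f y \<partial>D k)" .
qed

section \<open>Increments of an additive process\<close>

context additive_process begin

definition law :: "real \<Rightarrow> real \<Rightarrow> (real ^ 'n) measure" where
  "law s t = distr M borel (\<lambda>\<omega>. X t \<omega> - X s \<omega>)"

lemma X_measurable[measurable]: "0 \<le> t \<Longrightarrow> X t \<in> borel_measurable M"
  using adapted subalgebra_filtration by (blast intro: measurable_from_subalg)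

lemma sets_law[simp]: "sets (law s t) = sets borel"
  by (simp add: law_def)

lemma prob_space_law: "0 \<le> s \<Longrightarrow> 0 \<le> t \<Longrightarrow> prob_space (law s t)"
  unfolding law_def by (intro prob_space_distr) measurable

lemma integral_law:
  fixes f :: "real ^ 'n \<Rightarrow> 'b::{banach, second_countable_topology}"
  assumes "0 \<le> s" "0 \<le> t" "f \<in> borel_measurable borel"
  shows "(\<integral>y. f y \<partial>law s t) = (\<integral>\<omega>. f (X t \<omega> - X s \<omega>) \<partial>M)"
  unfolding law_def using assms by (intro integral_distr) measurable

lemma increments_indep:
  assumes "0 \<le> r" "r \<le> s" "s \<le> t"
  shows "indep_var borel (\<lambda>\<omega>. X s \<omega> - X r \<omega>) borel (\<lambda>\<omega>. X t \<omega> - X s \<omega>)"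
proof -
  let ?U = "\<lambda>\<omega>. X s \<omega> - X r \<omega>" and ?V = "\<lambda>\<omega>. X t \<omega> - X s \<omega>"
  let ?vim = "\<lambda>f :: 'w \<Rightarrow> real ^ 'n. {f -` A \<inter> space M |A. A \<in> sets borel}"
  have closed: "sigma_sets (space M) (?vim f) = ?vim f" for f
    using sets.sigma_sets_eq[of "vimage_algebra (space M) f borel"]
    by (simp add: sets_vimage_algebra2)
  have [measurable]: "?U \<in> borel_measurable M" "?V \<in> borel_measurable M"
    using assms by (auto intro!: borel_measurable_diff X_measurable)
  have s: "0 \<le> s" using assms by simp
  have sub: "subalgebra M (G s)" "subalgebra M (G r)" using subalgebra_filtration assms by auto
  have "X r \<in> borel_measurable (G s)"
    using adapted[OF assms(1)] filtration_mono[OF assms(1,2)] sub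
    by (auto simp: measurable_def subalgebra_def)
  then have UG: "?U \<in> borel_measurable (G s)"
    using adapted[OF s] by (intro borel_measurable_diff)
  have UsubG: "?vim ?U \<subseteq> sets (G s)"
    using measurable_sets[OF UG] sub by (auto simp: subalgebra_def)
  have "indep_set (?vim ?U) (?vim ?V)"
  proof (rule indep_setI)
    show "?vim ?U \<subseteq> events" "?vim ?V \<subseteq> events" by auto
    fix a b assume a: "a \<in> ?vim ?U" and b: "b \<in> ?vim ?V"
    have "prob (b \<inter> a) = prob b * prob a"
      by (rule indep_setD[OF indep_increments[OF s assms(3)] b]) (use a UsubG in auto)
    then show "prob (a \<inter> b) = prob a * prob b" by (simp add: Int_commute mult.commute)
  qed
  then show ?thesis
    unfolding indep_var_eq closed by simp
qed

lemma integral_law_split: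
  fixes f :: "real ^ 'n \<Rightarrow> 'b::{banach, second_countable_topology}"
  assumes rst: "0 \<le> r" "r \<le> s" "s \<le> t" and f[measurable]: "f \<in> borel_measurable borel"
    and B: "\<And>y. norm (f y) \<le> B"
  shows "(\<integral>y. f y \<partial>law r t) = (\<integral>x. (\<integral>y. f (x + y) \<partial>law s t) \<partial>law r s)"
proof -
  let ?U = "\<lambda>\<omega>. X s \<omega> - X r \<omega>" and ?V = "\<lambda>\<omega>. X t \<omega> - X s \<omega>"
  have pos: "0 \<le> s" "0 \<le> t" using rst by auto
  interpret D1: prob_space "law r s" using rst pos by (intro prob_space_law)
  interpret D2: prob_space "law s t" using rst pos by (intro prob_space_law)
  interpret P: pair_prob_space "law r s" "law s t" ..
  have m: "?U \<in> borel_measurable M" "?V \<in> borel_measurable M"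
    using rst pos by (auto intro!: borel_measurable_diff X_measurable)
  have eq: "law r s \<Otimes>\<^sub>M law s t = distr M (borel \<Otimes>\<^sub>M borel) (\<lambda>\<omega>. (?U \<omega>, ?V \<omega>))"
    using increments_indep[OF rst] unfolding indep_var_distribution_eq law_def by simp
  have "(\<integral>y. f y \<partial>law r t) = (\<integral>\<omega>. f (?U \<omega> + ?V \<omega>) \<partial>M)"
    using rst pos by (simp add: integral_law)
  also have "\<dots> = (\<integral>(x, y). f (x + y) \<partial>(law r s \<Otimes>\<^sub>M law s t))"
    unfolding eq using m by (subst integral_distr) (auto simp: case_prod_beta')
  also have "\<dots> = (\<integral>x. (\<integral>y. f (x + y) \<partial>law s t) \<partial>law r s)"
  proof -
    have "integrable (law r s \<Otimes>\<^sub>M law s t) (\<lambda>(x, y). f (x + y))"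
    proof (rule P.integrable_const_bound[where B = B])
      have "(\<lambda>(x, y). f (x + y)) \<in> borel_measurable (borel \<Otimes>\<^sub>M borel)" by measurable
      then show "(\<lambda>(x, y). f (x + y)) \<in> borel_measurable (law r s \<Otimes>\<^sub>M law s t)"
        by (simp cong: measurable_cong_sets sets_pair_measure_cong)
    qed (use B in auto)
    from P.integral_fst[OF this] show ?thesis by simp
  qed
  finally show ?thesis .
qed

lemma char_fun_law_split:
  assumes rst: "0 \<le> r" "r \<le> s" "s \<le> t"
  shows "char_fun (law r t) u = char_fun (law r s) u * char_fun (law s t) u"
proof -
  have "char_fun (law r t) u = (\<integral>x. (\<integral>y. exp (\<i> * of_real (u \<bullet> (x + y))) \<partial>law s t) \<partial>law r s)"
    unfolding char_fun_def by (rule integral_law_split[OF rst, where B = 1]) auto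
  also have "\<dots> = (\<integral>x. exp (\<i> * of_real (u \<bullet> x)) * char_fun (law s t) u \<partial>law r s)"
    by (simp add: char_fun_def inner_add_right distrib_left exp_add)
  finally show ?thesis by (simp add: char_fun_def)
qed

lemma integral_law_from_zero:
  fixes f :: "real ^ 'n \<Rightarrow> 'b::{banach, second_countable_topology}"
  assumes "0 \<le> t" and [measurable]: "f \<in> borel_measurable borel"
  shows "(\<integral>y. f y \<partial>law 0 t) = (\<integral>\<omega>. f (X t \<omega>) \<partial>M)"
proof -
  have [measurable]: "X t \<in> borel_measurable M" "X 0 \<in> borel_measurable M" using assms by (auto intro: X_measurable)
  have "(\<integral>y. f y \<partial>law 0 t) = (\<integral>\<omega>. f (X t \<omega> - X 0 \<omega>) \<partial>M)"
    using assms by (simp add: integral_law)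
  also have "\<dots> = (\<integral>\<omega>. f (X t \<omega>) \<partial>M)"
    by (rule integral_cong_AE) (use start_zero in auto)
  finally show ?thesis .
qed

lemma char_fun_law_norm:
  assumes t: "0 \<le> t" and triplet: "characteristic_triplet M (X t) b 0 \<nu>"
  shows "(cmod (char_fun (law 0 t) u))\<^sup>2 = exp (- (\<integral>y. 1 - cos (u \<bullet> y) \<partial>scale_measure 2 \<nu>))"
proof -
  have "sets \<nu> = sets borel" using triplet by (auto simp: characteristic_triplet_def levy_measure_def)
  note [measurable_cong] = this
  have "(\<integral>y. 1 - cos (u \<bullet> y) \<partial>scale_measure 2 \<nu>) = 2 * (\<integral>y. 1 - cos (u \<bullet> y) \<partial>\<nu>)"
    by (rule integral_scale_two) auto
  then show ?thesis
    unfolding char_fun_def using t characteristic_triplet_norm[OF triplet, of u] by (simp add: integral_law_from_zero)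
qed

text \<open>A metric for convergence in probability, evaluated between two times of the process.\<close>

definition osc :: "real \<Rightarrow> real \<Rightarrow> real" where
  "osc s t = (\<integral>y. min 1 (norm y) \<partial>law s t)"

lemma integrable_osc: "0 \<le> s \<Longrightarrow> 0 \<le> t \<Longrightarrow> integrable M (\<lambda>\<omega>. min 1 (norm (X t \<omega> - X s \<omega>)))"
  by (rule integrable_const_bound[where B = 1]) auto

lemma osc_eq: "0 \<le> s \<Longrightarrow> 0 \<le> t \<Longrightarrow> osc s t = (\<integral>\<omega>. min 1 (norm (X t \<omega> - X s \<omega>)) \<partial>M)"
  unfolding osc_def by (rule integral_law) auto

lemma osc_nonneg: "0 \<le> osc s t"
  unfolding osc_def by (rule integral_nonneg_AE) auto

lemma osc_triangle:
  assumes "0 \<le> r" "0 \<le> s" "0 \<le> t"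
  shows "osc s t \<le> osc r s + osc r t"
proof -
  have "osc s t \<le> (\<integral>\<omega>. min 1 (norm (X s \<omega> - X r \<omega>)) + min 1 (norm (X t \<omega> - X r \<omega>)) \<partial>M)"
    unfolding osc_eq[OF assms(2,3)]
  proof (intro integral_mono Bochner_Integration.integrable_add integrable_osc assms)
    fix \<omega>
    have "norm (X t \<omega> - X s \<omega>) \<le> norm (X t \<omega> - X r \<omega>) + norm (X s \<omega> - X r \<omega>)"
      using norm_triangle_ineq4[of "X t \<omega> - X r \<omega>" "X s \<omega> - X r \<omega>"] by simp
    then show "min 1 (norm (X t \<omega> - X s \<omega>)) \<le> min 1 (norm (X s \<omega> - X r \<omega>)) + min 1 (norm (X t \<omega> - X r \<omega>))"
      using norm_ge_zero[of "X t \<omega> - X r \<omega>"] norm_ge_zero[of "X s \<omega> - X r \<omega>"] by linarith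
  qed
  also have "\<dots> = osc r s + osc r t"
    using assms integrable_osc by (simp add: osc_eq)
  finally show ?thesis .
qed

lemma osc_small:
  assumes t: "0 \<le> t" and e: "0 < e"
  shows "\<exists>d>0. \<forall>s\<ge>0. \<bar>s - t\<bar> < d \<longrightarrow> osc t s < e"
proof -
  have "eventually (\<lambda>h. prob {\<omega> \<in> space M. e / 2 \<le> norm (X (t + h) \<omega> - X t \<omega>)} < e / 2) (at 0 within {h. 0 \<le> t + h})"
    by (rule order_tendstoD(2)[OF stoch_continuous[OF t]]) (use e in auto)
  then obtain d where d: "0 < d" "\<And>h. 0 \<le> t + h \<Longrightarrow> h \<noteq> 0 \<Longrightarrow> \<bar>h\<bar> < d \<Longrightarrow>
      prob {\<omega> \<in> space M. e / 2 \<le> norm (X (t + h) \<omega> - X t \<omega>)} < e / 2"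
    by (auto simp: eventually_at dist_real_def)
  show ?thesis
  proof (intro exI[of _ d] conjI allI impI)
    fix s assume s: "0 \<le> s" "\<bar>s - t\<bar> < d"
    show "osc t s < e"
    proof (cases "s = t")
      case True
      then show ?thesis using e t by (simp add: osc_eq)
    next
      case False
      let ?E = "{\<omega> \<in> space M. e / 2 \<le> norm (X s \<omega> - X t \<omega>)}"
      have [measurable]: "X s \<in> borel_measurable M" "X t \<in> borel_measurable M"
        using s t by (auto intro: X_measurable)
      have E: "?E \<in> events" by measurable
      have "osc t s \<le> (\<integral>\<omega>. e / 2 + indicator ?E \<omega> \<partial>M)"
        unfolding osc_eq[OF t s(1)]
      proof (intro integral_mono integrable_osc t s Bochner_Integration.integrable_add)
        show "integrable M (\<lambda>\<omega>. indicator ?E \<omega> :: real)"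
          by (rule integrable_const_bound[where B = 1]) (use E in \<open>auto simp: indicator_def\<close>)
        fix \<omega> assume "\<omega> \<in> space M"
        then show "min 1 (norm (X s \<omega> - X t \<omega>)) \<le> e / 2 + indicator ?E \<omega>"
          using e by (auto simp: indicator_def min_def)
      qed auto
      also have "\<dots> = e / 2 + prob ?E"
        using E by (subst Bochner_Integration.integral_add)
          (auto simp: prob_space intro!: integrable_const_bound[where B = 1] simp: indicator_def)
      also have "prob ?E < e / 2"
        using d(2)[of "s - t"] s False by simp
      finally show ?thesis by simp
    qed
  qed (use d in simp)
qed

text \<open>Stochastic continuity is uniform on compact time intervals, because \<open>osc\<close> obeys the
  triangle inequality. This makes the increments over a fine partition uniformly small.\<close>

lemma osc_uniformly_small:
  assumes e: "0 < e"
  shows "\<exists>d>0. \<forall>s\<in>{0..T}. \<forall>r\<in>{0..T}. \<bar>s - r\<bar> < d \<longrightarrow> osc s r < e"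
proof -
  have "\<forall>t. 0 \<le> t \<longrightarrow> (\<exists>d>0. \<forall>s\<ge>0. \<bar>s - t\<bar> < d \<longrightarrow> osc t s < e / 2)"
    using osc_small[of _ "e / 2"] e by auto
  then obtain d where d: "\<And>t. 0 \<le> t \<Longrightarrow> 0 < d t"
    "\<And>t s. 0 \<le> t \<Longrightarrow> 0 \<le> s \<Longrightarrow> \<bar>s - t\<bar> < d t \<Longrightarrow> osc t s < e / 2"
    by metis
  obtain \<delta> where \<delta>: "0 < \<delta>" "\<And>x. x \<in> {0..T} \<Longrightarrow> \<exists>B\<in>(\<lambda>t. ball t (d t)) ` {0..T}. ball x \<delta> \<subseteq> B"
  proof (rule Heine_Borel_lemma[of "{0..T}" "(\<lambda>t. ball t (d t)) ` {0..T}"])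
    show "{0..T} \<subseteq> \<Union> ((\<lambda>t. ball t (d t)) ` {0..T})" using d(1) by fastforce
  qed auto
  show ?thesis
  proof (intro exI[of _ \<delta>] conjI ballI impI)
    fix s r assume sr: "s \<in> {0..T}" "r \<in> {0..T}" "\<bar>s - r\<bar> < \<delta>"
    obtain t where t: "t \<in> {0..T}" "ball s \<delta> \<subseteq> ball t (d t)" using \<delta>(2)[OF sr(1)] by auto
    have "s \<in> ball t (d t)" "r \<in> ball t (d t)" using t(2) sr(3) \<delta>(1) by (auto simp: dist_real_def subset_iff)
    then have "\<bar>s - t\<bar> < d t" "\<bar>r - t\<bar> < d t" by (auto simp: dist_real_def abs_minus_commute)
    then have "osc t s < e / 2" "osc t r < e / 2" using d(2)[of t s] d(2)[of t r] t sr by auto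
    then show "osc s r < e" using osc_triangle[of t s r] t sr by auto
  qed (use \<delta> in simp)
qed

end

section \<open>Symmetrised increments along refining partitions\<close>

text \<open>Partitions of \<open>[0, t]\<close> whose mesh tends to zero. The sum of the symmetrised increment laws
  plays the role of the Levy measure of \<open>X t - X' t\<close>, where \<open>X'\<close> is an independent copy of \<open>X\<close>;
  that measure is the sum of \<open>\<nu>\<close> and its reflection, which even functions do not distinguish from \<open>2 \<nu>\<close>.\<close>

locale refining_partitions = additive_process M G X
  for M :: "'w measure" and G and X :: "real \<Rightarrow> 'w \<Rightarrow> real ^ 'n" +
  fixes t :: real and b :: "real ^ 'n" and \<nu> :: "(real ^ 'n) measure"
    and \<tau> :: "nat \<Rightarrow> nat \<Rightarrow> real" and N :: "nat \<Rightarrow> nat"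
  assumes triplet: "characteristic_triplet M (X t) b 0 \<nu>"
    and N_pos: "0 < N m" and tau_0: "\<tau> m 0 = 0" and tau_N: "\<tau> m (N m) = t"
    and tau_mono: "k < N m \<Longrightarrow> \<tau> m k \<le> \<tau> m (Suc k)"
    and mesh: "0 < d \<Longrightarrow> eventually (\<lambda>m. \<forall>k<N m. \<tau> m (Suc k) - \<tau> m k < d) sequentially"
begin

abbreviation "inc m k \<equiv> law (\<tau> m k) (\<tau> m (Suc k))"

lemma tau_le: "j \<le> k \<Longrightarrow> k \<le> N m \<Longrightarrow> \<tau> m j \<le> \<tau> m k"
proof (induction k)
  case (Suc k)
  then show ?case using tau_mono[of k m] by (cases "j = Suc k") auto
qed simp

lemma tau_nonneg: "k \<le> N m \<Longrightarrow> 0 \<le> \<tau> m k"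
  using tau_le[of 0 k m] by (simp add: tau_0)

lemma tau_le_t: "k \<le> N m \<Longrightarrow> \<tau> m k \<le> t"
  using tau_le[of k "N m" m] by (simp add: tau_N)

lemma t_nonneg: "0 \<le> t"
  using tau_nonneg[of "N 0" 0] by (simp add: tau_N)

lemma prob_space_inc: "k < N m \<Longrightarrow> prob_space (inc m k)"
  by (intro prob_space_law tau_nonneg) auto

lemma osc_mesh:
  assumes "0 < e"
  shows "eventually (\<lambda>m. \<forall>k<N m. osc (\<tau> m k) (\<tau> m (Suc k)) < e) sequentially"
proof -
  obtain d where d: "0 < d" "\<And>s r. s \<in> {0..t} \<Longrightarrow> r \<in> {0..t} \<Longrightarrow> \<bar>s - r\<bar> < d \<Longrightarrow> osc s r < e"
    using osc_uniformly_small[OF assms, of t] by blast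
  show ?thesis
    using mesh[OF d(1)]
  proof eventually_elim
    case (elim m)
    show ?case
    proof (intro allI impI)
      fix k assume k: "k < N m"
      show "osc (\<tau> m k) (\<tau> m (Suc k)) < e"
        using k elim[rule_format, OF k] tau_mono[OF k] by (intro d(2)) (auto simp: tau_nonneg tau_le_t)
    qed
  qed
qed

definition \<mu> :: "nat \<Rightarrow> (real ^ 'n) measure" where
  "\<mu> m = sum_measure (N m) (\<lambda>k. sym_law (inc m k))"

lemma sets_sum_of_laws: "sets (\<mu> m) = sets borel"
  unfolding \<mu>_def by (intro integral_sum_measure(1)[OF N_pos] prob_space_sym_law prob_space_inc) auto

lemma finite_sum_of_laws: "finite_measure (\<mu> m)"
  unfolding \<mu>_def by (intro integral_sum_measure(2)[OF N_pos] prob_space_sym_law prob_space_inc) auto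

lemma integral_mu:
  fixes f :: "real ^ 'n \<Rightarrow> real"
  assumes "f \<in> borel_measurable borel" "\<And>y. 0 \<le> f y" "\<And>y. f y \<le> B"
  shows "(\<integral>y. f y \<partial>\<mu> m) = (\<Sum>k<N m. \<integral>y. f y \<partial>sym_law (inc m k))"
  unfolding \<mu>_def
  by (rule integral_sum_measure(3)[OF N_pos, where B = B]) (use assms in \<open>auto intro: prob_space_sym_law prob_space_inc\<close>)

definition "\<theta> u m k = 1 - (cmod (char_fun (inc m k) u))\<^sup>2"

lemma theta_bounds:
  assumes "k < N m"
  shows "0 \<le> \<theta> u m k" "\<theta> u m k \<le> 2 * max 2 (norm u) * osc (\<tau> m k) (\<tau> m (Suc k))"
  using char_fun_norm_le_1[OF prob_space_inc[OF assms], of u]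
    one_minus_char_fun_square_le[OF prob_space_inc[OF assms], of u]
  by (auto simp: \<theta>_def osc_def power_le_one)

lemma integral_mu_one_minus_cos: "(\<integral>y. 1 - cos (u \<bullet> y) \<partial>\<mu> m) = (\<Sum>k<N m. \<theta> u m k)"
proof -
  have "(\<integral>y. 1 - cos (u \<bullet> y) \<partial>\<mu> m) = (\<Sum>k<N m. \<integral>y. 1 - cos (u \<bullet> y) \<partial>sym_law (inc m k))"
    by (rule integral_mu[where B = 2]) (auto intro: order_trans[OF diff_left_mono[OF cos_ge_minus_one]])
  also have "\<dots> = (\<Sum>k<N m. \<theta> u m k)"
    by (intro sum.cong refl) (simp add: \<theta>_def sym_law_one_minus_cos prob_space_inc)
  finally show ?thesis .
qed

definition "\<Psi> u = (\<integral>y. 1 - cos (u \<bullet> y) \<partial>scale_measure 2 \<nu>)"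

text \<open>The increments are independent, so the characteristic function of \<open>X t\<close> is the product of
  theirs.\<close>

lemma prod_theta: "(\<Prod>k<N m. 1 - \<theta> u m k) = exp (- \<Psi> u)"
proof -
  have "char_fun (law 0 (\<tau> m j)) u = (\<Prod>k<j. char_fun (inc m k) u)" if "j \<le> N m" for j
    using that
  proof (induction j)
    case 0
    have "char_fun (law 0 0) u = 1"
      by (simp add: char_fun_def integral_law prob_space)
    then show ?case by (simp add: tau_0)
  next
    case (Suc j)
    have "char_fun (law 0 (\<tau> m (Suc j))) u = char_fun (law 0 (\<tau> m j)) u * char_fun (inc m j) u"
      by (rule char_fun_law_split) (use Suc.prems tau_nonneg tau_mono in auto)
    then show ?case using Suc by simp
  qed
  from this[of "N m"] have "(cmod (char_fun (law 0 t) u))\<^sup>2 = (\<Prod>k<N m. (cmod (char_fun (inc m k) u))\<^sup>2)"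
    by (simp add: tau_N prod_norm[symmetric] prod_power_distrib)
  then show ?thesis using char_fun_law_norm[OF t_nonneg triplet, of u] by (simp add: \<Psi>_def \<theta>_def)
qed

text \<open>From \<open>1 - x \<le> exp (- x)\<close> in each factor of the product.\<close>

lemma sum_theta_le: "(\<Sum>k<N m. \<theta> u m k) \<le> \<Psi> u"
proof -
  have "exp (- \<Psi> u) \<le> (\<Prod>k<N m. exp (- \<theta> u m k))"
    unfolding prod_theta[of u m, symmetric]
  proof (intro prod_mono conjI)
    fix k
    show "1 - \<theta> u m k \<le> exp (- \<theta> u m k)" using exp_ge_add_one_self[of "- \<theta> u m k"] by simp
    show "0 \<le> 1 - \<theta> u m k" by (simp add: \<theta>_def)
  qed
  then show ?thesis by (simp add: exp_sum[symmetric] sum_negf)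
qed

text \<open>From \<open>1 - x = 1 / (1 + x / (1 - x)) \<ge> exp (- x / (1 - x))\<close> in each factor.\<close>

lemma sum_theta_ge:
  assumes "\<eta> < 1" "\<And>k. k < N m \<Longrightarrow> \<theta> u m k \<le> \<eta>"
  shows "(1 - \<eta>) * \<Psi> u \<le> (\<Sum>k<N m. \<theta> u m k)"
proof -
  have "(\<Prod>k<N m. exp (- (\<theta> u m k / (1 - \<eta>)))) \<le> exp (- \<Psi> u)"
    unfolding prod_theta[of u m, symmetric]
  proof (intro prod_mono conjI)
    fix k assume "k \<in> {..<N m}"
    then have k: "k < N m" by simp
    let ?q = "\<theta> u m k"
    have q: "0 \<le> ?q" "?q \<le> \<eta>" using theta_bounds(1)[OF k] assms(2)[OF k] by auto
    have "?q / (1 - ?q) \<le> ?q / (1 - \<eta>)" using q assms(1) by (intro divide_left_mono) auto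
    then have "exp (- (?q / (1 - \<eta>))) \<le> exp (- (?q / (1 - ?q)))" by simp
    also have "\<dots> \<le> 1 / (1 + ?q / (1 - ?q))"
      unfolding exp_minus inverse_eq_divide
      using exp_ge_add_one_self[of "?q / (1 - ?q)"] q assms(1)
      by (intro divide_left_mono mult_pos_pos add_pos_nonneg) auto
    also have "\<dots> = 1 - ?q" using q assms(1) by (simp add: field_simps)
    finally show "exp (- (?q / (1 - \<eta>))) \<le> 1 - ?q" .
  qed simp
  then have "\<Psi> u \<le> (\<Sum>k<N m. \<theta> u m k) / (1 - \<eta>)"
    by (simp add: exp_sum[symmetric] sum_negf sum_divide_distrib)
  then show ?thesis using assms(1) by (simp add: pos_le_divide_eq mult.commute)
qed

lemma sum_theta_tendsto: "(\<lambda>m. \<Sum>k<N m. \<theta> u m k) \<longlonglongrightarrow> \<Psi> u"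
proof (rule LIMSEQ_I)
  fix e :: real assume e: "0 < e"
  have \<Psi>: "0 \<le> \<Psi> u" unfolding \<Psi>_def by (rule integral_nonneg_AE) auto
  define \<eta> where "\<eta> = min (1/2) (e / (2 * (\<Psi> u + 1)))"
  have \<eta>: "0 < \<eta>" "\<eta> < 1" using e \<Psi> by (auto simp: \<eta>_def min_def)
  have "\<eta> * \<Psi> u \<le> e / (2 * (\<Psi> u + 1)) * \<Psi> u" using \<Psi> by (intro mult_right_mono) (auto simp: \<eta>_def)
  also have "\<dots> < e" using e \<Psi> by (simp add: field_simps add_pos_nonneg)
  finally have small: "\<eta> * \<Psi> u < e" .
  define c where "c = 2 * max 2 (norm u)"
  have c: "0 < c" by (simp add: c_def)
  have "eventually (\<lambda>m. \<forall>k<N m. osc (\<tau> m k) (\<tau> m (Suc k)) < \<eta> / c) sequentially"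
    using \<eta> c by (intro osc_mesh) simp
  then have "eventually (\<lambda>m. norm ((\<Sum>k<N m. \<theta> u m k) - \<Psi> u) < e) sequentially"
  proof (rule eventually_mono)
    fix m assume m: "\<forall>k<N m. osc (\<tau> m k) (\<tau> m (Suc k)) < \<eta> / c"
    have "\<theta> u m k \<le> \<eta>" if "k < N m" for k
    proof -
      have "\<theta> u m k \<le> c * osc (\<tau> m k) (\<tau> m (Suc k))" using theta_bounds(2)[OF that] by (simp add: c_def)
      also have "\<dots> \<le> c * (\<eta> / c)" using m that c by (intro mult_left_mono) (auto intro: less_imp_le)
      finally show ?thesis using c by simp
    qed
    from sum_theta_ge[OF \<eta>(2) this] sum_theta_le[where u = u and m = m]
    show "norm ((\<Sum>k<N m. \<theta> u m k) - \<Psi> u) < e" using small by (simp add: algebra_simps)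
  qed
  then show "\<exists>no. \<forall>n\<ge>no. norm ((\<Sum>k<N n. \<theta> u n k) - \<Psi> u) < e" by (simp add: eventually_sequentially)
qed

lemma levy_nu: "levy_measure \<nu>"
  using triplet by (simp add: characteristic_triplet_def)

sublocale levy_dominated \<mu> "scale_measure 2 \<nu>"
proof (rule levy_dominated.intro)
  show "finite_measure (\<mu> m)" for m by (rule finite_sum_of_laws)
  show "sets (\<mu> m) = sets borel" for m by (rule sets_sum_of_laws)
  show "levy_measure (scale_measure 2 \<nu>)" by (rule levy_measure_scale_two[OF levy_nu])
  show "(\<integral>y. 1 - cos (u \<bullet> y) \<partial>\<mu> m) \<le> (\<integral>y. 1 - cos (u \<bullet> y) \<partial>scale_measure 2 \<nu>)" for m u
    using sum_theta_le by (simp add: integral_mu_one_minus_cos \<Psi>_def)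
  show "(\<lambda>m. \<integral>y. 1 - cos (u \<bullet> y) \<partial>\<mu> m) \<longlonglongrightarrow> (\<integral>y. 1 - cos (u \<bullet> y) \<partial>scale_measure 2 \<nu>)" for u
    using sum_theta_tendsto by (simp add: integral_mu_one_minus_cos \<Psi>_def)
qed

end

section \<open>Functions that vanish almost everywhere for the limit\<close>

context levy_dominated begin

text \<open>Away from the origin this is the convergence already shown. Near the origin \<open>h\<close> is dominated
  by \<open>|y|^2\<close>, whose integral over a small ball is small uniformly in \<open>m\<close> by the Gaussian weight with
  large \<open>\<sigma>\<close>. The cutoff \<open>\<kappa>\<close> vanishes for \<open>|y| \<le> 1 / (2 \<sigma>)\<close> and equals \<open>1\<close> for \<open>|y| \<ge> 1 / \<sigma>\<close>.\<close>

lemma integral_mu_vanishes: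
  fixes h :: "real ^ 'n \<Rightarrow> real"
  assumes cont: "continuous_on UNIV h" and even: "\<And>y. h (- y) = h y" and nonneg: "\<And>y. 0 \<le> h y"
    and bound: "\<And>y. h y \<le> C * min 1 ((norm y)\<^sup>2)" and null: "AE y in \<nu>. h y = 0"
  shows "(\<lambda>m. \<integral>y. h y \<partial>\<mu> m) \<longlonglongrightarrow> 0"
proof (rule LIMSEQ_I)
  fix e :: real assume e: "0 < e"
  have [measurable]: "h \<in> borel_measurable borel" using cont by (rule borel_measurable_continuous_onI)
  have C: "0 \<le> C" using nonneg[of "axis undefined 1"] bound[of "axis undefined 1"] by (simp add: norm_axis_1)
  have "eventually (\<lambda>m. (\<integral>y. gauss_weight (Suc m) y \<partial>\<nu>) / (real (Suc m))\<^sup>2 < e / (8 * C + 8)) sequentially"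
    using e C by (intro order_tendstoD[OF gauss_weight_core_vanishes[OF levy]]) auto
  then obtain p where p: "(\<integral>y. gauss_weight (Suc p) y \<partial>\<nu>) / (real (Suc p))\<^sup>2 < e / (8 * C + 8)"
    by (auto simp: eventually_sequentially)
  define \<sigma> where "\<sigma> = real (Suc p)"
  have \<sigma>: "0 < \<sigma>" by (simp add: \<sigma>_def)
  define W where "W = (\<integral>y. gauss_weight \<sigma> y \<partial>\<nu>)"
  have W: "4 * C / \<sigma>\<^sup>2 * W \<le> e / 2"
  proof -
    have "W / \<sigma>\<^sup>2 \<le> e / (8 * C + 8)" using p by (simp add: W_def \<sigma>_def)
    then have "4 * C * (W / \<sigma>\<^sup>2) \<le> 4 * C * (e / (8 * C + 8))" using C by (intro mult_left_mono) auto
    also have "\<dots> \<le> e / 2" using C e by (simp add: field_simps)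
    finally show ?thesis by simp
  qed
  define \<kappa> :: "real ^ 'n \<Rightarrow> real" where "\<kappa> y = min 1 (max 0 (2 * \<sigma> * norm y - 1))" for y
  have \<kappa>: "0 \<le> \<kappa> y" "\<kappa> y \<le> 1" for y by (auto simp: \<kappa>_def)
  have \<kappa>cont: "continuous_on UNIV \<kappa>" unfolding \<kappa>_def by (intro continuous_intros)
  then have [measurable]: "\<kappa> \<in> borel_measurable borel" by (rule borel_measurable_continuous_onI)
  have hC: "h y \<le> C" for y
    using bound[of y] mult_left_mono[of "min 1 ((norm y)\<^sup>2)" 1 C] C by auto
  have core: "h y * (1 - \<kappa> y) \<le> 4 * C / \<sigma>\<^sup>2 * gauss_weight \<sigma> y" for y
  proof (cases "\<sigma> * norm y \<le> 1")
    case True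
    have "h y * (1 - \<kappa> y) \<le> h y * 1" using \<kappa>[of y] nonneg[of y] by (intro mult_left_mono) auto
    also have "\<dots> \<le> C * (norm y)\<^sup>2" using bound[of y] C mult_left_mono[of "min 1 ((norm y)\<^sup>2)" "(norm y)\<^sup>2" C] by auto
    also have "\<dots> = 4 * C / \<sigma>\<^sup>2 * (\<sigma>\<^sup>2 * (norm y)\<^sup>2 / 4)" using \<sigma> by simp
    also have "\<dots> \<le> 4 * C / \<sigma>\<^sup>2 * gauss_weight \<sigma> y"
      using gauss_weight_ge_square[of \<sigma> y] True \<sigma> C by (intro mult_left_mono) auto
    finally show ?thesis .
  next
    case False
    then have "\<kappa> y = 1" by (simp add: \<kappa>_def)
    then show ?thesis using C gauss_weight_nonneg[of \<sigma> y] by simp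
  qed
  have abs: "\<bar>h y * \<kappa> y\<bar> \<le> C" "\<bar>h y * (1 - \<kappa> y)\<bar> \<le> C" for y
    using nonneg[of y] hC[of y] \<kappa>[of y] mult_mono[of "h y" C "\<kappa> y" 1] mult_mono[of "h y" C "1 - \<kappa> y" 1] C by (auto simp: abs_mult)
  have "(\<lambda>m. \<integral>y. h y * \<kappa> y \<partial>\<mu> m) \<longlonglongrightarrow> (\<integral>y. h y * \<kappa> y \<partial>\<nu>)"
  proof (rule tendsto_integral_even[where B = C and \<epsilon> = "1 / (2 * \<sigma>)"])
    show "continuous_on UNIV (\<lambda>y. h y * \<kappa> y)" by (intro continuous_intros cont \<kappa>cont)
    show "\<bar>h y * \<kappa> y\<bar> \<le> C" for y by (rule abs)
    show "h (- y) * \<kappa> (- y) = h y * \<kappa> y" for y by (simp add: even \<kappa>_def)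
    show "h y * \<kappa> y = 0" if "norm y < 1 / (2 * \<sigma>)" for y
      using that \<sigma> by (simp add: \<kappa>_def field_simps)
  qed (use \<sigma> in simp)
  also have "(\<integral>y. h y * \<kappa> y \<partial>\<nu>) = 0"
    by (rule integral_eq_zero_AE) (use null in auto)
  finally have lim: "(\<lambda>m. \<integral>y. h y * \<kappa> y \<partial>\<mu> m) \<longlonglongrightarrow> 0" .
  have "0 < e / 2" using e by simp
  from LIMSEQ_D[OF lim this] obtain m0 where m0: "\<And>m. m0 \<le> m \<Longrightarrow> norm (\<integral>y. h y * \<kappa> y \<partial>\<mu> m) < e / 2"
    unfolding diff_zero by blast
  show "\<exists>m0. \<forall>m\<ge>m0. norm ((\<integral>y. h y \<partial>\<mu> m) - 0) < e"
  proof (intro exI[of _ m0] allI impI)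
    fix m assume m: "m0 \<le> m"
    have i: "integrable (\<mu> m) (\<lambda>y. h y * \<kappa> y)" "integrable (\<mu> m) (\<lambda>y. h y * (1 - \<kappa> y))"
      by (rule integrable_mu[where B = C]; use abs in simp)+
    have "(\<integral>y. h y \<partial>\<mu> m) = (\<integral>y. h y * \<kappa> y + h y * (1 - \<kappa> y) \<partial>\<mu> m)"
      unfolding distrib_left[symmetric] by simp
    also have "\<dots> = (\<integral>y. h y * \<kappa> y \<partial>\<mu> m) + (\<integral>y. h y * (1 - \<kappa> y) \<partial>\<mu> m)"
      by (rule Bochner_Integration.integral_add[OF i])
    finally have eq: "(\<integral>y. h y \<partial>\<mu> m) = (\<integral>y. h y * \<kappa> y \<partial>\<mu> m) + (\<integral>y. h y * (1 - \<kappa> y) \<partial>\<mu> m)" .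
    have "(\<integral>y. h y * (1 - \<kappa> y) \<partial>\<mu> m) \<le> (\<integral>y. 4 * C / \<sigma>\<^sup>2 * gauss_weight \<sigma> y \<partial>\<mu> m)"
      by (intro integral_mono i core integrable_mult_right integrable_gauss_weight_mu)
    also have "\<dots> = 4 * C / \<sigma>\<^sup>2 * (\<integral>y. gauss_weight \<sigma> y \<partial>\<mu> m)" by simp
    also have "\<dots> \<le> 4 * C / \<sigma>\<^sup>2 * W"
      unfolding W_def using C \<sigma> by (intro mult_left_mono gauss_weight_mu_le) auto
    finally have "(\<integral>y. h y * (1 - \<kappa> y) \<partial>\<mu> m) \<le> e / 2" using W by simp
    moreover have "0 \<le> (\<integral>y. h y \<partial>\<mu> m)" using nonneg by (intro integral_nonneg_AE) auto
    ultimately show "norm ((\<integral>y. h y \<partial>\<mu> m) - 0) < e" using m0[OF m] eq unfolding real_norm_def by linarith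
  qed
qed

end

section \<open>Monotone Lipschitz functions and the covariance defect\<close>

text \<open>Move from \<open>x\<close> to \<open>y\<close> by changing one coordinate at a time.\<close>

lemma nondecreasing_each_iff:
  fixes f :: "real ^ 'n \<Rightarrow> real"
  shows "nondecreasing_each f \<longleftrightarrow> (\<forall>x y. x \<le> y \<longrightarrow> f x \<le> f y)"
proof
  assume nd: "nondecreasing_each f"
  show "\<forall>x y. x \<le> y \<longrightarrow> f x \<le> f y"
  proof (intro allI impI)
    fix x y :: "real ^ 'n" assume xy: "x \<le> y"
    have "f x \<le> f (\<chi> j. if j \<in> S then y $ j else x $ j)" if "finite S" for S
      using that
    proof (induction S rule: finite_induct)
      case (insert i S)
      let ?z = "\<chi> j. if j \<in> S then y $ j else x $ j"
      have "mono (\<lambda>r. f (\<chi> j. if j = i then r else ?z $ j))" using nd by (simp only: nondecreasing_each_def)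
      then have "f (\<chi> j. if j = i then x $ i else ?z $ j) \<le> f (\<chi> j. if j = i then y $ i else ?z $ j)"
        using xy by (auto simp: mono_def less_eq_vec_def)
      moreover have "(\<chi> j. if j = i then x $ i else ?z $ j) = ?z" using insert by (auto simp: vec_eq_iff)
      moreover have "(\<chi> j. if j = i then y $ i else ?z $ j) = (\<chi> j. if j \<in> insert i S then y $ j else x $ j)"
        by (auto simp: vec_eq_iff)
      ultimately show ?case using insert by simp
    qed simp
    from this[of UNIV] show "f x \<le> f y" by simp
  qed
next
  assume m: "\<forall>x y. x \<le> y \<longrightarrow> f x \<le> f y"
  show "nondecreasing_each f"
    unfolding nondecreasing_each_def mono_def by (auto intro!: m[rule_format] simp: less_eq_vec_def)
qed

definition lip_mono :: "real \<Rightarrow> real \<Rightarrow> (real ^ 'n \<Rightarrow> real) \<Rightarrow> bool" where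
  "lip_mono L B f \<longleftrightarrow> (\<forall>x y. x \<le> y \<longrightarrow> f x \<le> f y) \<and> (\<forall>x y. \<bar>f x - f y\<bar> \<le> L * norm (x - y)) \<and> (\<forall>x. \<bar>f x\<bar> \<le> B)"

lemma lip_monoD:
  assumes "lip_mono L B f"
  shows "x \<le> y \<Longrightarrow> f x \<le> f y" "\<bar>f x - f y\<bar> \<le> L * norm (x - y)" "\<bar>f x\<bar> \<le> B"
  using assms by (auto simp: lip_mono_def)

lemma lip_mono_continuous: "lip_mono L B f \<Longrightarrow> continuous_on UNIV f"
proof -
  assume f: "lip_mono L B f"
  have "(max 0 L)-lipschitz_on UNIV f"
  proof (rule lipschitz_onI)
    fix x y :: "real ^ 'a"
    have "L * norm (x - y) \<le> max 0 L * norm (x - y)" by (intro mult_right_mono) auto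
    then show "dist (f x) (f y) \<le> max 0 L * dist x y"
      using lip_monoD(2)[OF f, of x y] by (simp add: dist_norm)
  qed simp
  then show ?thesis by (rule lipschitz_on_continuous_on)
qed

lemma lip_mono_measurable: "lip_mono L B f \<Longrightarrow> f \<in> borel_measurable borel"
  by (intro borel_measurable_continuous_onI lip_mono_continuous)

text \<open>The \<open>l\<^sup>1\<close> norm of the positive part.\<close>

definition pos_mass :: "real ^ 'n \<Rightarrow> real" where "pos_mass y = (\<Sum>i\<in>UNIV. max 0 (y $ i))"

text \<open>Measures how far \<open>y\<close> is from both orthants: it vanishes exactly when the coordinates of \<open>y\<close>
  do not have opposite signs, and it is at most a multiple of \<open>|y|^2\<close>. It bounds the extent to which
  an increment \<open>y\<close> can move two monotone functions in opposite directions.\<close>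

definition clash :: "real ^ 'n \<Rightarrow> real" where "clash y = min 1 (pos_mass y * pos_mass (- y))"

lemma pos_mass_nonneg: "0 \<le> pos_mass y"
  unfolding pos_mass_def by (intro sum_nonneg) auto

lemma pos_mass_le: "pos_mass (y :: real ^ 'n) \<le> real CARD('n) * norm y"
proof -
  have "pos_mass y \<le> (\<Sum>i\<in>(UNIV::'n set). norm y)"
    unfolding pos_mass_def using component_le_norm_cart[of y] by (intro sum_mono) (auto simp: abs_le_iff)
  then show ?thesis by simp
qed

lemma clash_nonneg: "0 \<le> clash y" and clash_le_1: "clash y \<le> 1"
  by (auto simp: clash_def pos_mass_nonneg)

lemma clash_minus: "clash (- y) = clash y"
  by (simp add: clash_def mult.commute)

lemma clash_continuous: "continuous_on UNIV clash"
  unfolding clash_def pos_mass_def by (intro continuous_intros)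

lemma clash_measurable[measurable]: "clash \<in> borel_measurable borel"
  by (intro borel_measurable_continuous_onI clash_continuous)

lemma clash_bound: "clash (y :: real ^ 'n) \<le> (real CARD('n))\<^sup>2 * min 1 ((norm y)\<^sup>2)"
proof -
  have "pos_mass y * pos_mass (- y) \<le> (real CARD('n) * norm y) * (real CARD('n) * norm y)"
    using pos_mass_le[of y] pos_mass_le[of "- y"] pos_mass_nonneg by (intro mult_mono) auto
  then have 1: "clash y \<le> (real CARD('n))\<^sup>2 * (norm y)\<^sup>2" by (simp add: clash_def power2_eq_square mult_ac)
  have "clash y \<le> 1" by (rule clash_le_1)
  also have "1 \<le> (real CARD('n))\<^sup>2 * 1" by (simp add: Suc_leI)
  finally show ?thesis using 1 by (cases "1 \<le> (norm y)\<^sup>2") (auto simp: min_def)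
qed

lemma clash_orthant:
  assumes "y \<in> nonneg_orthant \<union> nonpos_orthant"
  shows "clash y = 0"
proof -
  have "pos_mass y = 0 \<or> pos_mass (- y) = 0"
  proof (cases "y \<in> nonneg_orthant")
    case True
    then have "max 0 ((- y) $ i) = 0" for i by (auto simp: nonneg_orthant_def)
    then show ?thesis by (simp only: pos_mass_def sum.neutral_const simp_thms)
  next
    case False
    then have "max 0 (y $ i) = 0" for i using assms by (auto simp: nonpos_orthant_def)
    then show ?thesis by (simp only: pos_mass_def sum.neutral_const simp_thms)
  qed
  then show ?thesis by (auto simp: clash_def)
qed

lemma lip_mono_increment_le:
  assumes f: "lip_mono L B f" and L: "0 \<le> L"
  shows "f x - f y \<le> L * pos_mass (x - y)"
proof -
  let ?p = "\<chi> i. max 0 ((x - y) $ i)"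
  have "x \<le> y + ?p" by (simp add: less_eq_vec_def max_def)
  then have "f x \<le> f (y + ?p)" by (rule lip_monoD(1)[OF f])
  also have "\<dots> \<le> f y + L * norm ?p" using lip_monoD(2)[OF f, of "y + ?p" y] by simp
  also have "norm ?p \<le> pos_mass (x - y)"
    unfolding pos_mass_def using norm_le_l1_cart[of ?p] by simp
  finally show ?thesis using L by (simp add: mult_left_mono)
qed

text \<open>If the increments of \<open>f\<close> and \<open>g\<close> have opposite signs, one of them is at most \<open>L\<close> times the
  positive mass of \<open>x - y\<close> and the other at most \<open>L\<close> times the negative mass.\<close>

lemma lip_mono_increments_product:
  assumes f: "lip_mono L B f" and g: "lip_mono L B g" and L: "0 \<le> L"
  shows "- ((L\<^sup>2 + 4 * B\<^sup>2) * clash (x - y)) \<le> (f x - f y) * (g x - g y)"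
proof -
  let ?p = "pos_mass (x - y)" and ?q = "pos_mass (y - x)"
  let ?a = "f x - f y" and ?b = "g x - g y"
  have pq: "0 \<le> ?p" "0 \<le> ?q" by (auto simp: pos_mass_nonneg)
  have a: "?a \<le> L * ?p" "- ?a \<le> L * ?q" and b: "?b \<le> L * ?p" "- ?b \<le> L * ?q"
    using lip_mono_increment_le[OF f L, of x y] lip_mono_increment_le[OF f L, of y x]
      lip_mono_increment_le[OF g L, of x y] lip_mono_increment_le[OF g L, of y x] by auto
  have "- (L\<^sup>2 * (?p * ?q)) \<le> ?a * ?b"
  proof (cases "0 \<le> ?a")
    case a0: True
    show ?thesis
    proof (cases "0 \<le> ?b")
      case True
      then have "0 \<le> ?a * ?b" using a0 by simp
      moreover have "0 \<le> L\<^sup>2 * (?p * ?q)" using pq by simp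
      ultimately show ?thesis by linarith
    next
      case False
      have "?a * (- ?b) \<le> (L * ?p) * (L * ?q)" using a0 False a b pq L by (intro mult_mono) auto
      also have "\<dots> = L\<^sup>2 * (?p * ?q)" by (simp add: power2_eq_square)
      finally show ?thesis unfolding mult_minus_right by linarith
    qed
  next
    case a0: False
    show ?thesis
    proof (cases "0 \<le> ?b")
      case False
      then have "0 \<le> ?a * ?b" using a0 by (simp add: mult_nonpos_nonpos)
      moreover have "0 \<le> L\<^sup>2 * (?p * ?q)" using pq by simp
      ultimately show ?thesis by linarith
    next
      case True
      have "(- ?a) * ?b \<le> (L * ?q) * (L * ?p)" using a0 True a b pq L by (intro mult_mono) auto
      also have "\<dots> = L\<^sup>2 * (?p * ?q)" by (simp add: power2_eq_square)
      finally show ?thesis unfolding mult_minus_left by linarith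
    qed
  qed
  moreover have "- (4 * B\<^sup>2) \<le> ?a * ?b"
  proof -
    have "\<bar>?a\<bar> \<le> 2 * B" "\<bar>?b\<bar> \<le> 2 * B"
      using lip_monoD(3)[OF f, of x] lip_monoD(3)[OF f, of y] lip_monoD(3)[OF g, of x] lip_monoD(3)[OF g, of y] by auto
    then have "\<bar>?a\<bar> * \<bar>?b\<bar> \<le> (2 * B) * (2 * B)" by (intro mult_mono) auto
    then have "\<bar>?a * ?b\<bar> \<le> 4 * B\<^sup>2" by (simp add: abs_mult power2_eq_square)
    then show ?thesis by linarith
  qed
  moreover have "(L\<^sup>2 + 4 * B\<^sup>2) * clash (x - y) \<ge> min (L\<^sup>2 * (?p * ?q)) (4 * B\<^sup>2)"
  proof (cases "?p * ?q \<le> 1")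
    case True
    then have "clash (x - y) = ?p * ?q" by (simp add: clash_def)
    moreover have "L\<^sup>2 * (?p * ?q) \<le> (L\<^sup>2 + 4 * B\<^sup>2) * (?p * ?q)" using pq by (intro mult_right_mono) auto
    ultimately show ?thesis by simp
  next
    case False
    then have "clash (x - y) = 1" by (simp add: clash_def)
    then show ?thesis by (simp add: min_le_iff_disj)
  qed
  ultimately show ?thesis by linarith
qed

lemma prob_integrable:
  fixes f :: "real ^ 'n \<Rightarrow> real"
  assumes "prob_space D" "sets D = sets borel" "f \<in> borel_measurable borel" "\<And>y. \<bar>f y\<bar> \<le> B"
  shows "integrable D f"
proof -
  interpret prob_space D by fact
  show ?thesis by (rule integrable_const_bound[where B = B]) (use assms in \<open>auto simp: measurable_cong_sets[OF assms(2) refl]\<close>)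
qed

text \<open>The covariance is half the expectation of \<open>(f x - f y) (g x - g y)\<close> over two independent
  copies.\<close>

lemma covariance_defect:
  fixes D :: "(real ^ 'n) measure"
  assumes D: "prob_space D" "sets D = sets borel"
    and f: "lip_mono L B f" and g: "lip_mono L B g" and L: "0 \<le> L"
  shows "(\<integral>x. f x \<partial>D) * (\<integral>x. g x \<partial>D) - (L\<^sup>2 + 4 * B\<^sup>2) / 2 * (\<integral>z. clash z \<partial>sym_law D)
    \<le> (\<integral>x. f x * g x \<partial>D)"
proof -
  interpret prob_space D by fact
  note [measurable_cong] = D(2)
  have [measurable]: "f \<in> borel_measurable borel" "g \<in> borel_measurable borel"
    using f g by (auto intro: lip_mono_measurable)
  have B: "0 \<le> B" using lip_monoD(3)[OF f, of 0] by simp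
  define K where "K = L\<^sup>2 + 4 * B\<^sup>2"
  have fg: "\<bar>f x * g x\<bar> \<le> B * B" for x
    using lip_monoD(3)[OF f, of x] lip_monoD(3)[OF g, of x] B by (auto simp: abs_mult intro: mult_mono)
  have i: "integrable D f" "integrable D g" "integrable D (\<lambda>x. f x * g x)"
    by (rule prob_integrable[OF D]; use lip_monoD(3)[OF f] lip_monoD(3)[OF g] fg in auto)+
  have ic: "integrable D (\<lambda>y. clash (x - y))" for x
    by (rule prob_integrable[OF D, where B = 1]) (auto simp: clash_nonneg clash_le_1)
  define F where "F = (\<integral>x. f x \<partial>D)"
  define H where "H = (\<integral>x. g x \<partial>D)"
  define R where "R = (\<integral>x. f x * g x \<partial>D)"
  have inner: "- (K * (\<integral>y. clash (x - y) \<partial>D)) \<le> f x * g x - f x * H - g x * F + R" for x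
  proof -
    have "(\<integral>y. - (K * clash (x - y)) \<partial>D) \<le> (\<integral>y. (f x * g x - f x * g y - g x * f y) + f y * g y \<partial>D)"
    proof (rule integral_mono)
      show "- (K * clash (x - y)) \<le> (f x * g x - f x * g y - g x * f y) + f y * g y" for y
        using lip_mono_increments_product[OF f g L, of x y] by (simp add: K_def algebra_simps)
    qed (use ic i in auto)
    also have "\<dots> = f x * g x - f x * H - g x * F + R"
      using i by (simp add: F_def H_def R_def prob_space)
    finally show ?thesis by simp
  qed
  have "(\<integral>x. - (K * (\<integral>y. clash (x - y) \<partial>D)) \<partial>D) \<le> (\<integral>x. f x * g x - f x * H - g x * F + R \<partial>D)"
  proof (rule integral_mono[OF _ _ inner])
    have "(\<lambda>x. \<integral>y. clash (x - y) \<partial>D) \<in> borel_measurable D" by measurable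
    moreover have "\<bar>\<integral>y. clash (x - y) \<partial>D\<bar> \<le> 1" for x
    proof -
      have "(\<integral>y. clash (x - y) \<partial>D) \<le> (\<integral>y. 1 \<partial>D)" by (intro integral_mono ic clash_le_1) auto
      moreover have "0 \<le> (\<integral>y. clash (x - y) \<partial>D)" by (intro integral_nonneg_AE) (auto simp: clash_nonneg)
      ultimately show ?thesis by (simp add: prob_space)
    qed
    ultimately have "integrable D (\<lambda>x. \<integral>y. clash (x - y) \<partial>D)" by (intro integrable_const_bound[where B = 1]) auto
    then show "integrable D (\<lambda>x. - (K * (\<integral>y. clash (x - y) \<partial>D)))" by auto
  qed (use i in auto)
  also have "\<dots> = 2 * (R - F * H)"
    using i by (simp add: F_def[symmetric] H_def[symmetric] R_def[symmetric] prob_space)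
  also have "(\<integral>x. - (K * (\<integral>y. clash (x - y) \<partial>D)) \<partial>D) = - (K * (\<integral>z. clash z \<partial>sym_law D))"
    by (subst integral_sym_law(1)[OF D, where B = 1]) (auto simp: clash_nonneg clash_le_1)
  finally show ?thesis by (simp add: F_def H_def R_def K_def)
qed

text \<open>The class is stable under the transition operators of the process, which makes the
  induction over the steps of a partition possible.\<close>

lemma lip_mono_average:
  fixes D :: "(real ^ 'n) measure"
  assumes D: "prob_space D" "sets D = sets borel" and f: "lip_mono L B f"
  shows "lip_mono L B (\<lambda>x. \<integral>y. f (x + y) \<partial>D)"
proof -
  interpret prob_space D by fact
  have [measurable]: "f \<in> borel_measurable borel" using f by (rule lip_mono_measurable)
  have i: "integrable D (\<lambda>y. f (x + y))" for x
    by (rule prob_integrable[OF D, where B = B]) (use lip_monoD(3)[OF f] in auto)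
  show ?thesis
    unfolding lip_mono_def
  proof (intro conjI allI impI)
    fix x z :: "real ^ 'n"
    assume "x \<le> z"
    then show "(\<integral>y. f (x + y) \<partial>D) \<le> (\<integral>y. f (z + y) \<partial>D)"
      by (intro integral_mono i lip_monoD(1)[OF f]) (simp add: less_eq_vec_def)
  next
    fix x z :: "real ^ 'n"
    have "\<bar>(\<integral>y. f (x + y) \<partial>D) - (\<integral>y. f (z + y) \<partial>D)\<bar> = \<bar>\<integral>y. f (x + y) - f (z + y) \<partial>D\<bar>"
      using i by simp
    also have "\<dots> \<le> (\<integral>y. \<bar>f (x + y) - f (z + y)\<bar> \<partial>D)" by (rule integral_abs_bound)
    also have "\<dots> \<le> (\<integral>y. L * norm (x - z) \<partial>D)"
    proof (rule integral_mono)
      show "\<bar>f (x + y) - f (z + y)\<bar> \<le> L * norm (x - z)" for y using lip_monoD(2)[OF f, of "x + y" "z + y"] by simp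
    qed (use i in auto)
    finally show "\<bar>(\<integral>y. f (x + y) \<partial>D) - (\<integral>y. f (z + y) \<partial>D)\<bar> \<le> L * norm (x - z)" by (simp add: prob_space)
  next
    fix x :: "real ^ 'n"
    have "\<bar>\<integral>y. f (x + y) \<partial>D\<bar> \<le> (\<integral>y. \<bar>f (x + y)\<bar> \<partial>D)" by (rule integral_abs_bound)
    also have "\<dots> \<le> (\<integral>y. B \<partial>D)" by (intro integral_mono integrable_abs i lip_monoD(3)[OF f]) auto
    finally show "\<bar>\<integral>y. f (x + y) \<partial>D\<bar> \<le> B" by (simp add: prob_space)
  qed
qed

text \<open>The infimal convolution with \<open>m |.|\<close>: a Lipschitz regularisation that keeps monotonicity.\<close>

definition inf_conv :: "(real ^ 'n \<Rightarrow> real) \<Rightarrow> nat \<Rightarrow> real ^ 'n \<Rightarrow> real" where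
  "inf_conv f m x = (INF y. f y + real m * norm (x - y))"

lemma inf_conv_lip_mono:
  fixes f :: "real ^ 'n \<Rightarrow> real"
  assumes mono: "\<And>x y. x \<le> y \<Longrightarrow> f x \<le> f y" and B: "\<And>x. \<bar>f x\<bar> \<le> B"
  shows inf_conv_le: "inf_conv f m x \<le> f y + real m * norm (x - y)"
    and inf_conv_ge: "(\<And>y. c \<le> f y + real m * norm (x - y)) \<Longrightarrow> c \<le> inf_conv f m x"
    and inf_conv_lip: "lip_mono (real m) B (inf_conv f m)"
proof -
  have ge: "- B \<le> f y + real m * norm (x - y)" for x y
  proof -
    have "0 \<le> real m * norm (x - y)" by simp
    then show ?thesis using B[of y] by linarith
  qed
  have le: "inf_conv f m x \<le> f y + real m * norm (x - y)" for x y
    unfolding inf_conv_def by (rule cINF_lower) (use ge in \<open>auto intro!: bdd_belowI[of _ "- B"]\<close>)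
  have grt: "c \<le> inf_conv f m x" if "\<And>y. c \<le> f y + real m * norm (x - y)" for c x
    unfolding inf_conv_def by (rule cINF_greatest) (use that in auto)
  show "inf_conv f m x \<le> f y + real m * norm (x - y)" by (rule le)
  show "(\<And>y. c \<le> f y + real m * norm (x - y)) \<Longrightarrow> c \<le> inf_conv f m x" by (rule grt)
  have lip: "inf_conv f m x - real m * norm (x - z) \<le> inf_conv f m z" for x z
  proof (rule grt)
    fix y
    have "norm (x - y) \<le> norm (x - z) + norm (z - y)" using norm_triangle_ineq[of "x - z" "z - y"] by simp
    then have "real m * norm (x - y) \<le> real m * norm (x - z) + real m * norm (z - y)"
      unfolding distrib_left[symmetric] by (rule mult_left_mono) simp
    then show "inf_conv f m x - real m * norm (x - z) \<le> f y + real m * norm (z - y)"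
      using le[of x y] by linarith
  qed
  show "lip_mono (real m) B (inf_conv f m)"
    unfolding lip_mono_def
  proof (intro conjI allI impI)
    fix x z :: "real ^ 'n" assume xz: "x \<le> z"
    show "inf_conv f m x \<le> inf_conv f m z"
    proof (rule grt)
      fix y
      have "y - (z - x) \<le> y" using xz by (simp add: less_eq_vec_def)
      then have "f (y - (z - x)) \<le> f y" by (rule mono)
      then show "inf_conv f m x \<le> f y + real m * norm (z - y)" using le[of x "y - (z - x)"] by simp
    qed
  next
    fix x z :: "real ^ 'n"
    show "\<bar>inf_conv f m x - inf_conv f m z\<bar> \<le> real m * norm (x - z)"
      using lip[of x z] lip[of z x] by (simp add: norm_minus_commute abs_le_iff)
  next
    fix x
    have "inf_conv f m x \<le> f x" using le[of x x] by simp
    moreover have "- B \<le> inf_conv f m x" by (rule grt) (rule ge)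
    ultimately show "\<bar>inf_conv f m x\<bar> \<le> B" using B[of x] by (simp add: abs_le_iff)
  qed
qed

lemma inf_conv_tendsto:
  fixes f :: "real ^ 'n \<Rightarrow> real"
  assumes mono: "\<And>x y. x \<le> y \<Longrightarrow> f x \<le> f y" and B: "\<And>x. \<bar>f x\<bar> \<le> B" and cont: "continuous_on UNIV f"
  shows "(\<lambda>m. inf_conv f m x) \<longlonglongrightarrow> f x"
proof (rule LIMSEQ_I)
  fix e :: real assume e: "0 < e"
  have "0 < e / 2" using e by simp
  then obtain d where d: "0 < d" "\<And>y. dist y x < d \<Longrightarrow> dist (f y) (f x) < e / 2"
    using cont unfolding continuous_on_iff by (metis UNIV_I)
  obtain m0 :: nat where m0: "2 * B / d \<le> real m0" using real_arch_simple by blast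
  show "\<exists>m0. \<forall>m\<ge>m0. norm (inf_conv f m x - f x) < e"
  proof (intro exI[of _ m0] allI impI)
    fix m assume m: "m0 \<le> m"
    have "f x - e / 2 \<le> inf_conv f m x"
    proof (rule inf_conv_ge[OF mono B])
      fix y
      show "f x - e / 2 \<le> f y + real m * norm (x - y)"
      proof (cases "dist y x < d")
        case True
        then have "f x - e / 2 \<le> f y" using d(2)[of y] unfolding dist_real_def by linarith
        moreover have "0 \<le> real m * norm (x - y)" by simp
        ultimately show ?thesis by linarith
      next
        case False
        then have "d \<le> norm (x - y)" by (simp add: dist_norm norm_minus_commute)
        moreover have "2 * B \<le> real m * d"
          using m0 m d(1) by (metis (no_types, opaque_lifting) of_nat_le_iff order_trans pos_divide_le_eq)
        ultimately have "2 * B \<le> real m * norm (x - y)"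
          by (meson mult_left_mono of_nat_0_le_iff order_trans)
        then show ?thesis using B[of x] B[of y] e by (auto simp: abs_le_iff)
      qed
    qed
    moreover have "inf_conv f m x \<le> f x" using inf_conv_le[OF mono B, where m = m and x = x and y = x] by simp
    ultimately show "norm (inf_conv f m x - f x) < e" using e by auto
  qed
qed

section \<open>Jumps in the orthants imply association\<close>

text \<open>The partition of \<open>[0, t]\<close> that contains \<open>s\<close> and divides \<open>[0, s]\<close> and \<open>[s, t]\<close> evenly into
  \<open>m + 1\<close> steps each. The triplet describes \<open>X t\<close>, so the partition starts at \<open>0\<close> even where only the
  increment over \<open>[s, t]\<close> matters.\<close>

definition two_piece :: "real \<Rightarrow> real \<Rightarrow> nat \<Rightarrow> nat \<Rightarrow> real" where
  "two_piece s t m k = (if k \<le> Suc m then s * real k / real (Suc m)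
     else s + (t - s) * real (k - Suc m) / real (Suc m))"

lemma two_piece_zero: "two_piece s t m 0 = 0"
  by (simp add: two_piece_def)

lemma two_piece_shift: "two_piece s t m (k + Suc m) = s + (t - s) * real k / real (Suc m)"
  by (cases k) (auto simp: two_piece_def simp del: of_nat_Suc)

lemma two_piece_step:
  assumes "0 \<le> s" "s \<le> t"
  shows "0 \<le> two_piece s t m (Suc k) - two_piece s t m k"
    and "two_piece s t m (Suc k) - two_piece s t m k \<le> t / real (Suc m)"
proof -
  have "two_piece s t m (Suc k) - two_piece s t m k = s / real (Suc m) \<or>
    two_piece s t m (Suc k) - two_piece s t m k = (t - s) / real (Suc m)"
  proof (cases "k < Suc m")
    case True
    have "s * real (Suc k) / real (Suc m) - s * real k / real (Suc m) = (s * real (Suc k) - s * real k) / real (Suc m)"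
      by (rule diff_divide_distrib[symmetric])
    also have "s * real (Suc k) - s * real k = s" by (simp add: algebra_simps)
    finally show ?thesis using True by (simp add: two_piece_def del: of_nat_Suc)
  next
    case False
    then obtain j where "k = j + Suc m" by (metis add.commute le_Suc_ex not_less)
    then show ?thesis using two_piece_shift[of s t m j] two_piece_shift[of s t m "Suc j"]
      by (auto simp: field_simps)
  qed
  then show "0 \<le> two_piece s t m (Suc k) - two_piece s t m k"
    and "two_piece s t m (Suc k) - two_piece s t m k \<le> t / real (Suc m)"
    using assms divide_right_mono[of "t - s" t "real (Suc m)"] divide_right_mono[of s t "real (Suc m)"]
      divide_nonneg_nonneg[of s "real (Suc m)", OF _ of_nat_0_le_iff]
      divide_nonneg_nonneg[of "t - s" "real (Suc m)", OF _ of_nat_0_le_iff]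
    by linarith+
qed

context additive_process begin

lemma refining_two_piece:
  assumes st: "0 \<le> s" "s \<le> t" and triplet: "characteristic_triplet M (X t) b 0 \<nu>"
  shows "refining_partitions M G X t b \<nu> (two_piece s t) (\<lambda>m. 2 * Suc m)"
proof (intro refining_partitions.intro refining_partitions_axioms.intro)
  show "additive_process M G X" by unfold_locales
  show "characteristic_triplet M (X t) b 0 \<nu>" by fact
  fix m
  show "two_piece s t m (2 * Suc m) = t"
    using two_piece_shift[of s t m "Suc m"] by (simp add: mult_2 del: of_nat_Suc)
  show "two_piece s t m k \<le> two_piece s t m (Suc k)" for k
    using two_piece_step(1)[OF st, of m k] by simp
next
  fix d :: real assume d: "0 < d"
  have "(\<lambda>m. t * (1 / real (Suc m))) \<longlonglongrightarrow> t * 0"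
    by (intro tendsto_intros LIMSEQ_Suc[OF lim_1_over_n])
  then have "eventually (\<lambda>m. t * (1 / real (Suc m)) < d) sequentially"
    using d by (intro order_tendstoD) auto
  then show "eventually (\<lambda>m. \<forall>k<2 * Suc m. two_piece s t m (Suc k) - two_piece s t m k < d) sequentially"
  proof eventually_elim
    case (elim m)
    then show ?case using two_piece_step(2)[OF st, of m] by (auto intro: le_less_trans)
  qed
qed (auto simp: two_piece_zero)

text \<open>Splitting off the last step by the Markov property, the covariance is the expected
  covariance over that step plus the covariance of the averaged functions, which belong to the same
  class with the same constants. The defects of the single steps therefore add up.\<close>

lemma covariance_defect_chain:
  fixes \<tau> :: "nat \<Rightarrow> real"
  assumes L: "0 \<le> L" and \<tau>0: "0 \<le> \<tau> 0" and mono: "\<And>k. \<tau> k \<le> \<tau> (Suc k)"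
    and f: "lip_mono L B f" and g: "lip_mono L B g"
  shows "(\<integral>x. f x \<partial>law (\<tau> 0) (\<tau> j)) * (\<integral>x. g x \<partial>law (\<tau> 0) (\<tau> j))
      - (L\<^sup>2 + 4 * B\<^sup>2) / 2 * (\<Sum>k<j. \<integral>z. clash z \<partial>sym_law (law (\<tau> k) (\<tau> (Suc k))))
    \<le> (\<integral>x. f x * g x \<partial>law (\<tau> 0) (\<tau> j))"
  using f g
proof (induction j arbitrary: f g)
  case 0
  have "(\<integral>x. h x \<partial>law (\<tau> 0) (\<tau> 0)) = h 0" if "h \<in> borel_measurable borel" for h :: "real ^ 'n \<Rightarrow> real"
    using that \<tau>0 by (simp add: integral_law prob_space)
  then show ?case using 0[THEN lip_mono_measurable] by simp
next
  case (Suc j)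
  have le: "\<tau> 0 \<le> \<tau> j" by (rule lift_Suc_mono_le[of \<tau>, OF mono]) simp
  have pos: "0 \<le> \<tau> j" "0 \<le> \<tau> (Suc j)" using le \<tau>0 mono[of j] by auto
  have D: "prob_space (law (\<tau> j) (\<tau> (Suc j)))" "sets (law (\<tau> j) (\<tau> (Suc j))) = sets borel"
    using pos by (auto intro: prob_space_law)
  have E: "prob_space (law (\<tau> 0) (\<tau> j))" "sets (law (\<tau> 0) (\<tau> j)) = sets borel"
    using pos \<tau>0 by (auto intro: prob_space_law)
  interpret E: prob_space "law (\<tau> 0) (\<tau> j)" by (rule E)
  note f = Suc.prems(1) and g = Suc.prems(2)
  have [measurable]: "f \<in> borel_measurable borel" "g \<in> borel_measurable borel"
    using f g by (auto intro: lip_mono_measurable)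
  have B: "0 \<le> B" using lip_monoD(3)[OF f, of 0] by simp
  have fgB: "\<bar>f x * g x\<bar> \<le> B * B" for x
    using lip_monoD(3)[OF f, of x] lip_monoD(3)[OF g, of x] B by (auto simp: abs_mult intro: mult_mono)
  define F where "F x = (\<integral>y. f (x + y) \<partial>law (\<tau> j) (\<tau> (Suc j)))" for x
  define H where "H x = (\<integral>y. g (x + y) \<partial>law (\<tau> j) (\<tau> (Suc j)))" for x
  define R where "R x = (\<integral>y. f (x + y) * g (x + y) \<partial>law (\<tau> j) (\<tau> (Suc j)))" for x
  define c where "c = (L\<^sup>2 + 4 * B\<^sup>2) / 2 * (\<integral>z. clash z \<partial>sym_law (law (\<tau> j) (\<tau> (Suc j))))"
  have F: "lip_mono L B F" and H: "lip_mono L B H"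
    unfolding F_def H_def by (intro lip_mono_average D f g)+
  have [measurable]: "F \<in> borel_measurable borel" "H \<in> borel_measurable borel"
    using F H by (auto intro: lip_mono_measurable)
  have split: "(\<integral>x. f x \<partial>law (\<tau> 0) (\<tau> (Suc j))) = (\<integral>x. F x \<partial>law (\<tau> 0) (\<tau> j))"
    "(\<integral>x. g x \<partial>law (\<tau> 0) (\<tau> (Suc j))) = (\<integral>x. H x \<partial>law (\<tau> 0) (\<tau> j))"
    "(\<integral>x. f x * g x \<partial>law (\<tau> 0) (\<tau> (Suc j))) = (\<integral>x. R x \<partial>law (\<tau> 0) (\<tau> j))"
    unfolding F_def H_def R_def
    by (rule integral_law_split[OF \<tau>0 le mono]; use lip_monoD(3)[OF f] lip_monoD(3)[OF g] fgB in auto)+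
  have step: "F x * H x - c \<le> R x" for x
  proof -
    have "lip_mono L B (\<lambda>y. f (x + y))" "lip_mono L B (\<lambda>y. g (x + y))"
      using f g by (auto simp: lip_mono_def less_eq_vec_def intro: order_trans)
        (metis add_diff_cancel_left)+
    from covariance_defect[OF D this L] show ?thesis by (simp add: F_def H_def R_def c_def)
  qed
  have iFH: "integrable (law (\<tau> 0) (\<tau> j)) (\<lambda>x. F x * H x)"
  proof (rule prob_integrable[OF E, where B = "B * B"])
    show "\<bar>F x * H x\<bar> \<le> B * B" for x
      using lip_monoD(3)[OF F, of x] lip_monoD(3)[OF H, of x] B by (auto simp: abs_mult intro: mult_mono)
  qed measurable
  have iR: "integrable (law (\<tau> 0) (\<tau> j)) R"
  proof -
    interpret D: prob_space "law (\<tau> j) (\<tau> (Suc j))" by (rule D)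
    have "R \<in> borel_measurable borel" unfolding R_def
      by (rule D.borel_measurable_lebesgue_integral) (simp cong: measurable_cong_sets sets_pair_measure_cong)
    moreover have "\<bar>R x\<bar> \<le> B * B" for x
    proof -
      have i: "integrable (law (\<tau> j) (\<tau> (Suc j))) (\<lambda>y. f (x + y) * g (x + y))"
        by (rule prob_integrable[OF D, where B = "B * B"]) (use fgB in auto)
      have "\<bar>R x\<bar> \<le> (\<integral>y. \<bar>f (x + y) * g (x + y)\<bar> \<partial>law (\<tau> j) (\<tau> (Suc j)))"
        unfolding R_def by (rule integral_abs_bound)
      also have "\<dots> \<le> (\<integral>y. B * B \<partial>law (\<tau> j) (\<tau> (Suc j)))"
        by (intro integral_mono integrable_abs i fgB) auto
      finally show ?thesis by (simp add: D.prob_space)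
    qed
    ultimately show ?thesis by (intro prob_integrable[OF E])
  qed
  have "(\<integral>x. F x * H x \<partial>law (\<tau> 0) (\<tau> j)) - c = (\<integral>x. F x * H x - c \<partial>law (\<tau> 0) (\<tau> j))"
    using iFH by (simp add: E.prob_space)
  also have "\<dots> \<le> (\<integral>x. R x \<partial>law (\<tau> 0) (\<tau> j))"
    by (intro integral_mono step iR Bochner_Integration.integrable_diff iFH) auto
  finally show ?case
    using Suc.IH[OF F H] unfolding split by (simp add: c_def algebra_simps)
qed

text \<open>The total defect over the steps in \<open>[s, t]\<close> is at most that over all steps in \<open>[0, t]\<close>, which
  tends to zero as \<open>clash\<close> vanishes on the orthants. A bound for \<open>X t - X s\<close> thus follows from the
  Levy measure of \<open>X t\<close>.\<close>

lemma lip_association_of_orthant_jumps: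
  assumes st: "0 \<le> s" "s \<le> t" and triplet: "characteristic_triplet M (X t) b 0 \<nu>"
    and null: "emeasure \<nu> (- (nonneg_orthant \<union> nonpos_orthant)) = 0"
    and L: "0 \<le> L" and f: "lip_mono L B f" and g: "lip_mono L B g"
  shows "(\<integral>x. f x \<partial>law s t) * (\<integral>x. g x \<partial>law s t) \<le> (\<integral>x. f x * g x \<partial>law s t)"
proof -
  interpret P: refining_partitions M G X t b \<nu> "two_piece s t" "\<lambda>m. 2 * Suc m"
    by (rule refining_two_piece[OF st triplet])
  define K where "K = (L\<^sup>2 + 4 * B\<^sup>2) / 2"
  have "AE y in scale_measure 2 \<nu>. clash y = 0"
  proof (rule AE_I)
    have sets: "sets \<nu> = sets borel" using triplet by (auto simp: characteristic_triplet_def levy_measure_def)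
    have cl: "closed (nonneg_orthant :: (real ^ 'n) set)" "closed (nonpos_orthant :: (real ^ 'n) set)"
      unfolding nonneg_orthant_def nonpos_orthant_def
      by (intro closed_Collect_all closed_Collect_le continuous_intros)+
    show "- (nonneg_orthant \<union> nonpos_orthant) \<in> sets (scale_measure 2 \<nu>)"
      using cl by (simp add: sets)
    show "{y \<in> space (scale_measure 2 \<nu>). clash y \<noteq> 0} \<subseteq> - (nonneg_orthant \<union> nonpos_orthant)"
      using clash_orthant by auto
    show "emeasure (scale_measure 2 \<nu>) (- (nonneg_orthant \<union> nonpos_orthant)) = 0" using null by simp
  qed
  then have lim: "(\<lambda>m. \<integral>y. clash y \<partial>P.\<mu> m) \<longlonglongrightarrow> 0"
    by (intro P.integral_mu_vanishes[where C = "(real CARD('n))\<^sup>2"] clash_continuous clash_bound clash_minus clash_nonneg)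
  have "(\<integral>x. f x \<partial>law s t) * (\<integral>x. g x \<partial>law s t) - K * (\<integral>y. clash y \<partial>P.\<mu> m) \<le> (\<integral>x. f x * g x \<partial>law s t)" for m
  proof -
    define \<sigma> where "\<sigma> k = two_piece s t m (k + Suc m)" for k
    define a where "a k = (\<integral>z. clash z \<partial>sym_law (law (two_piece s t m k) (two_piece s t m (Suc k))))" for k
    have a: "0 \<le> a k" for k unfolding a_def by (rule integral_nonneg_AE) (simp add: clash_nonneg)
    have \<sigma>: "\<sigma> 0 = s" "\<sigma> (Suc m) = t"
      using two_piece_shift[of s t m 0] two_piece_shift[of s t m "Suc m"] by (simp_all add: \<sigma>_def del: of_nat_Suc)
    have "\<sigma> k \<le> \<sigma> (Suc k)" for k using two_piece_step(1)[OF st, of m "k + Suc m"] by (simp add: \<sigma>_def)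
    then have "(\<integral>x. f x \<partial>law s t) * (\<integral>x. g x \<partial>law s t) - K * (\<Sum>k<Suc m. a (k + Suc m)) \<le> (\<integral>x. f x * g x \<partial>law s t)"
      using covariance_defect_chain[OF L _ _ f g, of \<sigma> "Suc m"] st
      unfolding \<sigma> K_def by (simp add: \<sigma>_def a_def)
    moreover have "(\<Sum>k<Suc m. a (k + Suc m)) \<le> (\<integral>y. clash y \<partial>P.\<mu> m)"
    proof -
      have "(\<Sum>k<Suc m. a (k + Suc m)) = (\<Sum>k\<in>{Suc m..<Suc m + Suc m}. a k)"
        using sum.shift_bounds_nat_ivl[of a 0 "Suc m" "Suc m"] by (simp only: add_0 lessThan_atLeast0)
      also have "\<dots> \<le> (\<Sum>k<2 * Suc m. a k)" using a by (intro sum_mono2) auto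
      also have "\<dots> = (\<integral>y. clash y \<partial>P.\<mu> m)"
        unfolding a_def by (subst P.integral_mu[where B = 1]) (auto simp: clash_nonneg clash_le_1)
      finally show ?thesis .
    qed
    then have "K * (\<Sum>k<Suc m. a (k + Suc m)) \<le> K * (\<integral>y. clash y \<partial>P.\<mu> m)"
      by (rule mult_left_mono) (simp add: K_def)
    ultimately show ?thesis by linarith
  qed
  moreover have "(\<lambda>m. (\<integral>x. f x \<partial>law s t) * (\<integral>x. g x \<partial>law s t) - K * (\<integral>y. clash y \<partial>P.\<mu> m))
      \<longlonglongrightarrow> (\<integral>x. f x \<partial>law s t) * (\<integral>x. g x \<partial>law s t) - K * 0"
    by (intro tendsto_intros lim)
  ultimately show ?thesis by (intro LIMSEQ_le_const2) auto
qed

lemma integral_law_right_continuous: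
  fixes h :: "real ^ 'n \<Rightarrow> real"
  assumes s: "0 \<le> s" and t: "0 \<le> t" and cont: "continuous_on UNIV h" and B: "\<And>x. \<bar>h x\<bar> \<le> B"
    and r: "\<And>i. t < r i" "r \<longlonglongrightarrow> t"
  shows "(\<lambda>i. \<integral>x. h x \<partial>law s (r i)) \<longlonglongrightarrow> (\<integral>x. h x \<partial>law s t)"
proof -
  have [measurable]: "h \<in> borel_measurable borel" using cont by (rule borel_measurable_continuous_onI)
  have pos: "0 \<le> r i" for i using r(1)[of i] t by simp
  have [measurable]: "X s \<in> borel_measurable M" "X t \<in> borel_measurable M" "X (r i) \<in> borel_measurable M" for i
    using s t pos by (auto intro: X_measurable)
  have "(\<lambda>i. \<integral>\<omega>. h (X (r i) \<omega> - X s \<omega>) \<partial>M) \<longlonglongrightarrow> (\<integral>\<omega>. h (X t \<omega> - X s \<omega>) \<partial>M)"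
  proof (rule integral_dominated_convergence[where w = "\<lambda>_. B"])
    show "AE \<omega> in M. (\<lambda>i. h (X (r i) \<omega> - X s \<omega>)) \<longlonglongrightarrow> h (X t \<omega> - X s \<omega>)"
    proof (rule AE_I2)
      fix \<omega> assume "\<omega> \<in> space M"
      then have "((\<lambda>u. X u \<omega>) \<longlongrightarrow> X t \<omega>) (at_right t)"
        using cadlag_paths t unfolding cadlag_def by blast
      moreover have "filterlim r (at_right t) sequentially"
        using r by (auto simp: filterlim_at intro!: always_eventually)
      ultimately have "(\<lambda>i. X (r i) \<omega>) \<longlonglongrightarrow> X t \<omega>" by (rule filterlim_compose)
      then have "(\<lambda>i. X (r i) \<omega> - X s \<omega>) \<longlonglongrightarrow> X t \<omega> - X s \<omega>" by (intro tendsto_intros)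
      then show "(\<lambda>i. h (X (r i) \<omega> - X s \<omega>)) \<longlonglongrightarrow> h (X t \<omega> - X s \<omega>)"
        by (rule continuous_on_tendsto_compose[OF cont]) auto
    qed
  qed (use B in auto)
  then show ?thesis using s t pos by (simp add: integral_law)
qed

text \<open>An arbitrary time \<open>t\<close> is approached from the right by rational times, along which the paths
  converge.\<close>

lemma lip_association_all_times:
  assumes triplet: "\<And>s. 0 \<le> s \<Longrightarrow> characteristic_triplet M (X s) (b s) 0 (\<nu> s)"
    and null: "\<And>s. s \<in> \<rat> \<Longrightarrow> 0 \<le> s \<Longrightarrow> emeasure (\<nu> s) (- (nonneg_orthant \<union> nonpos_orthant)) = 0"
    and st: "0 \<le> s" "s \<le> t" and L: "0 \<le> L" and f: "lip_mono L B f" and g: "lip_mono L B g"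
  shows "(\<integral>x. f x \<partial>law s t) * (\<integral>x. g x \<partial>law s t) \<le> (\<integral>x. f x * g x \<partial>law s t)"
proof -
  have "\<exists>q\<in>\<rat>. t < q \<and> q < t + 1 / real (Suc i)" for i
    by (rule Rats_dense_in_real) simp
  then obtain r where r: "\<And>i. r i \<in> \<rat>" "\<And>i. t < r i" "\<And>i. r i < t + 1 / real (Suc i)" by metis
  have "(\<lambda>i. t + 1 / real (Suc i)) \<longlonglongrightarrow> t + 0"
    by (intro tendsto_intros LIMSEQ_Suc[OF lim_1_over_n])
  then have lim: "r \<longlonglongrightarrow> t"
    by (intro tendsto_sandwich[of "\<lambda>_. t" r sequentially "\<lambda>i. t + 1 / real (Suc i)"])
      (use r in \<open>auto intro!: always_eventually less_imp_le\<close>)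
  have t: "0 \<le> t" using st by simp
  have B: "0 \<le> B" using lip_monoD(3)[OF f, of 0] by simp
  have fgB: "\<bar>f x * g x\<bar> \<le> B * B" for x
    using lip_monoD(3)[OF f, of x] lip_monoD(3)[OF g, of x] B by (auto simp: abs_mult intro: mult_mono)
  note cont = lip_mono_continuous[OF f] lip_mono_continuous[OF g]
  note conv = integral_law_right_continuous[OF st(1) t _ _ r(2) lim]
  have "(\<integral>x. f x \<partial>law s (r i)) * (\<integral>x. g x \<partial>law s (r i)) \<le> (\<integral>x. f x * g x \<partial>law s (r i))" for i
  proof -
    have "0 \<le> r i" "s \<le> r i" using r(2)[of i] st by auto
    then show ?thesis using r(1) L f g st(1)
      by (intro lip_association_of_orthant_jumps[OF _ _ triplet null])
  qed
  then show ?thesis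
    by (intro LIMSEQ_le[OF tendsto_mult[OF conv[OF cont(1) lip_monoD(3)[OF f]] conv[OF cont(2) lip_monoD(3)[OF g]]]
        conv[OF continuous_on_mult[OF cont] fgB]]) auto
qed

lemma spatially_associated_if_orthant_jumps:
  assumes triplet: "\<And>s. 0 \<le> s \<Longrightarrow> characteristic_triplet M (X s) (b s) 0 (\<nu> s)"
    and null: "\<And>s. s \<in> \<rat> \<Longrightarrow> 0 \<le> s \<Longrightarrow> emeasure (\<nu> s) (- (nonneg_orthant \<union> nonpos_orthant)) = 0"
  shows "spatially_associated M X"
  unfolding spatially_associated_def
proof (intro allI impI, elim conjE)
  fix s t :: real and f g :: "real ^ 'n \<Rightarrow> real" and x :: "real ^ 'n"
  assume st: "0 \<le> s" "s \<le> t"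
    and f: "continuous_on UNIV f" "bounded (range f)" "nondecreasing_each f"
    and g: "continuous_on UNIV g" "bounded (range g)" "nondecreasing_each g"
  have t: "0 \<le> t" using st by simp
  interpret D: prob_space "law s t" using st(1) t by (rule prob_space_law)
  note D = prob_space_law[OF st(1) t] sets_law
  obtain Bf Bg where "\<And>y. \<bar>f y\<bar> \<le> Bf" "\<And>y. \<bar>g y\<bar> \<le> Bg"
    using f(2) g(2) unfolding bounded_iff by fastforce
  then have B: "\<bar>f y\<bar> \<le> max Bf Bg" "\<bar>g y\<bar> \<le> max Bf Bg" for y by (auto intro: max.coboundedI1 max.coboundedI2)
  define B where "B = max Bf Bg"
  define F where "F y = f (y + x)" for y
  define H where "H y = g (y + x)" for y
  have FB: "\<bar>F y\<bar> \<le> B" "\<bar>H y\<bar> \<le> B" for y using B by (auto simp: F_def H_def B_def)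
  have mono: "F y \<le> F z" "H y \<le> H z" if "y \<le> z" for y z
    using that f(3) g(3) unfolding nondecreasing_each_iff F_def H_def by (auto simp: less_eq_vec_def)
  have cont: "continuous_on UNIV F" "continuous_on UNIV H"
    unfolding F_def H_def by (intro continuous_on_compose2[OF f(1)] continuous_on_compose2[OF g(1)] continuous_intros; simp)+
  have lipF: "lip_mono (real m) B (inf_conv F m)" and lipH: "lip_mono (real m) B (inf_conv H m)" for m
    by (rule inf_conv_lip[OF mono(1) FB(1)], assumption) (rule inf_conv_lip[OF mono(2) FB(2)], assumption)
  have [measurable]: "inf_conv F m \<in> borel_measurable borel" "inf_conv H m \<in> borel_measurable borel"
    "F \<in> borel_measurable borel" "H \<in> borel_measurable borel" for m
    using lip_mono_measurable[OF lipF] lip_mono_measurable[OF lipH] cont by (auto intro: borel_measurable_continuous_onI)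
  have lim: "(\<lambda>m. inf_conv F m y) \<longlonglongrightarrow> F y" "(\<lambda>m. inf_conv H m y) \<longlonglongrightarrow> H y" for y
    by (rule inf_conv_tendsto[OF mono(1) FB(1) cont(1)], assumption)
      (rule inf_conv_tendsto[OF mono(2) FB(2) cont(2)], assumption)
  have B0: "0 \<le> B" using FB(1)[of 0] by simp
  have prodB: "\<bar>inf_conv F m y * inf_conv H m y\<bar> \<le> B * B" for m y
    using lip_monoD(3)[OF lipF[of m], of y] lip_monoD(3)[OF lipH[of m], of y] B0 by (auto simp: abs_mult intro: mult_mono)
  have conv: "(\<lambda>m. \<integral>y. h m y \<partial>law s t) \<longlonglongrightarrow> (\<integral>y. h' y \<partial>law s t)"
    if "\<And>m. h m \<in> borel_measurable borel" "h' \<in> borel_measurable borel" "\<And>m y. \<bar>h m y\<bar> \<le> C" "\<And>y. (\<lambda>m. h m y) \<longlonglongrightarrow> h' y"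
    for h :: "nat \<Rightarrow> real ^ 'n \<Rightarrow> real" and h' C
    by (rule integral_dominated_convergence[where w = "\<lambda>_. C"])
      (use that in \<open>auto simp: measurable_cong_sets[OF sets_law refl]\<close>)
  have "(\<integral>y. F y \<partial>law s t) * (\<integral>y. H y \<partial>law s t) \<le> (\<integral>y. F y * H y \<partial>law s t)"
  proof (rule LIMSEQ_le)
    show "(\<lambda>m. (\<integral>y. inf_conv F m y \<partial>law s t) * (\<integral>y. inf_conv H m y \<partial>law s t)) \<longlonglongrightarrow>
       (\<integral>y. F y \<partial>law s t) * (\<integral>y. H y \<partial>law s t)"
      by (intro tendsto_mult conv[OF _ _ lip_monoD(3)[OF lipF] lim(1)] conv[OF _ _ lip_monoD(3)[OF lipH] lim(2)]) measurable
    show "(\<lambda>m. \<integral>y. inf_conv F m y * inf_conv H m y \<partial>law s t) \<longlonglongrightarrow> (\<integral>y. F y * H y \<partial>law s t)"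
      by (intro conv[OF _ _ prodB tendsto_mult[OF lim]]) measurable
    show "\<exists>m0. \<forall>m\<ge>m0. (\<integral>y. inf_conv F m y \<partial>law s t) * (\<integral>y. inf_conv H m y \<partial>law s t)
        \<le> (\<integral>y. inf_conv F m y * inf_conv H m y \<partial>law s t)"
      using lip_association_all_times[OF triplet null st _ lipF lipH] by auto
  qed
  then show "markov_evolution M X s t f x * markov_evolution M X s t g x \<le> markov_evolution M X s t (\<lambda>y. f y * g y) x"
    using borel_measurable_times[OF \<open>F \<in> borel_measurable borel\<close> \<open>H \<in> borel_measurable borel\<close>]
      integral_law[OF st(1) t, of F] integral_law[OF st(1) t, of H] integral_law[OF st(1) t, of "\<lambda>y. F y * H y"]
    by (simp add: markov_evolution_def F_def H_def)
qed

end

section \<open>Association implies jumps in the orthants\<close>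

text \<open>Bounded increasing functions that see only displacements larger than \<open>\<epsilon>\<close> in one direction.
  The functions \<open>ramp i \<epsilon> y\<close> and \<open>- ramp j \<epsilon> (- y)\<close> are both non-decreasing, but have a non-positive
  product.\<close>

definition ramp :: "'n \<Rightarrow> real \<Rightarrow> real ^ 'n \<Rightarrow> real" where
  "ramp i \<epsilon> y = min 1 (max 0 (y $ i - \<epsilon>))"

lemma ramp_bounds: "0 \<le> ramp i \<epsilon> y" "ramp i \<epsilon> y \<le> 1"
  by (auto simp: ramp_def)

lemma ramp_mono: "x \<le> y \<Longrightarrow> ramp i \<epsilon> x \<le> ramp i \<epsilon> y"
proof -
  assume "x \<le> y"
  then have "x $ i \<le> y $ i" by (simp add: less_eq_vec_def)
  then show ?thesis by (auto simp: ramp_def)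
qed

lemma ramp_lipschitz: "\<bar>ramp i \<epsilon> x - ramp i \<epsilon> y\<bar> \<le> norm (x - y)"
proof -
  have "\<bar>ramp i \<epsilon> x - ramp i \<epsilon> y\<bar> \<le> \<bar>x $ i - y $ i\<bar>" unfolding ramp_def by linarith
  also have "\<dots> \<le> norm (x - y)" using component_le_norm_cart[of "x - y" i] by simp
  finally show ?thesis .
qed

lemma ramp_lip_mono: "lip_mono 1 1 (ramp i \<epsilon>)" "lip_mono 1 1 (\<lambda>y. - ramp i \<epsilon> (- y))"
proof -
  show "lip_mono 1 1 (ramp i \<epsilon>)"
    using ramp_mono ramp_lipschitz by (auto simp: lip_mono_def ramp_bounds)
  have "- ramp i \<epsilon> (- x) \<le> - ramp i \<epsilon> (- y)" if "x \<le> y" for x y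
    using ramp_mono[of "- y" "- x" i \<epsilon>] that by (simp add: less_eq_vec_def)
  moreover have "\<bar>- ramp i \<epsilon> (- x) - - ramp i \<epsilon> (- y)\<bar> \<le> 1 * norm (x - y)" for x y
    using ramp_lipschitz[of i \<epsilon> "- y" "- x"] by (simp add: norm_minus_commute)
  ultimately show "lip_mono 1 1 (\<lambda>y. - ramp i \<epsilon> (- y))"
    by (auto simp: lip_mono_def ramp_bounds)
qed

lemma ramp_le_norm: "0 \<le> \<epsilon> \<Longrightarrow> ramp i \<epsilon> y \<le> min 1 (norm y)"
  using component_le_norm_cart[of y i] by (auto simp: ramp_def)

lemma ramp_zero: "norm y < \<epsilon> \<Longrightarrow> ramp i \<epsilon> y = 0"
  using component_le_norm_cart[of y i] by (auto simp: ramp_def)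

lemma ramp_continuous: "continuous_on A (ramp i \<epsilon>)"
  unfolding ramp_def by (intro continuous_intros)

lemma ramp_measurable[measurable]: "ramp i \<epsilon> \<in> borel_measurable borel"
  by (intro borel_measurable_continuous_onI ramp_continuous)

definition lip_associated :: "(real ^ 'n) measure \<Rightarrow> bool" where
  "lip_associated D \<longleftrightarrow> (\<forall>L B f g. lip_mono L B f \<longrightarrow> lip_mono L B g \<longrightarrow>
     (\<integral>x. f x \<partial>D) * (\<integral>x. g x \<partial>D) \<le> (\<integral>x. f x * g x \<partial>D))"

text \<open>For fixed \<open>y\<close> the functions \<open>f (x - y)\<close> and \<open>g (x - y)\<close> are non-decreasing in \<open>x\<close>. Averaged over
  \<open>x\<close> they are both non-increasing in \<open>y\<close>, and reversing both signs does not change a product.\<close>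

lemma lip_associated_sym_law:
  fixes D :: "(real ^ 'n) measure"
  assumes D: "prob_space D" "sets D = sets borel" and assoc: "lip_associated D"
  shows "lip_associated (sym_law D)"
  unfolding lip_associated_def
proof (intro allI impI)
  fix L B and f g :: "real ^ 'n \<Rightarrow> real" assume f: "lip_mono L B f" and g: "lip_mono L B g"
  interpret prob_space D by fact
  have [measurable]: "f \<in> borel_measurable borel" "g \<in> borel_measurable borel"
    using f g by (auto intro: lip_mono_measurable)
  note [measurable_cong] = D(2)
  have B: "0 \<le> B" using lip_monoD(3)[OF f, of 0] by simp
  have fgB: "\<bar>f x * g x\<bar> \<le> B * B" for x
    using lip_monoD(3)[OF f, of x] lip_monoD(3)[OF g, of x] B by (auto simp: abs_mult intro: mult_mono)
  have shift: "lip_mono L B (\<lambda>x. h (x - y))" if "lip_mono L B h" for h :: "real ^ 'n \<Rightarrow> real" and y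
  proof -
    have "\<bar>h (x - y) - h (x' - y)\<bar> \<le> L * norm (x - x')" for x x'
      using lip_monoD(2)[OF that, of "x - y" "x' - y"] by simp
    then show ?thesis using that by (auto simp: lip_mono_def less_eq_vec_def)
  qed
  define F where "F y = - (\<integral>x. f (x - y) \<partial>D)" for y
  define H where "H y = - (\<integral>x. g (x - y) \<partial>D)" for y
  have refl: "lip_mono L B (\<lambda>y. - h (- y))" if "lip_mono L B h" for h :: "real ^ 'n \<Rightarrow> real"
  proof -
    have "\<bar>- h (- x) - - h (- x')\<bar> \<le> L * norm (x - x')" for x x'
      using lip_monoD(2)[OF that, of "- x'" "- x"] by (simp add: norm_minus_commute)
    moreover have "- h (- x) \<le> - h (- y)" if "x \<le> y" for x y
      using lip_monoD(1)[OF \<open>lip_mono L B h\<close>, of "- y" "- x"] that by (simp add: less_eq_vec_def)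
    ultimately show ?thesis using that by (auto simp: lip_mono_def)
  qed
  have FH: "lip_mono L B F" "lip_mono L B H"
    unfolding F_def H_def using refl[OF lip_mono_average[OF D f]] refl[OF lip_mono_average[OF D g]]
    by (simp_all add: add.commute)
  have [measurable]: "F \<in> borel_measurable borel" "H \<in> borel_measurable borel"
    using FH by (auto intro: lip_mono_measurable)
  have iFH: "integrable D (\<lambda>y. F y * H y)"
  proof (rule prob_integrable[OF D, where B = "B * B"])
    show "\<bar>F x * H x\<bar> \<le> B * B" for x
      using lip_monoD(3)[OF FH(1), of x] lip_monoD(3)[OF FH(2), of x] B by (auto simp: abs_mult intro: mult_mono)
  qed measurable
  have "(\<integral>z. f z \<partial>sym_law D) * (\<integral>z. g z \<partial>sym_law D) = (\<integral>y. F y \<partial>D) * (\<integral>y. H y \<partial>D)"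
    using lip_monoD(3)[OF f] lip_monoD(3)[OF g] by (simp add: integral_sym_law(2)[OF D, where B = B] F_def H_def)
  also have "\<dots> \<le> (\<integral>y. F y * H y \<partial>D)"
    using assoc FH unfolding lip_associated_def by blast
  also have "\<dots> \<le> (\<integral>y. (\<integral>x. f (x - y) * g (x - y) \<partial>D) \<partial>D)"
  proof (rule integral_mono[OF iFH])
    have "(\<lambda>y. \<integral>x. f (x - y) * g (x - y) \<partial>D) \<in> borel_measurable D" by measurable
    moreover have "\<bar>\<integral>x. f (x - y) * g (x - y) \<partial>D\<bar> \<le> B * B" for y
    proof -
      have i: "integrable D (\<lambda>x. f (x - y) * g (x - y))"
        by (rule prob_integrable[OF D, where B = "B * B"]) (use fgB in auto)
      have "\<bar>\<integral>x. f (x - y) * g (x - y) \<partial>D\<bar> \<le> (\<integral>x. \<bar>f (x - y) * g (x - y)\<bar> \<partial>D)" by (rule integral_abs_bound)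
      also have "\<dots> \<le> (\<integral>x. B * B \<partial>D)" by (intro integral_mono integrable_abs i fgB) auto
      finally show ?thesis by (simp add: prob_space)
    qed
    ultimately show "integrable D (\<lambda>y. \<integral>x. f (x - y) * g (x - y) \<partial>D)"
      by (intro integrable_const_bound[where B = "B * B"]) auto
    show "F y * H y \<le> (\<integral>x. f (x - y) * g (x - y) \<partial>D)" for y
      using assoc shift[OF f, of y] shift[OF g, of y] unfolding lip_associated_def F_def H_def by simp
  qed
  also have "\<dots> = (\<integral>z. f z * g z \<partial>sym_law D)"
    using fgB by (intro integral_sym_law(2)[OF D, symmetric, where B = "B * B"]) auto
  finally show "(\<integral>z. f z \<partial>sym_law D) * (\<integral>z. g z \<partial>sym_law D) \<le> (\<integral>z. f z * g z \<partial>sym_law D)" .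
qed

context additive_process begin

lemma lip_associated_law:
  assumes "spatially_associated M X" and st: "0 \<le> s" "s \<le> t"
  shows "lip_associated (law s t)"
  unfolding lip_associated_def
proof (intro allI impI)
  fix L B and f g :: "real ^ 'n \<Rightarrow> real" assume f: "lip_mono L B f" and g: "lip_mono L B g"
  have reg: "continuous_on UNIV h \<and> bounded (range h) \<and> nondecreasing_each h" if "lip_mono L B h" for h :: "real ^ 'n \<Rightarrow> real"
    using lip_mono_continuous[OF that] lip_monoD[OF that]
    by (auto simp: nondecreasing_each_iff bounded_iff)
  have [measurable]: "f \<in> borel_measurable borel" "g \<in> borel_measurable borel"
    using f g by (auto intro: lip_mono_measurable)
  have "markov_evolution M X s t f 0 * markov_evolution M X s t g 0 \<le> markov_evolution M X s t (\<lambda>y. f y * g y) 0"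
    using assms reg[OF f] reg[OF g] unfolding spatially_associated_def by blast
  then show "(\<integral>x. f x \<partial>law s t) * (\<integral>x. g x \<partial>law s t) \<le> (\<integral>x. f x * g x \<partial>law s t)"
    using st by (simp add: markov_evolution_def integral_law)
qed

end

context refining_partitions begin

lemma ramp_sym_inc_le:
  assumes k: "k < N m" and \<epsilon>: "0 \<le> \<epsilon>"
  shows "(\<integral>y. ramp i \<epsilon> y \<partial>sym_law (inc m k)) \<le> 2 * osc (\<tau> m k) (\<tau> m (Suc k))"
proof -
  interpret D: prob_space "inc m k" by (rule prob_space_inc[OF k])
  note D = prob_space_inc[OF k] sets_law
  define w where "w = osc (\<tau> m k) (\<tau> m (Suc k))"
  have i1: "integrable (inc m k) (\<lambda>y. min 1 (norm y))"
    by (rule prob_integrable[OF D, where B = 1]) auto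
  have "(\<integral>y. ramp i \<epsilon> y \<partial>sym_law (inc m k)) = (\<integral>x. (\<integral>y. ramp i \<epsilon> (x - y) \<partial>inc m k) \<partial>inc m k)"
    by (intro integral_sym_law(1)[OF D, where B = 1]) (auto simp: ramp_bounds)
  also have "\<dots> \<le> (\<integral>x. min 1 (norm x) + w \<partial>inc m k)"
  proof (rule integral_mono)
    have i2: "integrable (inc m k) (\<lambda>y. ramp i \<epsilon> (x - y))" for x
      by (rule prob_integrable[OF D, where B = 1]) (auto simp: ramp_bounds)
    show "(\<integral>y. ramp i \<epsilon> (x - y) \<partial>inc m k) \<le> min 1 (norm x) + w" for x
    proof -
      have "(\<integral>y. ramp i \<epsilon> (x - y) \<partial>inc m k) \<le> (\<integral>y. min 1 (norm x) + min 1 (norm y) \<partial>inc m k)"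
      proof (rule integral_mono)
        fix y
        show "ramp i \<epsilon> (x - y) \<le> min 1 (norm x) + min 1 (norm y)"
          using ramp_le_norm[OF \<epsilon>, of i "x - y"] norm_triangle_ineq4[of x y] norm_ge_zero[of x] norm_ge_zero[of y] by linarith
      qed (use i1 i2 in auto)
      then show ?thesis using i1 by (simp add: D.prob_space w_def osc_def)
    qed
    have "(\<lambda>x. \<integral>y. ramp i \<epsilon> (x - y) \<partial>inc m k) \<in> borel_measurable borel"
    proof -
      have "(\<lambda>x. \<integral>y. - ramp i \<epsilon> (- (- x + y)) \<partial>inc m k) \<in> borel_measurable borel"
        using lip_mono_measurable[OF lip_mono_average[OF D ramp_lip_mono(2)[of i \<epsilon>]]]
        by (rule measurable_compose[rotated]) measurable
      then show ?thesis by (simp add: add.commute)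
    qed
    moreover have "\<bar>\<integral>y. ramp i \<epsilon> (x - y) \<partial>inc m k\<bar> \<le> 1" for x
    proof -
      have "(\<integral>y. ramp i \<epsilon> (x - y) \<partial>inc m k) \<le> (\<integral>y. 1 \<partial>inc m k)"
        by (intro integral_mono i2 ramp_bounds) auto
      moreover have "0 \<le> (\<integral>y. ramp i \<epsilon> (x - y) \<partial>inc m k)" by (intro integral_nonneg_AE) (auto simp: ramp_bounds)
      ultimately show ?thesis by (simp add: D.prob_space)
    qed
    ultimately show "integrable (inc m k) (\<lambda>x. \<integral>y. ramp i \<epsilon> (x - y) \<partial>inc m k)"
      by (intro prob_integrable[OF D])
  qed (use i1 in auto)
  also have "\<dots> = 2 * w" using i1 by (simp add: D.prob_space w_def osc_def)
  finally show ?thesis by (simp add: w_def)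
qed

text \<open>Association bounds the expectation of the product of the two ramps by the product of their
  expectations. Summed over the partition this is at most the largest expectation of the first ramp,
  which tends to zero, times the sum of the expectations of the second, which stays bounded.\<close>

lemma opposite_ramps_vanish:
  assumes assoc: "\<And>m k. k < N m \<Longrightarrow> lip_associated (inc m k)" and \<epsilon>: "0 < \<epsilon>"
  shows "(\<lambda>m. \<integral>y. ramp i \<epsilon> y * ramp j \<epsilon> (- y) \<partial>\<mu> m) \<longlonglongrightarrow> 0"
proof -
  let ?J = "\<lambda>m. \<integral>y. ramp j \<epsilon> (- y) \<partial>\<mu> m"
  have bnd: "\<bar>ramp i \<epsilon> y\<bar> \<le> 1" for i and y :: "real ^ 'n" using ramp_bounds[of i \<epsilon> y] by simp
  have J0: "0 \<le> ?J m" for m by (intro integral_nonneg_AE) (auto simp: ramp_bounds)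
  have "(\<lambda>m. \<integral>y. ramp j \<epsilon> y + ramp j \<epsilon> (- y) \<partial>\<mu> m) \<longlonglongrightarrow> (\<integral>y. ramp j \<epsilon> y + ramp j \<epsilon> (- y) \<partial>scale_measure 2 \<nu>)"
  proof (rule tendsto_integral_even[where B = 2 and \<epsilon> = \<epsilon>])
    show "continuous_on UNIV (\<lambda>y. ramp j \<epsilon> y + ramp j \<epsilon> (- y))"
      by (intro continuous_intros continuous_on_compose2[OF ramp_continuous[of UNIV]]) auto
    show "\<bar>ramp j \<epsilon> y + ramp j \<epsilon> (- y)\<bar> \<le> 2" for y using ramp_bounds[of j \<epsilon> y] ramp_bounds[of j \<epsilon> "- y"] by simp
  qed (use \<epsilon> in \<open>auto simp: ramp_zero add.commute\<close>)
  then have "Bseq (\<lambda>m. \<integral>y. ramp j \<epsilon> y + ramp j \<epsilon> (- y) \<partial>\<mu> m)" by (intro convergent_imp_Bseq convergentI)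
  then obtain C where C: "\<And>m. norm (\<integral>y. ramp j \<epsilon> y + ramp j \<epsilon> (- y) \<partial>\<mu> m) \<le> C" by (auto simp: Bseq_def)
  have J: "?J m \<le> C" for m
  proof -
    have "?J m \<le> (\<integral>y. ramp j \<epsilon> y + ramp j \<epsilon> (- y) \<partial>\<mu> m)"
      by (intro integral_mono Bochner_Integration.integrable_add integrable_mu[where B = 1]) (auto simp: bnd ramp_bounds)
    then show ?thesis using C[of m] by simp
  qed
  have C0: "0 \<le> C" using J0[of 0] J[of 0] by simp
  have pos: "0 \<le> ramp i \<epsilon> y * ramp j \<epsilon> (- y)" "ramp i \<epsilon> y * ramp j \<epsilon> (- y) \<le> 1" for y
    using ramp_bounds[of i \<epsilon> y] ramp_bounds[of j \<epsilon> "- y"] by (auto intro: mult_le_one)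
  show ?thesis
  proof (rule LIMSEQ_I)
    fix e :: real assume e: "0 < e"
    define \<delta> where "\<delta> = e / (2 * (C + 1))"
    have \<delta>: "0 < \<delta>" using e C0 by (simp add: \<delta>_def)
    have "2 * \<delta> * C < e" using e C0 by (simp add: \<delta>_def field_simps)
    have "eventually (\<lambda>m. norm ((\<integral>y. ramp i \<epsilon> y * ramp j \<epsilon> (- y) \<partial>\<mu> m) - 0) < e) sequentially"
      using osc_mesh[OF \<delta>]
    proof (rule eventually_mono)
      fix m assume small: "\<forall>k<N m. osc (\<tau> m k) (\<tau> m (Suc k)) < \<delta>"
      have "(\<integral>y. ramp i \<epsilon> y * ramp j \<epsilon> (- y) \<partial>\<mu> m) = (\<Sum>k<N m. \<integral>y. ramp i \<epsilon> y * ramp j \<epsilon> (- y) \<partial>sym_law (inc m k))"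
        by (rule integral_mu[where B = 1]) (auto simp: pos)
      also have "\<dots> \<le> (\<Sum>k<N m. 2 * \<delta> * (\<integral>y. ramp j \<epsilon> (- y) \<partial>sym_law (inc m k)))"
      proof (rule sum_mono)
        fix k assume "k \<in> {..<N m}"
        then have k: "k < N m" by simp
        have "lip_associated (sym_law (inc m k))"
          by (intro lip_associated_sym_law prob_space_inc[OF k] assoc[OF k]) simp
        then have "(\<integral>y. ramp i \<epsilon> y \<partial>sym_law (inc m k)) * (\<integral>y. - ramp j \<epsilon> (- y) \<partial>sym_law (inc m k))
            \<le> (\<integral>y. ramp i \<epsilon> y * - ramp j \<epsilon> (- y) \<partial>sym_law (inc m k))"
          using ramp_lip_mono unfolding lip_associated_def by blast
        then have "(\<integral>y. ramp i \<epsilon> y * ramp j \<epsilon> (- y) \<partial>sym_law (inc m k)) \<le>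
            (\<integral>y. ramp i \<epsilon> y \<partial>sym_law (inc m k)) * (\<integral>y. ramp j \<epsilon> (- y) \<partial>sym_law (inc m k))" by simp
        also have "\<dots> \<le> 2 * \<delta> * (\<integral>y. ramp j \<epsilon> (- y) \<partial>sym_law (inc m k))"
        proof (rule mult_right_mono)
          show "(\<integral>y. ramp i \<epsilon> y \<partial>sym_law (inc m k)) \<le> 2 * \<delta>"
            using ramp_sym_inc_le[OF k less_imp_le[OF \<epsilon>], of i] small k by fastforce
        qed (intro integral_nonneg_AE, auto simp: ramp_bounds)
        finally show "(\<integral>y. ramp i \<epsilon> y * ramp j \<epsilon> (- y) \<partial>sym_law (inc m k)) \<le>
            2 * \<delta> * (\<integral>y. ramp j \<epsilon> (- y) \<partial>sym_law (inc m k))" .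
      qed
      also have "\<dots> = 2 * \<delta> * ?J m"
        unfolding sum_distrib_left[symmetric]
        by (subst integral_mu[where B = 1]) (auto simp: ramp_bounds)
      also have "\<dots> \<le> 2 * \<delta> * C" using J \<delta> by (intro mult_left_mono) auto
      finally have "(\<integral>y. ramp i \<epsilon> y * ramp j \<epsilon> (- y) \<partial>\<mu> m) < e" using \<open>2 * \<delta> * C < e\<close> by simp
      moreover have "0 \<le> (\<integral>y. ramp i \<epsilon> y * ramp j \<epsilon> (- y) \<partial>\<mu> m)"
        by (intro integral_nonneg_AE) (auto simp: pos)
      ultimately show "norm ((\<integral>y. ramp i \<epsilon> y * ramp j \<epsilon> (- y) \<partial>\<mu> m) - 0) < e" by simp
    qed
    then show "\<exists>m0. \<forall>m\<ge>m0. norm ((\<integral>y. ramp i \<epsilon> y * ramp j \<epsilon> (- y) \<partial>\<mu> m) - 0) < e"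
      by (simp add: eventually_sequentially)
  qed
qed

text \<open>Adding the product with \<open>i\<close> and \<open>j\<close> exchanged makes the test function even.\<close>

lemma opposite_signs_null:
  assumes assoc: "\<And>m k. k < N m \<Longrightarrow> lip_associated (inc m k)" and \<epsilon>: "0 < \<epsilon>"
  shows "emeasure \<nu> {y. \<epsilon> < y $ i \<and> y $ j < - \<epsilon>} = 0"
proof -
  let ?H = "\<lambda>y. ramp i \<epsilon> y * ramp j \<epsilon> (- y) + ramp j \<epsilon> y * ramp i \<epsilon> (- y)"
  have pos: "0 \<le> ramp i \<epsilon> y * ramp j \<epsilon> (- y)" "ramp i \<epsilon> y * ramp j \<epsilon> (- y) \<le> 1" for i j y
    using ramp_bounds[of i \<epsilon> y] ramp_bounds[of j \<epsilon> "- y"] by (auto intro: mult_le_one)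
  have sets: "sets \<nu> = sets borel" using levy_nu by (simp add: levy_measure_def)
  have cont: "continuous_on UNIV ?H"
    by (intro continuous_intros continuous_on_compose2[OF ramp_continuous[of UNIV]]) auto
  have H0: "0 \<le> ?H y" for y using pos(1)[of i y j] pos(1)[of j y i] by simp
  have H2: "\<bar>?H y\<bar> \<le> 2" for y using pos[of i y j] pos[of j y i] by simp
  have "(\<lambda>m. \<integral>y. ?H y \<partial>\<mu> m) \<longlonglongrightarrow> (\<integral>y. ?H y \<partial>scale_measure 2 \<nu>)"
    by (rule tendsto_integral_even[where B = 2 and \<epsilon> = \<epsilon>, OF cont H2]) (use \<epsilon> in \<open>auto simp: ramp_zero mult.commute add.commute\<close>)
  moreover have "(\<lambda>m. \<integral>y. ?H y \<partial>\<mu> m) \<longlonglongrightarrow> 0 + 0"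
  proof -
    have "(\<integral>y. ?H y \<partial>\<mu> m) = (\<integral>y. ramp i \<epsilon> y * ramp j \<epsilon> (- y) \<partial>\<mu> m) + (\<integral>y. ramp j \<epsilon> y * ramp i \<epsilon> (- y) \<partial>\<mu> m)" for m
      by (intro Bochner_Integration.integral_add integrable_mu[where B = 1]) (auto simp: pos abs_of_nonneg)
    then show ?thesis by (simp only:) (intro tendsto_add opposite_ramps_vanish assoc \<epsilon>)
  qed
  ultimately have "(\<integral>y. ?H y \<partial>scale_measure 2 \<nu>) = 0" using LIMSEQ_unique by fastforce
  moreover have "integrable (scale_measure 2 \<nu>) ?H"
    using cont by (intro levy_integrable_off_zero[OF levy _ H2 \<epsilon>] borel_measurable_continuous_onI) (auto simp: ramp_zero)
  ultimately have "AE y in scale_measure 2 \<nu>. ?H y = 0"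
    using H0 by (subst (asm) integral_nonneg_eq_0_iff_AE) auto
  then have "AE y in scale_measure 2 \<nu>. \<not> (\<epsilon> < y $ i \<and> y $ j < - \<epsilon>)"
  proof eventually_elim
    case (elim y)
    have "0 < ramp i \<epsilon> y * ramp j \<epsilon> (- y)" if "\<epsilon> < y $ i \<and> y $ j < - \<epsilon>"
      using that by (intro mult_pos_pos) (auto simp: ramp_def)
    then show ?case using elim pos(1)[of j y i] by fastforce
  qed
  then have "emeasure (scale_measure 2 \<nu>) {y \<in> space (scale_measure 2 \<nu>). \<epsilon> < y $ i \<and> y $ j < - \<epsilon>} = 0"
    by (subst (asm) AE_iff_measurable[OF _ refl]) (auto simp: sets sets_eq_imp_space_eq[OF sets])
  moreover have "space (scale_measure 2 \<nu>) = UNIV" using sets_eq_imp_space_eq[OF sets] by (simp add: space_scale_measure)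
  ultimately show ?thesis by simp
qed

end

lemma orthant_complement_eq:
  "- (nonneg_orthant \<union> nonpos_orthant) =
     (\<Union>i. \<Union>j. \<Union>m. {y :: real ^ 'n. inverse (real (Suc m)) < y $ i \<and> y $ j < - inverse (real (Suc m))})"
proof (intro set_eqI iffI)
  fix y :: "real ^ 'n"
  assume "y \<in> - (nonneg_orthant \<union> nonpos_orthant)"
  then obtain i j where ij: "0 < y $ i" "y $ j < 0"
    by (auto simp: nonneg_orthant_def nonpos_orthant_def not_le)
  then obtain m where "inverse (real (Suc m)) < min (y $ i) (- y $ j)"
    using reals_Archimedean[of "min (y $ i) (- y $ j)"] by auto
  then show "y \<in> (\<Union>i. \<Union>j. \<Union>m. {y :: real ^ 'n. inverse (real (Suc m)) < y $ i \<and> y $ j < - inverse (real (Suc m))})"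
    by (auto simp del: of_nat_Suc) (metis less_minus_iff)
next
  fix y :: "real ^ 'n"
  assume "y \<in> (\<Union>i. \<Union>j. \<Union>m. {y :: real ^ 'n. inverse (real (Suc m)) < y $ i \<and> y $ j < - inverse (real (Suc m))})"
  then obtain i j m where "inverse (real (Suc m)) < y $ i" "y $ j < - inverse (real (Suc m))" by blast
  moreover have "0 < inverse (real (Suc m))" by simp
  ultimately have "0 < y $ i" "y $ j < 0" by linarith+
  then show "y \<in> - (nonneg_orthant \<union> nonpos_orthant)"
    by (auto simp: nonneg_orthant_def nonpos_orthant_def not_le)
qed

text \<open>This direction takes \<open>s = 0\<close> in the partition: its first half then consists of trivial
  steps.\<close>

lemma (in additive_process) orthant_jumps_if_spatially_associated:
  assumes assoc: "spatially_associated M X" and t: "0 \<le> t"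
    and triplet: "characteristic_triplet M (X t) b 0 \<nu>"
  shows "emeasure \<nu> (- (nonneg_orthant \<union> nonpos_orthant)) = 0"
proof -
  interpret P: refining_partitions M G X t b \<nu> "two_piece 0 t" "\<lambda>m. 2 * Suc m"
    by (rule refining_two_piece[OF order_refl t triplet])
  have a: "lip_associated (P.inc m k)" if "k < 2 * Suc m" for m k
    using that by (intro lip_associated_law assoc P.tau_nonneg P.tau_mono) auto
  have [measurable_cong]: "sets \<nu> = sets borel" using P.levy_nu by (simp add: levy_measure_def)
  have null: "{y. inverse (real (Suc m)) < y $ i \<and> y $ j < - inverse (real (Suc m))} \<in> null_sets \<nu>" for i j m
  proof (rule null_setsI)
    show "emeasure \<nu> {y. inverse (real (Suc m)) < y $ i \<and> y $ j < - inverse (real (Suc m))} = 0"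
      by (rule P.opposite_signs_null) (use a in auto)
    have "{y \<in> space borel. inverse (real (Suc m)) < y $ i \<and> y $ j < - inverse (real (Suc m))} \<in> sets borel" by measurable
    then show "{y. inverse (real (Suc m)) < y $ i \<and> y $ j < - inverse (real (Suc m))} \<in> sets \<nu>"
      using \<open>sets \<nu> = sets borel\<close> by simp
  qed
  have "(\<Union>i. \<Union>j. \<Union>m. {y. inverse (real (Suc m)) < y $ i \<and> y $ j < - inverse (real (Suc m))}) \<in> null_sets \<nu>"
    by (intro null_sets_UN' null) (auto intro: countable_finite)
  then show ?thesis unfolding orthant_complement_eq by auto
qed

section \<open>The characterisation\<close>

theorem theorem4p4:
  fixes M :: "'w measure" and G :: "real \<Rightarrow> 'w measure"
    and X :: "real \<Rightarrow> 'w \<Rightarrow> real ^ 'n"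
    and b :: "real \<Rightarrow> real ^ 'n" and \<nu> :: "real \<Rightarrow> (real ^ 'n) measure"
  assumes "additive_process M G X"
    and "\<And>s. 0 \<le> s \<Longrightarrow> characteristic_triplet M (X s) (b s) 0 (\<nu> s)"
  shows "spatially_associated M X \<longleftrightarrow>
    (\<forall>s\<in>\<rat>. 0 \<le> s \<longrightarrow> emeasure (\<nu> s) (- (nonneg_orthant \<union> nonpos_orthant)) = 0)"
proof -
  interpret additive_process M G X by (rule assms(1))
  show ?thesis
    using spatially_associated_if_orthant_jumps[OF assms(2)] orthant_jumps_if_spatially_associated[OF _ _ assms(2)]
    by blast
qed

end
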